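(* Let $q\in\mathbb{C}$ with $|q|<1$, let $1\le r\le n$, and let $t,s$ be positive real numbers. Let $X=\{x_1,\dots,x_n\}$ and $Y=\{y_1,\dots,y_k\}$ be two sets of distinct non-negative real numbers such that $$t<\min_{1\le j\le n}\{x_j\}\le\max_{1\le j\le n}\{x_j\}<s\le\min_{1\le j\le n}\{|x_j|^{-1}\}\wedge\min_{1\le j\le k}\{|qy_j|^{-1}\}.$$ Then $$D^{r,q}_{n,X}Z(X;Y)=\frac{Z(X;Y)\,q^{r(r-1)/2}}{r!\,(2\pi \mathrm{i})^r(q-1)^r}\oint_{\mathcal{C}}\cdots\oint_{\mathcal{C}}\ \prod_{1\le i\ne j\le r}\frac{(z_i-z_j)(1-qz_iz_j)}{qz_i-z_j}\ \prod_{i=1}^r\frac{1-qz_i^2}{1-z_i^2}\ \prod_{1\le i<j\le r}\frac{1}{(1-q^2z_iz_j)(1-z_iz_j)}$$ $$\times\prod_{i=1}^r\prod_{j=1}^n\frac{(qz_i-x_j)(1-z_ix_j)}{(z_i-x_j)(1-qz_ix_j)}\ \prod_{i=1}^r\prod_{j=1}^k\frac{1-z_iy_j}{1-qz_iy_j}\ \prod_{i=1}^r\frac{dz_i}{z_i},$$ where the integral is $r$-fold and $\mathcal{C}=\mathcal{C}_1\cup\cdots\cup\mathcal{C}_n$, with $\mathcal{C}_i$ ($1\le i\le n$) a positively oriented closed contour around $x_i$ such that (i) $q\mathcal{C}_i$ lies outside the contour $\mathcal{C}$, and (ii) $\mathcal{C}_i$ contains no other poles of the integrand.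
   Context: For $q\in\mathbb{C}$ and a function $F(x_1,\dots,x_n)$, the shift operator is $T_{q,i}F(x_1,\dots,x_n)=F(x_1,\dots,qx_i,\dots,x_n)$. For $1\le r\le n$ the Macdonald $q$-difference operator (the Macdonald $(q,t)$-operator at $t=q$) is $$D^{r,q}_{n,X}=q^{r(r-1)/2}\sum_{I\subset\{1,\dots,n\},\,|I|=r}\ \prod_{i\in I,\,j\notin I}\frac{qx_i-x_j}{x_i-x_j}\ \prod_{i\in I}T_{q,i},\qquad X=\{x_1,\dots,x_n\};$$ it acts in the variables $X$, with $Y$ as parameters. $Z(X;Y)$ is the partition function of the Pfaffian Schur measure: $Z(X;Y)=\sum_\lambda\tau_\lambda(Y)s_\lambda(X)$ (sum over all partitions, assumed absolutely convergent, with $\tau_\lambda=\sum_{\mu:\,\mu'\text{ even}}s_{\lambda/\mu}$, where $\mu'$ is the transpose of $\mu$, a partition is even if all its parts are even, and $s$ denotes (skew) Schur functions), which equals $$Z(X;Y)=\prod_{1\le i<j\le n}\frac{1}{1-x_ix_j}\ \prod_{i=1}^n\prod_{j=1}^k\frac{1}{1-x_iy_j}.$$ $a\wedge b$ denotes the minimum. *)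

theory Defs
  imports "HOL-Complex_Analysis.Complex_Analysis"
begin

section \<open>Partitions and skew Schur polynomials\<close>

text \<open>
  A partition is a weakly decreasing, finitely supported sequence of parts, with the parts
  numbered from \<open>0\<close>. Containment of Young diagrams is the pointwise order \<open>\<mu> \<le> \<nu>\<close>.
\<close>

definition partition_seqs :: "(nat \<Rightarrow> nat) set" where
  "partition_seqs = {\<nu>. antimono \<nu> \<and> finite {i. \<nu> i \<noteq> 0}}"

definition transpose_part :: "(nat \<Rightarrow> nat) \<Rightarrow> nat \<Rightarrow> nat" where
  "transpose_part \<mu> j = card {i. j < \<mu> i}"

definition even_part :: "(nat \<Rightarrow> nat) \<Rightarrow> bool" where
  "even_part \<mu> \<longleftrightarrow> (\<forall>i. even (\<mu> i))"

definition skew_diagram :: "(nat \<Rightarrow> nat) \<Rightarrow> (nat \<Rightarrow> nat) \<Rightarrow> (nat \<times> nat) set" where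
  "skew_diagram \<nu> \<mu> = {(i, j). \<mu> i \<le> j \<and> j < \<nu> i}"

text \<open>Semistandard tableaux of shape \<open>\<nu>/\<mu>\<close> with entries in \<open>{1..n}\<close>.\<close>

definition ssyt :: "nat \<Rightarrow> (nat \<Rightarrow> nat) \<Rightarrow> (nat \<Rightarrow> nat) \<Rightarrow> (nat \<times> nat \<Rightarrow> nat) set" where
  "ssyt n \<nu> \<mu> = {T \<in> skew_diagram \<nu> \<mu> \<rightarrow>\<^sub>E {1..n}.
     (\<forall>i j j'. (i, j) \<in> skew_diagram \<nu> \<mu> \<and> (i, j') \<in> skew_diagram \<nu> \<mu> \<and> j \<le> j'
         \<longrightarrow> T (i, j) \<le> T (i, j')) \<and>
     (\<forall>i i' j. (i, j) \<in> skew_diagram \<nu> \<mu> \<and> (i', j) \<in> skew_diagram \<nu> \<mu> \<and> i < i'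
         \<longrightarrow> T (i, j) < T (i', j))}"

definition skew_schur ::
  "nat \<Rightarrow> (nat \<Rightarrow> nat) \<Rightarrow> (nat \<Rightarrow> nat) \<Rightarrow> (nat \<Rightarrow> complex) \<Rightarrow> complex" where
  "skew_schur n \<nu> \<mu> x =
     (if \<mu> \<le> \<nu> then \<Sum>T\<in>ssyt n \<nu> \<mu>. \<Prod>c\<in>skew_diagram \<nu> \<mu>. x (T c) else 0)"

definition schur :: "nat \<Rightarrow> (nat \<Rightarrow> nat) \<Rightarrow> (nat \<Rightarrow> complex) \<Rightarrow> complex" where
  "schur n \<nu> x = skew_schur n \<nu> (\<lambda>_. 0) x"


section \<open>The partition function of the Pfaffian Schur measure\<close>

text \<open>
  In \<open>pf_tau\<close> the terms with \<open>\<not> \<mu> \<le> \<nu>\<close> vanish; they are left out so that the sum is finite.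
\<close>

definition pf_tau :: "nat \<Rightarrow> (nat \<Rightarrow> complex) \<Rightarrow> (nat \<Rightarrow> nat) \<Rightarrow> complex" where
  "pf_tau k y \<nu> =
     (\<Sum>\<mu> | \<mu> \<in> partition_seqs \<and> even_part (transpose_part \<mu>) \<and> \<mu> \<le> \<nu>. skew_schur k \<nu> \<mu> y)"

definition pf_Z :: "nat \<Rightarrow> nat \<Rightarrow> (nat \<Rightarrow> complex) \<Rightarrow> (nat \<Rightarrow> complex) \<Rightarrow> complex" where
  "pf_Z n k y x = (\<Sum>\<^sub>\<infinity>\<nu>\<in>partition_seqs. pf_tau k y \<nu> * schur n \<nu> x)"

definition pf_Z_abs_convergent ::
  "nat \<Rightarrow> nat \<Rightarrow> (nat \<Rightarrow> complex) \<Rightarrow> (nat \<Rightarrow> complex) \<Rightarrow> bool" where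
  "pf_Z_abs_convergent n k y x \<longleftrightarrow>
     (\<lambda>\<nu>. norm (pf_tau k y \<nu> * schur n \<nu> x)) summable_on partition_seqs"


section \<open>The Macdonald q-difference operator\<close>

definition qshift ::
  "complex \<Rightarrow> nat \<Rightarrow> ((nat \<Rightarrow> complex) \<Rightarrow> complex) \<Rightarrow> (nat \<Rightarrow> complex) \<Rightarrow> complex" where
  "qshift q i F x = F (x(i := q * x i))"

text \<open>
  The composition of the commuting operators \<open>qshift q i\<close>, \<open>i \<in> I\<close>; the two lemmas below
  determine it for finite \<open>I\<close>.
\<close>

definition qshifts ::
  "complex \<Rightarrow> nat set \<Rightarrow> ((nat \<Rightarrow> complex) \<Rightarrow> complex) \<Rightarrow> (nat \<Rightarrow> complex) \<Rightarrow> complex" where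
  "qshifts q I F x = F (\<lambda>i. if i \<in> I then q * x i else x i)"

lemma qshifts_empty: "qshifts q {} F = F"
  by (simp add: qshifts_def fun_eq_iff)

lemma qshifts_insert:
  assumes "i \<notin> I"
  shows "qshifts q (insert i I) F = qshift q i (qshifts q I F)"
proof
  fix x
  have "(\<lambda>j. if j \<in> insert i I then q * x j else x j) =
        (\<lambda>j. if j \<in> I then q * (x(i := q * x i)) j else (x(i := q * x i)) j)"
    using assms by (auto simp: fun_eq_iff)
  then show "qshifts q (insert i I) F x = qshift q i (qshifts q I F) x"
    by (simp only: qshifts_def qshift_def)
qed

definition macdonald_D ::
  "nat \<Rightarrow> complex \<Rightarrow> nat \<Rightarrow> ((nat \<Rightarrow> complex) \<Rightarrow> complex) \<Rightarrow> (nat \<Rightarrow> complex) \<Rightarrow> complex" where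
  "macdonald_D r q n F x =
     q ^ (r * (r - 1) div 2) *
     (\<Sum>I | I \<subseteq> {1..n} \<and> card I = r.
        (\<Prod>i\<in>I. \<Prod>j\<in>{1..n} - I. (q * x i - x j) / (x i - x j)) * qshifts q I F x)"


section \<open>The contour integral\<close>

text \<open>
  The integrand in \<open>z 1, \<dots>, z r\<close>; the factors \<open>1 / z i\<close> of the measure \<open>dz\<^sub>i / z\<^sub>i\<close> are part
  of it, so that \<open>0\<close> counts among its poles.
\<close>

definition D_integrand ::
  "complex \<Rightarrow> nat \<Rightarrow> nat \<Rightarrow> nat \<Rightarrow> (nat \<Rightarrow> complex) \<Rightarrow> (nat \<Rightarrow> complex) \<Rightarrow> (nat \<Rightarrow> complex) \<Rightarrow> complex"
where
  "D_integrand q r n k x y z =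
     (\<Prod>i=1..r. \<Prod>j\<in>{1..r} - {i}. (z i - z j) * (1 - q * z i * z j) / (q * z i - z j)) *
     (\<Prod>i=1..r. (1 - q * (z i)\<^sup>2) / (1 - (z i)\<^sup>2)) *
     (\<Prod>i=1..r. \<Prod>j\<in>{i<..r}. 1 / ((1 - q\<^sup>2 * z i * z j) * (1 - z i * z j))) *
     (\<Prod>i=1..r. \<Prod>j=1..n.
        ((q * z i - x j) * (1 - z i * x j)) / ((z i - x j) * (1 - q * z i * x j))) *
     (\<Prod>i=1..r. \<Prod>j=1..k. (1 - z i * y j) / (1 - q * z i * y j)) *
     (\<Prod>i=1..r. 1 / z i)"

text \<open>The integral over the contour made up of the closed curves \<open>\<gamma> 1, \<dots>, \<gamma> n\<close>.\<close>

definition multi_contour_integral ::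
  "nat \<Rightarrow> (nat \<Rightarrow> real \<Rightarrow> complex) \<Rightarrow> (complex \<Rightarrow> complex) \<Rightarrow> complex" where
  "multi_contour_integral n \<gamma> f = (\<Sum>i=1..n. contour_integral (\<gamma> i) f)"

text \<open>
  The iterated integral of \<open>F\<close> over the coordinates \<open>z 1, \<dots>, z r\<close> (innermost first); the
  remaining coordinates of \<open>z\<close> are parameters.
\<close>

primrec iterated_contour_integral ::
  "nat \<Rightarrow> (nat \<Rightarrow> real \<Rightarrow> complex) \<Rightarrow> nat \<Rightarrow> ((nat \<Rightarrow> complex) \<Rightarrow> complex)
     \<Rightarrow> (nat \<Rightarrow> complex) \<Rightarrow> complex" where
  "iterated_contour_integral n \<gamma> 0 F z = F z"
| "iterated_contour_integral n \<gamma> (Suc r) F z =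
     multi_contour_integral n \<gamma> (\<lambda>w. iterated_contour_integral n \<gamma> r F (z(Suc r := w)))"

text \<open>
  Each \<open>\<gamma> i\<close> is a positively oriented simple closed contour around \<open>x i\<close> such that
  \<open>q\<close> times it lies outside all the curves \<open>\<gamma> j\<close>, and neither the curve nor the region it
  encloses contains a pole of the integrand other than \<open>x i\<close>. Poles are taken in each
  variable \<open>z l\<close> separately, while the other variables run through the contour.
\<close>

definition admissible_contours ::
  "complex \<Rightarrow> nat \<Rightarrow> nat \<Rightarrow> nat \<Rightarrow> (nat \<Rightarrow> complex) \<Rightarrow> (nat \<Rightarrow> complex) \<Rightarrow> (nat \<Rightarrow> real \<Rightarrow> complex) \<Rightarrow> bool"
where
  "admissible_contours q r n k x y \<gamma> \<longleftrightarrow>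
     (\<forall>i\<in>{1..n}. valid_path (\<gamma> i) \<and> simple_path (\<gamma> i) \<and> pathfinish (\<gamma> i) = pathstart (\<gamma> i) \<and>
        x i \<in> inside (path_image (\<gamma> i)) \<and> winding_number (\<gamma> i) (x i) = 1) \<and>
     (\<forall>i\<in>{1..n}. \<forall>j\<in>{1..n}. \<forall>w\<in>path_image (\<gamma> i). q * w \<in> outside (path_image (\<gamma> j))) \<and>
     (\<forall>i\<in>{1..n}. \<forall>l\<in>{1..r}. \<forall>z.
        (\<forall>m\<in>{1..r} - {l}. z m \<in> (\<Union>j\<in>{1..n}. path_image (\<gamma> j))) \<longrightarrow>
        (\<forall>p \<in> path_image (\<gamma> i) \<union> inside (path_image (\<gamma> i)).
           is_pole (\<lambda>w. D_integrand q r n k x y (z(l := w))) p \<longrightarrow> p = x i))"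

end

theory Submission
  imports Defs
begin

text \<open>
  Both sides of the identity are sums over the subsets \<open>I\<close> of \<open>{1..n}\<close> with \<open>r\<close> elements, and they
  agree term by term. On the left this is the definition of the operator, and the ratio of the shifted
  to the original partition function is read off from the product formula for \<open>Z\<close>. On the right the
  sum comes from residues: the integrand is a product of a function \<open>F\<close> of one variable
  (\<open>one_var\<close>) over the \<open>z l\<close> and of a symmetric function \<open>P\<close> of two variables
  (\<open>pair_factor\<close>) over the pairs; inside the \<open>i\<close>-th curve only
  the simple pole of \<open>F\<close> at \<open>x i\<close> counts, and \<open>P u u = 0\<close> removes the residues in which two variables take the same \<open>x i\<close>. Each \<open>I\<close> then arises from its \<open>r!\<close> orderings.

  \<^bold>\<open>The product formula.\<close> A Schur polynomial is a sum over chains of interlacing partitions, one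
  step for each variable. Two facts about a single step suffice. Adding a horizontal strip commutes
  with removing one up to a geometric series (\<open>strip_weight_commute\<close>), by a bijection that
  reflects every row inside the interval allowed by its neighbours. On the indicator of the partitions
  with columns of even length, removing a strip has the same effect as adding one
  (\<open>strip_weight_reflect\<close>). Pushing all additions past all removals yields the Cauchy and the
  Littlewood products (\<open>partition_function_chains\<close>). For non-negative variables this is an
  identity in the extended non-negative reals, where sums may be interchanged freely; absolute
  convergence then says that the product is finite, so every factor is a convergent geometric series.
  Complex \<open>q\<close> is reached from real \<open>q\<close> by analytic continuation in the unit disc
  (\<open>pf_Z_qshift_product\<close>).

  \<^bold>\<open>The poles.\<close> As a function of \<open>z\<close>, \<open>P u z\<close> has its poles among \<open>q u\<close>, \<open>u / q\<close>,
  \<open>1 / u\<close> and \<open>1 / (q\<^sup>2 u)\<close>, the partners of \<open>u\<close>. The conditions on the contours speak of the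
  poles of the whole integrand while the other variables stay on the contour, and a factor may be
  cancelled there by a zero of another one. For all but finitely many \<open>u\<close> on the contour no such
  cancellation occurs, so no partner of \<open>u\<close> is enclosed by a curve
  (\<open>partners_avoid_generic\<close>). Once a variable has been replaced by its residue point, \<open>u\<close>
  becomes \<open>x i\<close>, a point inside a curve rather than on it. A partner of \<open>x i\<close> is still not
  enclosed (\<open>partners_avoid_x\<close>): otherwise the image under the corresponding map of the whole region
  inside the \<open>i\<close>-th curve, which is connected and meets no curve, would be enclosed, and with it the
  image of the curve itself. Hence \<open>P\<close> contributes no poles at any stage of the iterated integral,
  and a Cauchy integral in one variable drives the induction
  (\<open>iterated_integral_residues\<close>).

  For \<open>q = 0\<close> and \<open>r \<ge> 2\<close> the partners degenerate, but there the power of \<open>q\<close> in front vanishes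
  on both sides.
\<close>

section \<open>Partitions and interlacing\<close>

definition part_size :: "(nat \<Rightarrow> nat) \<Rightarrow> nat" where
  "part_size \<nu> = (\<Sum>i | \<nu> i \<noteq> 0. \<nu> i)"

definition interlaced :: "(nat \<Rightarrow> nat) \<Rightarrow> (nat \<Rightarrow> nat) \<Rightarrow> bool" where
  "interlaced \<kappa> \<nu> \<longleftrightarrow> (\<forall>i. \<nu> (Suc i) \<le> \<kappa> i \<and> \<kappa> i \<le> \<nu> i)"

lemma partition_antimono: "\<nu> \<in> partition_seqs \<Longrightarrow> i \<le> j \<Longrightarrow> \<nu> j \<le> \<nu> i"
  by (auto simp: partition_seqs_def antimono_def)

lemma partition_bounded:
  assumes "\<nu> \<in> partition_seqs"
  obtains N where "\<And>i. N \<le> i \<Longrightarrow> \<nu> i = 0"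
proof -
  have "finite {i. \<nu> i \<noteq> 0}" using assms by (simp add: partition_seqs_def)
  then obtain N where "\<forall>i\<in>{i. \<nu> i \<noteq> 0}. i < N"
    using finite_nat_set_iff_bounded by blast
  then show thesis by (intro that[of N]) (metis (mono_tags, lifting) linorder_not_less mem_Collect_eq)
qed

lemma partition_seqsI:
  assumes "\<And>i. \<nu> (Suc i) \<le> \<nu> i" and "\<And>i. N \<le> i \<Longrightarrow> \<nu> i = 0"
  shows "\<nu> \<in> partition_seqs"
proof -
  have "antimono \<nu>" using assms(1) by (simp add: decseq_Suc_iff)
  moreover have "{i. \<nu> i \<noteq> 0} \<subseteq> {..<N}" by (metis (mono_tags, lifting) assms(2) lessThan_iff linorder_not_less mem_Collect_eq subsetI)
  ultimately show ?thesis
    by (auto simp: partition_seqs_def intro: finite_subset)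
qed

lemma part_size_eq_sum:
  assumes "\<And>i. N \<le> i \<Longrightarrow> \<nu> i = 0"
  shows "part_size \<nu> = (\<Sum>i<N. \<nu> i)"
  unfolding part_size_def
proof (rule sum.mono_neutral_left)
  show "{i. \<nu> i \<noteq> 0} \<subseteq> {..<N}" by (metis (mono_tags, lifting) assms lessThan_iff linorder_not_less mem_Collect_eq subsetI)
qed auto

lemma part_size_mono:
  assumes "\<nu> \<in> partition_seqs" "\<kappa> \<le> \<nu>"
  shows "part_size \<kappa> \<le> part_size \<nu>"
proof -
  obtain N where N: "\<And>i. N \<le> i \<Longrightarrow> \<nu> i = 0" using partition_bounded[OF assms(1)] by blast
  have K: "\<And>i. N \<le> i \<Longrightarrow> \<kappa> i = 0" using N assms(2) by (metis le_fun_def le_zero_eq)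
  show ?thesis using assms(2) part_size_eq_sum[of N \<nu>, OF N] part_size_eq_sum[of N \<kappa>, OF K]
    by (simp add: le_fun_def sum_mono)
qed

lemma interlaced_le: "interlaced \<kappa> \<nu> \<Longrightarrow> \<kappa> \<le> \<nu>"
  by (auto simp: interlaced_def le_fun_def)

text \<open>
  The skew Schur polynomial of shape \<open>\<nu>/\<kappa>\<close> in one variable, for non-negative \<open>x\<close>: interlacing says
  that \<open>\<nu>/\<kappa>\<close> is a horizontal strip.
\<close>

definition strip_weight :: "ennreal \<Rightarrow> (nat \<Rightarrow> nat) \<Rightarrow> (nat \<Rightarrow> nat) \<Rightarrow> ennreal" where
  "strip_weight x \<kappa> \<nu> =
     (if \<kappa> \<in> partition_seqs \<and> \<nu> \<in> partition_seqs \<and> interlaced \<kappa> \<nu>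
      then x ^ (part_size \<nu> - part_size \<kappa>) else 0)"

text \<open>
  For two partitions \<open>l\<close>, \<open>\<mu>\<close> let \<open>\<nu>\<close> interlace both from above and \<open>\<kappa>\<close> both from
  below. Row \<open>i + 1\<close> of \<open>\<nu>\<close> and row \<open>i\<close> of \<open>\<kappa>\<close> range over the same interval, from the
  maximum of rows \<open>i + 1\<close> of \<open>l\<close>, \<open>\<mu>\<close> to the minimum of their rows \<open>i\<close>; the map reflects
  this interval. Row \<open>0\<close> of \<open>\<nu>\<close> is bounded from below only, and \<open>m\<close> is its excess over that
  bound: it becomes the index of the geometric series.
\<close>

definition toggle ::
  "(nat \<Rightarrow> nat) \<Rightarrow> (nat \<Rightarrow> nat) \<Rightarrow> nat \<times> (nat \<Rightarrow> nat) \<Rightarrow> nat \<Rightarrow> nat" where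
  "toggle l \<mu> = (\<lambda>(m, \<kappa>) i. case i of 0 \<Rightarrow> max (l 0) (\<mu> 0) + m
     | Suc i \<Rightarrow> min (l i) (\<mu> i) + max (l (Suc i)) (\<mu> (Suc i)) - \<kappa> i)"

lemma toggle_bij:
  assumes l: "l \<in> partition_seqs" and \<mu>: "\<mu> \<in> partition_seqs"
  shows "bij_betw (toggle l \<mu>)
     (UNIV \<times> {\<kappa> \<in> partition_seqs. interlaced \<kappa> l \<and> interlaced \<kappa> \<mu>})
     {\<nu> \<in> partition_seqs. interlaced l \<nu> \<and> interlaced \<mu> \<nu>}"
proof -
  obtain N1 where N1: "\<And>i. N1 \<le> i \<Longrightarrow> l i = 0" using partition_bounded[OF l] by blast
  define inv where "inv = (\<lambda>\<nu>. (\<nu> 0 - max (l 0) (\<mu> 0),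
     \<lambda>i. min (l i) (\<mu> i) + max (l (Suc i)) (\<mu> (Suc i)) - \<nu> (Suc i)))"
  show ?thesis
  proof (rule bij_betw_byWitness[where f' = inv])
    show "\<forall>p\<in>(UNIV :: nat set) \<times> {\<kappa> \<in> partition_seqs. interlaced \<kappa> l \<and> interlaced \<kappa> \<mu>}. inv (toggle l \<mu> p) = p"
    proof
      fix p assume p: "p \<in> (UNIV :: nat set) \<times> {\<kappa> \<in> partition_seqs. interlaced \<kappa> l \<and> interlaced \<kappa> \<mu>}"
      obtain m \<kappa> where [simp]: "p = (m, \<kappa>)" by (cases p)
      have "\<kappa> i \<le> l i" "\<kappa> i \<le> \<mu> i" for i using p by (auto simp: interlaced_def)
      then have "\<kappa> i \<le> min (l i) (\<mu> i) + max (l (Suc i)) (\<mu> (Suc i))" for i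
        by (simp add: le_add1 trans_le_add1)
      then show "inv (toggle l \<mu> p) = p"
        by (simp add: inv_def toggle_def fun_eq_iff)
    qed
  next
    show "\<forall>\<nu>\<in>{\<nu> \<in> partition_seqs. interlaced l \<nu> \<and> interlaced \<mu> \<nu>}. toggle l \<mu> (inv \<nu>) = \<nu>"
    proof
      fix \<nu> assume \<nu>: "\<nu> \<in> {\<nu> \<in> partition_seqs. interlaced l \<nu> \<and> interlaced \<mu> \<nu>}"
      have "\<nu> (Suc i) \<le> l i" "\<nu> (Suc i) \<le> \<mu> i" "l i \<le> \<nu> i" "\<mu> i \<le> \<nu> i" for i
        using \<nu> by (auto simp: interlaced_def)
      then show "toggle l \<mu> (inv \<nu>) = \<nu>"
        by (auto simp: inv_def toggle_def fun_eq_iff trans_le_add1 split: nat.split)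
    qed
  next
    show "toggle l \<mu> ` (UNIV \<times> {\<kappa> \<in> partition_seqs. interlaced \<kappa> l \<and> interlaced \<kappa> \<mu>})
       \<subseteq> {\<nu> \<in> partition_seqs. interlaced l \<nu> \<and> interlaced \<mu> \<nu>}"
    proof clarify
      fix m \<kappa> assume \<kappa>: "\<kappa> \<in> partition_seqs" "interlaced \<kappa> l" "interlaced \<kappa> \<mu>"
      have k: "\<kappa> i \<le> l i" "\<kappa> i \<le> \<mu> i" "l (Suc i) \<le> \<kappa> i" "\<mu> (Suc i) \<le> \<kappa> i" for i
        using \<kappa> by (auto simp: interlaced_def)
      have b: "l i \<le> toggle l \<mu> (m, \<kappa>) i" "\<mu> i \<le> toggle l \<mu> (m, \<kappa>) i"
        "toggle l \<mu> (m, \<kappa>) (Suc i) \<le> l i" "toggle l \<mu> (m, \<kappa>) (Suc i) \<le> \<mu> i" for i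
        using k[of i] k[of "i - 1"] by (auto simp: toggle_def min_def max_def split: nat.split)
      have "toggle l \<mu> (m, \<kappa>) \<in> partition_seqs"
      proof (rule partition_seqsI)
        show "toggle l \<mu> (m, \<kappa>) (Suc i) \<le> toggle l \<mu> (m, \<kappa>) i" for i
          using b[of i] by linarith
        show "toggle l \<mu> (m, \<kappa>) i = 0" if "Suc N1 \<le> i" for i
          using b(3)[of "i - 1"] N1[of "i - 1"] that by auto
      qed
      with b show "toggle l \<mu> (m, \<kappa>) \<in> partition_seqs \<and>
          interlaced l (toggle l \<mu> (m, \<kappa>)) \<and> interlaced \<mu> (toggle l \<mu> (m, \<kappa>))"
        by (auto simp: interlaced_def)
    qed
  next
    show "inv ` {\<nu> \<in> partition_seqs. interlaced l \<nu> \<and> interlaced \<mu> \<nu>}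
       \<subseteq> UNIV \<times> {\<kappa> \<in> partition_seqs. interlaced \<kappa> l \<and> interlaced \<kappa> \<mu>}"
    proof (rule image_subsetI)
      fix \<nu> assume "\<nu> \<in> {\<nu> \<in> partition_seqs. interlaced l \<nu> \<and> interlaced \<mu> \<nu>}"
      then have \<nu>: "\<nu> \<in> partition_seqs" "interlaced l \<nu>" "interlaced \<mu> \<nu>" by auto
      define \<kappa> where "\<kappa> = snd (inv \<nu>)"
      then have \<kappa>: "\<kappa> i = min (l i) (\<mu> i) + max (l (Suc i)) (\<mu> (Suc i)) - \<nu> (Suc i)" for i
        by (auto simp: inv_def)
      have k: "\<nu> (Suc i) \<le> l i" "\<nu> (Suc i) \<le> \<mu> i" "l i \<le> \<nu> i" "\<mu> i \<le> \<nu> i" for i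
        using \<nu> by (auto simp: interlaced_def)
      have b: "\<kappa> i \<le> l i" "\<kappa> i \<le> \<mu> i" "l (Suc i) \<le> \<kappa> i" "\<mu> (Suc i) \<le> \<kappa> i" for i
        using k[of i] k[of "Suc i"] by (auto simp: \<kappa>)
      have "\<kappa> \<in> partition_seqs"
      proof (rule partition_seqsI)
        show "\<kappa> (Suc i) \<le> \<kappa> i" for i
          using b[of i] b[of "Suc i"] by linarith
        show "\<kappa> i = 0" if "N1 \<le> i" for i
          using b(1)[of i] N1[of i] that by auto
      qed
      with b show "inv \<nu> \<in> UNIV \<times> {\<kappa> \<in> partition_seqs. interlaced \<kappa> l \<and> interlaced \<kappa> \<mu>}"
        by (auto simp: interlaced_def mem_Times_iff simp flip: \<kappa>_def)
    qed
  qed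
qed

text \<open>
  A reflection preserves the sum of the two reflected quantities and maximum plus minimum is the sum,
  so the sizes add up to those of \<open>l\<close> and \<open>\<mu>\<close>, apart from \<open>m\<close>. This makes the bijection
  compatible with the weights of strips.
\<close>

lemma toggle_part_size:
  assumes l: "l \<in> partition_seqs" and \<mu>: "\<mu> \<in> partition_seqs"
    and \<kappa>: "interlaced \<kappa> l" "interlaced \<kappa> \<mu>"
  shows "part_size (toggle l \<mu> (m, \<kappa>)) + part_size \<kappa> = m + part_size l + part_size \<mu>"
proof -
  obtain N1 where N1: "\<And>i. N1 \<le> i \<Longrightarrow> l i = 0" using partition_bounded[OF l] by blast
  obtain N2 where N2: "\<And>i. N2 \<le> i \<Longrightarrow> \<mu> i = 0" using partition_bounded[OF \<mu>] by blast
  define N where "N = max N1 N2"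
  have z: "l i = 0" "\<mu> i = 0" if "N \<le> i" for i using that N1 N2 by (auto simp: N_def)
  have k: "\<kappa> i \<le> l i" "\<kappa> i \<le> \<mu> i" for i using \<kappa> by (auto simp: interlaced_def)
  have zk: "\<kappa> i = 0" if "N \<le> i" for i using k(1)[of i] z(1)[OF that] by simp
  have zt: "toggle l \<mu> (m, \<kappa>) i = 0" if "Suc N \<le> i" for i
    using that z(1)[of "i - 1"] z(2)[of "i - 1"] z(1)[of i] z(2)[of i]
    by (cases i) (auto simp: toggle_def)
  have "part_size (toggle l \<mu> (m, \<kappa>)) + part_size \<kappa>
      = (\<Sum>i<Suc N. toggle l \<mu> (m, \<kappa>) i) + (\<Sum>i<N. \<kappa> i)"
    using part_size_eq_sum[OF zt] part_size_eq_sum[OF zk] by simp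
  also have "\<dots> = max (l 0) (\<mu> 0) + m + (\<Sum>i<N. toggle l \<mu> (m, \<kappa>) (Suc i) + \<kappa> i)"
    by (simp add: sum.lessThan_Suc_shift sum.distrib toggle_def del: sum.lessThan_Suc)
  also have "(\<Sum>i<N. toggle l \<mu> (m, \<kappa>) (Suc i) + \<kappa> i)
      = (\<Sum>i<N. min (l i) (\<mu> i) + max (l (Suc i)) (\<mu> (Suc i)))"
    by (rule sum.cong) (use k in \<open>auto simp: toggle_def trans_le_add1\<close>)
  also have "max (l 0) (\<mu> 0) + m + \<dots>
      = m + (\<Sum>i<N. min (l i) (\<mu> i)) + (\<Sum>i<Suc N. max (l i) (\<mu> i))"
    by (simp add: sum.lessThan_Suc_shift sum.distrib del: sum.lessThan_Suc)
  also have "(\<Sum>i<Suc N. max (l i) (\<mu> i)) = (\<Sum>i<N. max (l i) (\<mu> i))"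
    using z[of N] by simp
  also have "m + (\<Sum>i<N. min (l i) (\<mu> i)) + (\<Sum>i<N. max (l i) (\<mu> i))
      = m + (\<Sum>i<N. min (l i) (\<mu> i) + max (l i) (\<mu> i))"
    by (simp add: sum.distrib)
  also have "(\<Sum>i<N. min (l i) (\<mu> i) + max (l i) (\<mu> i)) = (\<Sum>i<N. l i + \<mu> i)"
    by (rule sum.cong) auto
  also have "\<dots> = part_size l + part_size \<mu>"
    using part_size_eq_sum[OF z(1)] part_size_eq_sum[OF z(2)] by (simp add: sum.distrib)
  finally show ?thesis by simp
qed

lemma count_space_swap:
  fixes f :: "'a \<Rightarrow> 'b \<Rightarrow> ennreal"
  shows "(\<integral>\<^sup>+x. \<integral>\<^sup>+y. f x y \<partial>count_space UNIV \<partial>count_space UNIV)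
       = (\<integral>\<^sup>+y. \<integral>\<^sup>+x. f x y \<partial>count_space UNIV \<partial>count_space UNIV)"
  using nn_integral_fst_count_space[of "\<lambda>(x, y). f x y"]
    nn_integral_snd_count_space[of "\<lambda>(x, y). f x y"] by simp

text \<open>
  The Cauchy identity with one variable on each side. Read as an identity of kernels, it moves the
  addition of a strip past the removal of one at the cost of a geometric series.
\<close>

lemma strip_weight_commute:
  assumes l: "l \<in> partition_seqs" and \<mu>: "\<mu> \<in> partition_seqs"
  shows "(\<integral>\<^sup>+\<nu>. strip_weight x l \<nu> * strip_weight y \<mu> \<nu> \<partial>count_space UNIV)
       = (\<Sum>m. (x * y) ^ m) *
         (\<integral>\<^sup>+\<kappa>. strip_weight x \<kappa> \<mu> * strip_weight y \<kappa> l \<partial>count_space UNIV)"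
proof -
  define A where "A = {\<nu> \<in> partition_seqs. interlaced l \<nu> \<and> interlaced \<mu> \<nu>}"
  define B where "B = {\<kappa> \<in> partition_seqs. interlaced \<kappa> l \<and> interlaced \<kappa> \<mu>}"
  have "(\<integral>\<^sup>+\<nu>. strip_weight x l \<nu> * strip_weight y \<mu> \<nu> \<partial>count_space UNIV)
      = (\<integral>\<^sup>+\<nu>. strip_weight x l \<nu> * strip_weight y \<mu> \<nu> \<partial>count_space A)"
    by (rule nn_integral_count_space_eq) (auto simp: A_def strip_weight_def split: if_splits)
  also have "\<dots> = (\<integral>\<^sup>+p. strip_weight x l (toggle l \<mu> p) * strip_weight y \<mu> (toggle l \<mu> p)
      \<partial>count_space (UNIV \<times> B))"
    unfolding A_def B_def
    by (rule nn_integral_bij_count_space[OF toggle_bij[OF l \<mu>], symmetric])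
  also have "\<dots> = (\<integral>\<^sup>+p. (case p of (m, \<kappa>) \<Rightarrow>
      (x * y) ^ m * (strip_weight x \<kappa> \<mu> * strip_weight y \<kappa> l)) \<partial>count_space (UNIV \<times> B))"
  proof (rule nn_integral_cong)
    fix p assume "p \<in> space (count_space ((UNIV :: nat set) \<times> B))"
    then obtain m \<kappa> where p: "p = (m, \<kappa>)" and \<kappa>: "\<kappa> \<in> B" by auto
    have \<kappa>': "\<kappa> \<in> partition_seqs" "interlaced \<kappa> l" "interlaced \<kappa> \<mu>" using \<kappa> by (auto simp: B_def)
    have t: "toggle l \<mu> (m, \<kappa>) \<in> A"
      using toggle_bij[OF l \<mu>] \<kappa> unfolding A_def B_def bij_betw_def by blast
    have e: "part_size (toggle l \<mu> (m, \<kappa>)) + part_size \<kappa> = m + part_size l + part_size \<mu>"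
      using toggle_part_size[OF l \<mu> \<kappa>'(2,3)] .
    have "part_size \<kappa> \<le> part_size l" "part_size \<kappa> \<le> part_size \<mu>"
      using \<kappa>' l \<mu> by (auto intro!: part_size_mono interlaced_le)
    then have "part_size (toggle l \<mu> (m, \<kappa>)) - part_size l = m + (part_size \<mu> - part_size \<kappa>)"
      "part_size (toggle l \<mu> (m, \<kappa>)) - part_size \<mu> = m + (part_size l - part_size \<kappa>)"
      using e by auto
    then show "strip_weight x l (toggle l \<mu> p) * strip_weight y \<mu> (toggle l \<mu> p) = (case p of (m, \<kappa>) \<Rightarrow>
      (x * y) ^ m * (strip_weight x \<kappa> \<mu> * strip_weight y \<kappa> l))"
      using t \<kappa>' l \<mu> by (simp add: p strip_weight_def A_def power_add power_mult_distrib mult_ac)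
  qed
  also have "\<dots> = (\<integral>\<^sup>+p. (case p of (m, \<kappa>) \<Rightarrow>
      (x * y) ^ m * (strip_weight x \<kappa> \<mu> * strip_weight y \<kappa> l)) \<partial>count_space UNIV)"
    by (rule nn_integral_count_space_eq) (auto simp: B_def strip_weight_def split: if_splits)
  also have "\<dots> = (\<integral>\<^sup>+m. \<integral>\<^sup>+\<kappa>. (x * y) ^ m * (strip_weight x \<kappa> \<mu> * strip_weight y \<kappa> l)
      \<partial>count_space UNIV \<partial>count_space UNIV)"
    by (subst nn_integral_fst_count_space[symmetric]) simp
  also have "\<dots> = (\<Sum>m. (x * y) ^ m) *
         (\<integral>\<^sup>+\<kappa>. strip_weight x \<kappa> \<mu> * strip_weight y \<kappa> l \<partial>count_space UNIV)"
    by (simp add: nn_integral_cmult nn_integral_multc nn_integral_count_space_nat)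
  finally show ?thesis .
qed

text \<open>
  The indicator of the partitions all of whose columns have even length; equivalently, the rows come
  in equal pairs.
\<close>

definition paired_rows :: "(nat \<Rightarrow> nat) \<Rightarrow> ennreal" where
  "paired_rows \<mu> = (if \<mu> \<in> partition_seqs \<and> even_part (transpose_part \<mu>) then 1 else 0)"

lemma even_transpose_iff:
  assumes \<mu>: "\<mu> \<in> partition_seqs"
  shows "even_part (transpose_part \<mu>) \<longleftrightarrow> (\<forall>i. \<mu> (2 * i) = \<mu> (Suc (2 * i)))"
proof
  assume ev: "even_part (transpose_part \<mu>)"
  show "\<forall>i. \<mu> (2 * i) = \<mu> (Suc (2 * i))"
  proof (rule allI, rule ccontr)
    fix i assume "\<mu> (2 * i) \<noteq> \<mu> (Suc (2 * i))"
    then have lt: "\<mu> (Suc (2 * i)) < \<mu> (2 * i)"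
      using partition_antimono[OF \<mu>, of "2 * i" "Suc (2 * i)"] by simp
    have "{k. \<mu> (Suc (2 * i)) < \<mu> k} = {..2 * i}"
    proof (intro set_eqI iffI)
      fix k assume k: "k \<in> {k. \<mu> (Suc (2 * i)) < \<mu> k}"
      show "k \<in> {..2 * i}"
      proof (rule ccontr)
        assume "k \<notin> {..2 * i}"
        then have "\<mu> k \<le> \<mu> (Suc (2 * i))" by (intro partition_antimono[OF \<mu>]) auto
        with k show False by simp
      qed
    next
      fix k assume "k \<in> {..2 * i}"
      then have "\<mu> (2 * i) \<le> \<mu> k" by (intro partition_antimono[OF \<mu>]) auto
      with lt show "k \<in> {k. \<mu> (Suc (2 * i)) < \<mu> k}" by simp
    qed
    then have "transpose_part \<mu> (\<mu> (Suc (2 * i))) = Suc (2 * i)"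
      by (simp add: transpose_part_def)
    then show False using ev by (metis even_part_def even_Suc dvd_triv_left)
  qed
next
  assume eq: "\<forall>i. \<mu> (2 * i) = \<mu> (Suc (2 * i))"
  show "even_part (transpose_part \<mu>)"
    unfolding even_part_def
  proof
    fix j
    obtain N where N: "\<And>i. N \<le> i \<Longrightarrow> \<mu> i = 0" using partition_bounded[OF \<mu>] by blast
    define c where "c = (LEAST c. \<mu> c \<le> j)"
    have c: "\<mu> c \<le> j" unfolding c_def by (rule LeastI[of _ N]) (simp add: N)
    have c': "j < \<mu> i" if "i < c" for i
      using not_less_Least[of i "\<lambda>c. \<mu> c \<le> j"] that by (auto simp: c_def)
    have "{i. j < \<mu> i} = {..<c}"
    proof (intro set_eqI iffI)
      fix i assume i: "i \<in> {i. j < \<mu> i}"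
      show "i \<in> {..<c}"
      proof (rule ccontr)
        assume "i \<notin> {..<c}"
        then have "\<mu> i \<le> \<mu> c" by (intro partition_antimono[OF \<mu>]) auto
        with i c show False by simp
      qed
    qed (use c' in auto)
    then have t: "transpose_part \<mu> j = c" by (simp add: transpose_part_def)
    show "even (transpose_part \<mu> j)"
    proof (rule ccontr)
      assume "odd (transpose_part \<mu> j)"
      then obtain i where i: "c = Suc (2 * i)" unfolding t by (metis oddE Suc_eq_plus1)
      then have "j < \<mu> (2 * i)" by (intro c') simp
      then show False using c eq i by simp
    qed
  qed
qed

lemma count_space_single:
  fixes f :: "'a \<Rightarrow> ennreal"
  assumes "\<And>b. b \<noteq> a \<Longrightarrow> f b = 0"
  shows "(\<integral>\<^sup>+b. f b \<partial>count_space UNIV) = f a"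
  using assms by (subst nn_integral_count_space'[where A = "{a}"]) auto

text \<open>
  A horizontal strip changes each column length by at most one. So the only partition with even
  columns above \<open>\<kappa>\<close> rounds every odd column length up, the only one below \<open>\<kappa>\<close> rounds it down, and
  both differ from \<open>\<kappa>\<close> by the number of odd columns. In terms of rows, rounding up replaces each
  pair of rows \<open>2 j\<close>, \<open>2 j + 1\<close> by two copies of the longer row, rounding down by two copies of the
  shorter one.
\<close>

lemma strip_weight_reflect:
  "(\<integral>\<^sup>+\<nu>. strip_weight x \<kappa> \<nu> * paired_rows \<nu> \<partial>count_space UNIV)
   = (\<integral>\<^sup>+\<mu>. strip_weight x \<mu> \<kappa> * paired_rows \<mu> \<partial>count_space UNIV)"
proof (cases "\<kappa> \<in> partition_seqs")
  case False
  then show ?thesis by (simp add: strip_weight_def)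
next
  case \<kappa>: True
  define up where "up = (\<lambda>i. \<kappa> (2 * (i div 2)))"
  define down where "down = (\<lambda>i. \<kappa> (Suc (2 * (i div 2))))"
  obtain N where N: "\<And>i. N \<le> i \<Longrightarrow> \<kappa> i = 0" using partition_bounded[OF \<kappa>] by blast
  have anti: "i \<le> j \<Longrightarrow> \<kappa> j \<le> \<kappa> i" for i j by (rule partition_antimono[OF \<kappa>])
  have zu: "up i = 0" if "2 * N \<le> i" for i
    using that unfolding up_def by (intro N) linarith
  have zd: "down i = 0" if "2 * N \<le> i" for i
    using that unfolding down_def by (intro N) linarith
  have zk: "\<kappa> i = 0" if "2 * N \<le> i" for i using that by (intro N) linarith
  have up: "up \<in> partition_seqs" using zu by (intro partition_seqsI) (auto simp: up_def intro!: anti)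
  have down: "down \<in> partition_seqs" using zd by (intro partition_seqsI) (auto simp: down_def intro!: anti)
  have ip: "interlaced \<kappa> up" "interlaced down \<kappa>"
    by (auto simp: interlaced_def up_def down_def intro!: anti)
  have su: "\<nu> = up" if "\<nu> \<in> partition_seqs" "even_part (transpose_part \<nu>)" "interlaced \<kappa> \<nu>" for \<nu>
  proof
    fix i
    have e: "\<nu> (2 * j) = \<nu> (Suc (2 * j))" for j using that by (auto simp: even_transpose_iff)
    have "\<nu> (2 * j) = \<kappa> (2 * j)" for j
      using that(3) e[of j] unfolding interlaced_def by (metis le_antisym)
    then show "\<nu> i = up i"
      using e[of "i div 2"] unfolding up_def
      by (cases "even i") (metis dvd_mult_div_cancel odd_two_times_div_two_succ Suc_eq_plus1)+
  qed
  have sd: "\<mu> = down" if "\<mu> \<in> partition_seqs" "even_part (transpose_part \<mu>)" "interlaced \<mu> \<kappa>" for \<mu>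
  proof
    fix i
    have e: "\<mu> (2 * j) = \<mu> (Suc (2 * j))" for j using that by (auto simp: even_transpose_iff)
    have "\<mu> (2 * j) = \<kappa> (Suc (2 * j))" for j
      using that(3) e[of j] unfolding interlaced_def by (metis le_antisym)
    then show "\<mu> i = down i"
      using e[of "i div 2"] unfolding down_def
      by (cases "even i") (metis dvd_mult_div_cancel odd_two_times_div_two_succ Suc_eq_plus1)+
  qed
  have "(\<integral>\<^sup>+\<nu>. strip_weight x \<kappa> \<nu> * paired_rows \<nu> \<partial>count_space UNIV)
      = strip_weight x \<kappa> up * paired_rows up"
    by (rule count_space_single) (use su in \<open>auto simp: strip_weight_def paired_rows_def\<close>)
  also have "\<dots> = x ^ (part_size up - part_size \<kappa>)"
    using \<kappa> up ip by (simp add: strip_weight_def paired_rows_def even_transpose_iff) (simp add: up_def)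
  also have "part_size up - part_size \<kappa> = part_size \<kappa> - part_size down"
  proof -
    have s: "(\<Sum>i<2 * M. g i) = (\<Sum>i<M. g (2 * i) + g (Suc (2 * i)))" for g :: "nat \<Rightarrow> nat" and M
      by (induction M) auto
    have "part_size up + part_size down = (\<Sum>i<2 * N. up i + down i)"
      using part_size_eq_sum[OF zu] part_size_eq_sum[OF zd] by (simp add: sum.distrib)
    also have "\<dots> = 2 * (\<Sum>i<N. \<kappa> (2 * i) + \<kappa> (Suc (2 * i)))"
      by (simp only: s up_def down_def) (simp add: sum_distrib_left mult_2 add_ac)
    also have "\<dots> = 2 * part_size \<kappa>"
      using part_size_eq_sum[OF zk] by (simp add: s)
    finally show ?thesis by simp
  qed
  also have "x ^ (part_size \<kappa> - part_size down) = strip_weight x down \<kappa> * paired_rows down"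
    using \<kappa> down ip by (simp add: strip_weight_def paired_rows_def even_transpose_iff) (simp add: down_def)
  also have "\<dots> = (\<integral>\<^sup>+\<mu>. strip_weight x \<mu> \<kappa> * paired_rows \<mu> \<partial>count_space UNIV)"
    by (rule count_space_single[symmetric]) (use sd in \<open>auto simp: strip_weight_def paired_rows_def\<close>)
  finally show ?thesis .
qed

primrec strip_chains ::
  "(nat \<Rightarrow> ennreal) \<Rightarrow> nat \<Rightarrow> (nat \<Rightarrow> nat) \<Rightarrow> (nat \<Rightarrow> nat) \<Rightarrow> ennreal" where
  "strip_chains x 0 \<mu> \<nu> = (if \<mu> = \<nu> \<and> \<mu> \<in> partition_seqs then 1 else 0)"
| "strip_chains x (Suc n) \<mu> \<nu> =
     (\<integral>\<^sup>+\<kappa>. strip_chains x n \<mu> \<kappa> * strip_weight (x (Suc n)) \<kappa> \<nu> \<partial>count_space UNIV)"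

definition paired_chains :: "(nat \<Rightarrow> ennreal) \<Rightarrow> nat \<Rightarrow> (nat \<Rightarrow> nat) \<Rightarrow> ennreal" where
  "paired_chains y k \<nu> = (\<integral>\<^sup>+\<mu>. paired_rows \<mu> * strip_chains y k \<mu> \<nu> \<partial>count_space UNIV)"

lemma zero_partition: "(\<lambda>_. 0) \<in> partition_seqs"
  by (auto simp: partition_seqs_def antimono_def)

lemma strip_chains_nonpartition: "\<nu> \<notin> partition_seqs \<Longrightarrow> strip_chains x n \<mu> \<nu> = 0"
  by (cases n) (auto simp: strip_weight_def)

text \<open>
  Adding a strip is moved past the removals of strips one at a time; what is left at the end is a strip
  added below the empty partition, which must be empty.
\<close>

lemma pieri_chains:
  "(\<integral>\<^sup>+\<nu>. strip_weight y \<mu> \<nu> * strip_chains x n (\<lambda>_. 0) \<nu> \<partial>count_space UNIV)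
   = (\<Prod>i=1..n. \<Sum>m. (x i * y) ^ m) * strip_chains x n (\<lambda>_. 0) \<mu>"
proof (induction n arbitrary: \<mu>)
  case 0
  have "(\<integral>\<^sup>+\<nu>. strip_weight y \<mu> \<nu> * strip_chains x 0 (\<lambda>_. 0) \<nu> \<partial>count_space UNIV)
     = strip_weight y \<mu> (\<lambda>_. 0)"
    by (subst count_space_single[where a = "\<lambda>_. 0"]) (auto simp: zero_partition)
  also have "\<dots> = strip_chains x 0 (\<lambda>_. 0) \<mu>"
  proof -
    have "interlaced \<mu> (\<lambda>_. 0) \<longleftrightarrow> \<mu> = (\<lambda>_. 0)"
      by (auto simp: interlaced_def)
    then show ?thesis by (auto simp: strip_weight_def zero_partition)
  qed
  finally show ?case by simp
next
  case (Suc n)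
  show ?case
  proof (cases "\<mu> \<in> partition_seqs")
    case False
    then show ?thesis by (simp add: strip_weight_def)
  next
    case \<mu>: True
    let ?S = "strip_chains x n (\<lambda>_. 0)"
    let ?x = "x (Suc n)"
    let ?G = "\<Sum>m. (?x * y) ^ m"
    have "(\<integral>\<^sup>+\<nu>. strip_weight y \<mu> \<nu> * strip_chains x (Suc n) (\<lambda>_. 0) \<nu> \<partial>count_space UNIV)
        = (\<integral>\<^sup>+\<nu>. \<integral>\<^sup>+l. ?S l * (strip_weight ?x l \<nu> * strip_weight y \<mu> \<nu>)
            \<partial>count_space UNIV \<partial>count_space UNIV)"
      by (simp add: nn_integral_cmult[symmetric] mult_ac)
    also have "\<dots> = (\<integral>\<^sup>+l. ?S l * (\<integral>\<^sup>+\<nu>. strip_weight ?x l \<nu> * strip_weight y \<mu> \<nu>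
            \<partial>count_space UNIV) \<partial>count_space UNIV)"
      by (subst count_space_swap) (simp add: nn_integral_cmult)
    also have "\<dots> = (\<integral>\<^sup>+l. ?S l * (?G * (\<integral>\<^sup>+\<kappa>. strip_weight ?x \<kappa> \<mu> * strip_weight y \<kappa> l
            \<partial>count_space UNIV)) \<partial>count_space UNIV)"
    proof (rule nn_integral_cong)
      fix l
      show "?S l * (\<integral>\<^sup>+\<nu>. strip_weight ?x l \<nu> * strip_weight y \<mu> \<nu> \<partial>count_space UNIV)
         = ?S l * (?G * (\<integral>\<^sup>+\<kappa>. strip_weight ?x \<kappa> \<mu> * strip_weight y \<kappa> l \<partial>count_space UNIV))"
        using strip_weight_commute[OF _ \<mu>, of l ?x y] strip_chains_nonpartition[of l x n "\<lambda>_. 0"]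
        by (cases "l \<in> partition_seqs") auto
    qed
    also have "\<dots> = ?G * (\<integral>\<^sup>+l. \<integral>\<^sup>+\<kappa>. strip_weight ?x \<kappa> \<mu> * (strip_weight y \<kappa> l * ?S l)
            \<partial>count_space UNIV \<partial>count_space UNIV)"
      by (simp add: nn_integral_cmult[symmetric] mult_ac)
    also have "\<dots> = ?G * (\<integral>\<^sup>+\<kappa>. strip_weight ?x \<kappa> \<mu> * (\<integral>\<^sup>+l. strip_weight y \<kappa> l * ?S l
            \<partial>count_space UNIV) \<partial>count_space UNIV)"
      by (subst count_space_swap) (simp add: nn_integral_cmult)
    also have "\<dots> = ?G * ((\<Prod>i=1..n. \<Sum>m. (x i * y) ^ m) *
        (\<integral>\<^sup>+\<kappa>. strip_weight ?x \<kappa> \<mu> * ?S \<kappa> \<partial>count_space UNIV))"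
      by (simp only: Suc.IH) (simp add: nn_integral_cmult[symmetric] mult_ac)
    also have "\<dots> = (\<Prod>i=1..Suc n. \<Sum>m. (x i * y) ^ m) * strip_chains x (Suc n) (\<lambda>_. 0) \<mu>"
      by (simp add: mult_ac)
    finally show ?thesis .
  qed
qed

text \<open>
  The identity of Littlewood. The last removal is turned into an addition by
  \<open>strip_weight_reflect\<close>, which is then moved past the other removals.
\<close>

lemma littlewood_chains:
  "(\<integral>\<^sup>+\<nu>. paired_rows \<nu> * strip_chains x n (\<lambda>_. 0) \<nu> \<partial>count_space UNIV)
   = (\<Prod>j=1..n. \<Prod>i=1..<j. \<Sum>m. (x i * x j) ^ m)"
proof (induction n)
  case 0
  have "(\<integral>\<^sup>+\<nu>. paired_rows \<nu> * strip_chains x 0 (\<lambda>_. 0) \<nu> \<partial>count_space UNIV)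
      = paired_rows (\<lambda>_. 0)"
    by (subst count_space_single[where a = "\<lambda>_. 0"]) (auto simp: zero_partition)
  also have "\<dots> = 1"
    by (simp add: paired_rows_def zero_partition even_transpose_iff)
  finally show ?case by simp
next
  case (Suc n)
  let ?S = "strip_chains x n (\<lambda>_. 0)"
  let ?x = "x (Suc n)"
  have "(\<integral>\<^sup>+\<nu>. paired_rows \<nu> * strip_chains x (Suc n) (\<lambda>_. 0) \<nu> \<partial>count_space UNIV)
      = (\<integral>\<^sup>+\<nu>. \<integral>\<^sup>+\<kappa>. ?S \<kappa> * (strip_weight ?x \<kappa> \<nu> * paired_rows \<nu>)
          \<partial>count_space UNIV \<partial>count_space UNIV)"
    by (simp add: nn_integral_cmult[symmetric] mult_ac)
  also have "\<dots> = (\<integral>\<^sup>+\<kappa>. ?S \<kappa> * (\<integral>\<^sup>+\<nu>. strip_weight ?x \<kappa> \<nu> * paired_rows \<nu>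
          \<partial>count_space UNIV) \<partial>count_space UNIV)"
    by (subst count_space_swap) (simp add: nn_integral_cmult)
  also have "\<dots> = (\<integral>\<^sup>+\<kappa>. \<integral>\<^sup>+\<mu>. paired_rows \<mu> * (strip_weight ?x \<mu> \<kappa> * ?S \<kappa>)
          \<partial>count_space UNIV \<partial>count_space UNIV)"
    by (simp only: strip_weight_reflect) (simp add: nn_integral_cmult[symmetric] mult_ac)
  also have "\<dots> = (\<integral>\<^sup>+\<mu>. paired_rows \<mu> * (\<integral>\<^sup>+\<kappa>. strip_weight ?x \<mu> \<kappa> * ?S \<kappa>
          \<partial>count_space UNIV) \<partial>count_space UNIV)"
    by (subst count_space_swap) (simp add: nn_integral_cmult)
  also have "\<dots> = (\<Prod>i=1..n. \<Sum>m. (x i * ?x) ^ m) *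
      (\<integral>\<^sup>+\<mu>. paired_rows \<mu> * ?S \<mu> \<partial>count_space UNIV)"
    by (simp only: pieri_chains) (simp add: nn_integral_cmult[symmetric] nn_integral_multc[symmetric] mult_ac)
  also have "\<dots> = (\<Prod>j=1..Suc n. \<Prod>i=1..<j. \<Sum>m. (x i * x j) ^ m)"
    by (simp add: Suc.IH atLeastLessThanSuc_atLeastAtMost mult_ac)
  finally show ?case .
qed

lemma partition_function_chains:
  "(\<integral>\<^sup>+\<nu>. paired_chains y k \<nu> * strip_chains x n (\<lambda>_. 0) \<nu> \<partial>count_space UNIV)
   = (\<Prod>j=1..n. \<Prod>i=1..<j. \<Sum>m. (x i * x j) ^ m) *
     (\<Prod>j=1..k. \<Prod>i=1..n. \<Sum>m. (x i * y j) ^ m)"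
proof (induction k)
  case 0
  have "paired_chains y 0 \<nu> = paired_rows \<nu>" for \<nu>
    unfolding paired_chains_def
    by (subst count_space_single[where a = \<nu>]) (auto simp: paired_rows_def)
  then show ?case using littlewood_chains by simp
next
  case (Suc k)
  let ?S = "strip_chains x n (\<lambda>_. 0)"
  let ?y = "y (Suc k)"
  have step: "paired_chains y (Suc k) \<nu>
      = (\<integral>\<^sup>+\<kappa>. paired_chains y k \<kappa> * strip_weight ?y \<kappa> \<nu> \<partial>count_space UNIV)" for \<nu>
  proof -
    have "paired_chains y (Suc k) \<nu> = (\<integral>\<^sup>+\<mu>. \<integral>\<^sup>+\<kappa>. paired_rows \<mu> * strip_chains y k \<mu> \<kappa> * strip_weight ?y \<kappa> \<nu>
          \<partial>count_space UNIV \<partial>count_space UNIV)"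
      by (simp add: paired_chains_def nn_integral_cmult[symmetric] mult_ac)
    also have "\<dots> = (\<integral>\<^sup>+\<kappa>. paired_chains y k \<kappa> * strip_weight ?y \<kappa> \<nu> \<partial>count_space UNIV)"
      by (subst count_space_swap) (simp add: paired_chains_def nn_integral_multc)
    finally show ?thesis .
  qed
  have "(\<integral>\<^sup>+\<nu>. paired_chains y (Suc k) \<nu> * ?S \<nu> \<partial>count_space UNIV)
      = (\<integral>\<^sup>+\<nu>. \<integral>\<^sup>+\<kappa>. paired_chains y k \<kappa> * (strip_weight ?y \<kappa> \<nu> * ?S \<nu>)
          \<partial>count_space UNIV \<partial>count_space UNIV)"
    by (simp only: step) (simp add: nn_integral_cmult[symmetric] nn_integral_multc[symmetric] mult_ac)
  also have "\<dots> = (\<integral>\<^sup>+\<kappa>. paired_chains y k \<kappa> * (\<integral>\<^sup>+\<nu>. strip_weight ?y \<kappa> \<nu> * ?S \<nu>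
          \<partial>count_space UNIV) \<partial>count_space UNIV)"
    by (subst count_space_swap) (simp add: nn_integral_cmult)
  also have "\<dots> = (\<Prod>i=1..n. \<Sum>m. (x i * ?y) ^ m) *
      (\<integral>\<^sup>+\<kappa>. paired_chains y k \<kappa> * ?S \<kappa> \<partial>count_space UNIV)"
    by (simp only: pieri_chains) (simp add: nn_integral_cmult[symmetric] nn_integral_multc[symmetric] mult_ac)
  also have "\<dots> = (\<Prod>j=1..n. \<Prod>i=1..<j. \<Sum>m. (x i * x j) ^ m) *
     (\<Prod>j=1..Suc k. \<Prod>i=1..n. \<Sum>m. (x i * y j) ^ m)"
    by (simp add: Suc.IH mult_ac)
  finally show ?case .
qed

section \<open>Branching of skew Schur polynomials\<close>

lemma skew_diagram_iff: "(i, j) \<in> skew_diagram \<nu> \<mu> \<longleftrightarrow> \<mu> i \<le> j \<and> j < \<nu> i"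
  by (simp add: skew_diagram_def)

lemma skew_diagram_Sigma:
  assumes "\<And>i. N \<le> i \<Longrightarrow> \<nu> i = 0"
  shows "skew_diagram \<nu> \<mu> = Sigma {..<N} (\<lambda>i. {\<mu> i..<\<nu> i})"
  using assms by (auto simp: skew_diagram_def) (metis linorder_not_less not_less_zero)

lemma finite_skew_diagram:
  assumes "\<nu> \<in> partition_seqs" shows "finite (skew_diagram \<nu> \<mu>)"
proof -
  obtain N where "\<And>i. N \<le> i \<Longrightarrow> \<nu> i = 0" using partition_bounded[OF assms] by blast
  then show ?thesis by (subst skew_diagram_Sigma) auto
qed

lemma card_skew_diagram:
  assumes "\<nu> \<in> partition_seqs" "\<kappa> \<le> \<nu>"
  shows "card (skew_diagram \<nu> \<kappa>) = part_size \<nu> - part_size \<kappa>"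
proof -
  obtain N where N: "\<And>i. N \<le> i \<Longrightarrow> \<nu> i = 0" using partition_bounded[OF assms(1)] by blast
  have K: "\<And>i. N \<le> i \<Longrightarrow> \<kappa> i = 0" using N assms(2) by (metis le_fun_def le_zero_eq)
  have "card (skew_diagram \<nu> \<kappa>) = (\<Sum>i<N. \<nu> i - \<kappa> i)"
    using skew_diagram_Sigma[of N \<nu> \<kappa>, OF N] by simp
  also have "\<dots> = (\<Sum>i<N. \<nu> i) - (\<Sum>i<N. \<kappa> i)"
    using assms(2) by (intro sum_subtractf_nat) (simp add: le_fun_def)
  finally show ?thesis using part_size_eq_sum[of N \<nu>, OF N] part_size_eq_sum[of N \<kappa>, OF K] by simp
qed

lemma finite_ssyt:
  assumes "\<nu> \<in> partition_seqs" shows "finite (ssyt n \<nu> \<mu>)"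
proof (rule finite_subset)
  show "ssyt n \<nu> \<mu> \<subseteq> skew_diagram \<nu> \<mu> \<rightarrow>\<^sub>E {1..n}" by (auto simp: ssyt_def)
  show "finite (skew_diagram \<nu> \<mu> \<rightarrow>\<^sub>E {1..n})"
    by (intro finite_PiE finite_skew_diagram assms) auto
qed

lemma finite_below_partition:
  assumes "\<nu> \<in> partition_seqs" shows "finite {\<kappa>. \<kappa> \<le> \<nu>}"
proof -
  obtain N where N: "\<And>i. N \<le> i \<Longrightarrow> \<nu> i = 0" using partition_bounded[OF assms] by blast
  have "{\<kappa>. \<kappa> \<le> \<nu>} \<subseteq> {\<kappa>. \<forall>i. (i \<in> {..<N} \<longrightarrow> \<kappa> i \<in> {..\<nu> 0}) \<and> (i \<notin> {..<N} \<longrightarrow> \<kappa> i = 0)}"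
  proof clarify
    fix \<kappa> i assume \<kappa>: "\<kappa> \<le> \<nu>"
    have "\<kappa> i \<le> \<nu> i" using \<kappa> by (simp add: le_fun_def)
    moreover have "\<nu> i \<le> \<nu> 0" by (rule partition_antimono[OF assms]) simp
    ultimately show "(i \<in> {..<N} \<longrightarrow> \<kappa> i \<in> {..\<nu> 0}) \<and> (i \<notin> {..<N} \<longrightarrow> \<kappa> i = 0)"
      using N[of i] by auto
  qed
  moreover have "finite \<dots>"
    by (rule finite_set_of_finite_funs) auto
  ultimately show ?thesis by (rule finite_subset)
qed

lemma interlaced_partition:
  assumes "\<nu> \<in> partition_seqs" "interlaced \<kappa> \<nu>"
  shows "\<kappa> \<in> partition_seqs"
proof -
  obtain N where N: "\<And>i. N \<le> i \<Longrightarrow> \<nu> i = 0" using partition_bounded[OF assms(1)] by blast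
  have i: "\<nu> (Suc i) \<le> \<kappa> i" "\<kappa> i \<le> \<nu> i" for i using assms(2) by (auto simp: interlaced_def)
  show ?thesis
  proof (rule partition_seqsI)
    show "\<kappa> (Suc i) \<le> \<kappa> i" for i using i(1)[of i] i(2)[of "Suc i"] by linarith
    show "\<kappa> i = 0" if "N \<le> i" for i using i(2)[of i] N[OF that] by simp
  qed
qed

text \<open>
  A tableau with entries up to \<open>n + 1\<close> is a tableau with entries up to \<open>n\<close> on a smaller shape
  \<open>\<kappa>\<close> whose complement in \<open>\<nu>\<close> is filled with \<open>n + 1\<close>; columns increase strictly exactly if that
  complement is a horizontal strip.
\<close>

definition fill_strip ::
  "nat \<Rightarrow> (nat \<Rightarrow> nat) \<Rightarrow> (nat \<Rightarrow> nat) \<Rightarrow> (nat \<Rightarrow> nat) \<times> (nat \<times> nat \<Rightarrow> nat) \<Rightarrow> nat \<times> nat \<Rightarrow> nat" where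
  "fill_strip n \<nu> \<mu> = (\<lambda>(\<kappa>, T) c. if c \<in> skew_diagram \<kappa> \<mu> then T c
     else if c \<in> skew_diagram \<nu> \<mu> then Suc n else undefined)"

lemma fill_strip_bij:
  assumes \<nu>: "\<nu> \<in> partition_seqs" and \<mu>: "\<mu> \<in> partition_seqs" and le: "\<mu> \<le> \<nu>"
  shows "bij_betw (fill_strip n \<nu> \<mu>)
           (Sigma {\<kappa>. interlaced \<kappa> \<nu> \<and> \<mu> \<le> \<kappa>} (\<lambda>\<kappa>. ssyt n \<kappa> \<mu>)) (ssyt (Suc n) \<nu> \<mu>)"
proof -
  \<comment> \<open>The length of row \<open>i\<close> of the subshape occupied by the entries up to \<open>n\<close>.\<close>
  define shape where "shape = (\<lambda>T i. LEAST j. \<mu> i \<le> j \<and> (j < \<nu> i \<longrightarrow> n < (T :: nat \<times> nat \<Rightarrow> nat) (i, j)))"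
  have mn: "\<mu> i \<le> \<nu> i" "\<mu> (Suc i) \<le> \<mu> i" "\<nu> (Suc i) \<le> \<nu> i" for i
    using le by (auto simp: le_fun_def intro: partition_antimono[OF \<mu>] partition_antimono[OF \<nu>])
  have shape0: "\<mu> i \<le> shape T i \<and> (shape T i < \<nu> i \<longrightarrow> n < T (i, shape T i))" for T i
    unfolding shape_def by (rule LeastI[of _ "\<nu> i"]) (use mn(1)[of i] in simp)
  have shape1: "\<mu> i \<le> shape T i" "shape T i < \<nu> i \<Longrightarrow> n < T (i, shape T i)" for T i
    using shape0 by blast+
  have shape2: "shape T i \<le> \<nu> i" for T i
    unfolding shape_def by (rule Least_le) (use mn(1)[of i] in simp)
  have shape3: "T (i, j) \<le> n" if "\<mu> i \<le> j" "j < shape T i" for T i j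
    using not_less_Least[of j "\<lambda>j. \<mu> i \<le> j \<and> (j < \<nu> i \<longrightarrow> n < T (i, j))"] that
    unfolding shape_def by auto
  have row: "T (i, j) \<le> T (i, j')" if "T \<in> ssyt m l \<mu>" "\<mu> i \<le> j" "j \<le> j'" "j' < l i" for T m l i j j'
    using that unfolding ssyt_def by (force simp: skew_diagram_iff)
  have col: "T (i, j) < T (i', j)"
    if "T \<in> ssyt m l \<mu>" "\<mu> i \<le> j" "j < l i" "\<mu> i' \<le> j" "j < l i'" "i < i'" for T m l i i' j
    using that unfolding ssyt_def by (force simp: skew_diagram_iff)
  have rng: "T c \<in> {1..m}" if "T \<in> ssyt m l \<mu>" "c \<in> skew_diagram l \<mu>" for T m l c
    using that unfolding ssyt_def by (blast dest: PiE_mem)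
  have out: "T c = undefined" if "T \<in> ssyt m l \<mu>" "c \<notin> skew_diagram l \<mu>" for T m l c
    using that unfolding ssyt_def by (blast dest: PiE_arb)
  have shape4: "j < shape T i \<longleftrightarrow> T (i, j) \<le> n"
    if T: "T \<in> ssyt (Suc n) \<nu> \<mu>" and j: "\<mu> i \<le> j" "j < \<nu> i" for T i j
  proof
    assume "T (i, j) \<le> n"
    show "j < shape T i"
    proof (rule ccontr)
      assume "\<not> j < shape T i"
      then have "n < T (i, shape T i)" "T (i, shape T i) \<le> T (i, j)"
        using shape1(1)[of i T] shape1(2)[of T i] row[OF T, of i "shape T i" j] j by auto
      with \<open>T (i, j) \<le> n\<close> show False by simp
    qed
  qed (use shape3 j in auto)
  show ?thesis
  proof (rule bij_betw_byWitness[where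
        f' = "\<lambda>T. (shape T, \<lambda>c. if c \<in> skew_diagram (shape T) \<mu> then T c else undefined)"])
    show "\<forall>p\<in>Sigma {\<kappa>. interlaced \<kappa> \<nu> \<and> \<mu> \<le> \<kappa>} (\<lambda>\<kappa>. ssyt n \<kappa> \<mu>).
       (shape (fill_strip n \<nu> \<mu> p), \<lambda>c. if c \<in> skew_diagram (shape (fill_strip n \<nu> \<mu> p)) \<mu>
           then fill_strip n \<nu> \<mu> p c else undefined) = p"
    proof (rule ballI)
      fix p assume p: "p \<in> Sigma {\<kappa>. interlaced \<kappa> \<nu> \<and> \<mu> \<le> \<kappa>} (\<lambda>\<kappa>. ssyt n \<kappa> \<mu>)"
      obtain \<kappa> T where pp: "p = (\<kappa>, T)" by (cases p)
      have \<kappa>: "interlaced \<kappa> \<nu>" "\<mu> \<le> \<kappa>" and T: "T \<in> ssyt n \<kappa> \<mu>" using p by (auto simp: pp)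
      have k: "\<kappa> i \<le> \<nu> i" "\<mu> i \<le> \<kappa> i" for i using \<kappa> by (auto simp: interlaced_def le_fun_def)
      have sh: "shape (fill_strip n \<nu> \<mu> p) i = \<kappa> i" for i
        unfolding shape_def
      proof (rule Least_equality)
        show "\<mu> i \<le> \<kappa> i \<and> (\<kappa> i < \<nu> i \<longrightarrow> n < fill_strip n \<nu> \<mu> p (i, \<kappa> i))"
          using k[of i] by (auto simp: pp fill_strip_def skew_diagram_iff)
        fix j assume j: "\<mu> i \<le> j \<and> (j < \<nu> i \<longrightarrow> n < fill_strip n \<nu> \<mu> p (i, j))"
        show "\<kappa> i \<le> j"
        proof (rule ccontr)
          assume "\<not> \<kappa> i \<le> j"
          then have c: "(i, j) \<in> skew_diagram \<kappa> \<mu>" "j < \<nu> i"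
            using j k(1)[of i] by (auto simp: skew_diagram_iff)
          then show False using rng[OF T c(1)] j by (simp add: pp fill_strip_def)
        qed
      qed
      have "shape (fill_strip n \<nu> \<mu> p) = \<kappa>" using sh by blast
      moreover have "(\<lambda>c. if c \<in> skew_diagram \<kappa> \<mu> then fill_strip n \<nu> \<mu> p c else undefined) = T"
        using out[OF T] by (auto simp: pp fill_strip_def fun_eq_iff)
      ultimately show "(shape (fill_strip n \<nu> \<mu> p), \<lambda>c. if c \<in> skew_diagram (shape (fill_strip n \<nu> \<mu> p)) \<mu>
           then fill_strip n \<nu> \<mu> p c else undefined) = p" by (simp add: pp)
    qed
  next
    show "\<forall>T\<in>ssyt (Suc n) \<nu> \<mu>.
       fill_strip n \<nu> \<mu> (shape T, \<lambda>c. if c \<in> skew_diagram (shape T) \<mu> then T c else undefined) = T"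
    proof (intro ballI ext)
      fix T and c :: "nat \<times> nat" assume T: "T \<in> ssyt (Suc n) \<nu> \<mu>"
      obtain i j where c: "c = (i, j)" by (cases c)
      have "T c = Suc n" if "c \<notin> skew_diagram (shape T) \<mu>" "c \<in> skew_diagram \<nu> \<mu>"
        using rng[OF T that(2)] shape4[OF T, of i j] that by (auto simp: c skew_diagram_iff)
      moreover have "T c = undefined" if "c \<notin> skew_diagram \<nu> \<mu>" using out[OF T that] .
      ultimately show "fill_strip n \<nu> \<mu> (shape T, \<lambda>c. if c \<in> skew_diagram (shape T) \<mu> then T c else undefined) c = T c"
        by (simp add: fill_strip_def)
    qed
  next
    show "fill_strip n \<nu> \<mu> ` Sigma {\<kappa>. interlaced \<kappa> \<nu> \<and> \<mu> \<le> \<kappa>} (\<lambda>\<kappa>. ssyt n \<kappa> \<mu>) \<subseteq> ssyt (Suc n) \<nu> \<mu>"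
    proof (rule image_subsetI)
      fix p assume p: "p \<in> Sigma {\<kappa>. interlaced \<kappa> \<nu> \<and> \<mu> \<le> \<kappa>} (\<lambda>\<kappa>. ssyt n \<kappa> \<mu>)"
      obtain \<kappa> T where pp: "p = (\<kappa>, T)" by (cases p)
      have \<kappa>: "interlaced \<kappa> \<nu>" "\<mu> \<le> \<kappa>" and T: "T \<in> ssyt n \<kappa> \<mu>" using p by (auto simp: pp)
      have k: "\<kappa> i \<le> \<nu> i" "\<mu> i \<le> \<kappa> i" "\<nu> (Suc i) \<le> \<kappa> i" for i
        using \<kappa> by (auto simp: interlaced_def le_fun_def)
      have f: "fill_strip n \<nu> \<mu> p (i, j) = (if j < \<kappa> i then T (i, j) else Suc n)"
        if "\<mu> i \<le> j" "j < \<nu> i" for i j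
        using that by (auto simp: pp fill_strip_def skew_diagram_iff)
      have r: "T (i, j) \<in> {1..n}" if "\<mu> i \<le> j" "j < \<kappa> i" for i j
        by (rule rng[OF T]) (use that in \<open>auto simp: skew_diagram_iff\<close>)
      have up: "j < \<kappa> i" if "j < \<nu> i'" "i < i'" for i i' j
        using k(3)[of i] partition_antimono[OF \<nu>, of "Suc i" i'] that by simp
      show "fill_strip n \<nu> \<mu> p \<in> ssyt (Suc n) \<nu> \<mu>"
        unfolding ssyt_def
      proof (intro CollectI conjI allI impI)
        show "fill_strip n \<nu> \<mu> p \<in> skew_diagram \<nu> \<mu> \<rightarrow>\<^sub>E {1..Suc n}"
        proof (rule PiE_I)
          fix c assume "c \<in> skew_diagram \<nu> \<mu>"
          then show "fill_strip n \<nu> \<mu> p c \<in> {1..Suc n}"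
            using f r by (cases c) (fastforce simp: skew_diagram_iff)
        next
          fix c assume c: "c \<notin> skew_diagram \<nu> \<mu>"
          then have "c \<notin> skew_diagram \<kappa> \<mu>"
            using k(1) by (cases c) (auto simp: skew_diagram_iff dest: less_le_trans)
          with c show "fill_strip n \<nu> \<mu> p c = undefined" by (simp add: pp fill_strip_def)
        qed
      next
        fix i j j' assume a: "(i, j) \<in> skew_diagram \<nu> \<mu> \<and> (i, j') \<in> skew_diagram \<nu> \<mu> \<and> j \<le> j'"
        have "T (i, j) \<le> T (i, j')" if "j' < \<kappa> i"
          using row[OF T, of i j j'] a that by (simp add: skew_diagram_iff)
        then show "fill_strip n \<nu> \<mu> p (i, j) \<le> fill_strip n \<nu> \<mu> p (i, j')"
          using a r[of i j] by (auto simp: f skew_diagram_iff)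
      next
        fix i i' j assume a: "(i, j) \<in> skew_diagram \<nu> \<mu> \<and> (i', j) \<in> skew_diagram \<nu> \<mu> \<and> i < i'"
        have j: "j < \<kappa> i" using up[of j i' i] a by (simp add: skew_diagram_iff)
        have "T (i, j) < T (i', j)" if "j < \<kappa> i'"
          using col[OF T, of i j i'] a j that by (simp add: skew_diagram_iff)
        then show "fill_strip n \<nu> \<mu> p (i, j) < fill_strip n \<nu> \<mu> p (i', j)"
          using a r[of i j] j by (auto simp: f skew_diagram_iff)
      qed
    qed
  next
    show "(\<lambda>T. (shape T, \<lambda>c. if c \<in> skew_diagram (shape T) \<mu> then T c else undefined)) ` ssyt (Suc n) \<nu> \<mu>
       \<subseteq> Sigma {\<kappa>. interlaced \<kappa> \<nu> \<and> \<mu> \<le> \<kappa>} (\<lambda>\<kappa>. ssyt n \<kappa> \<mu>)"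
    proof (rule image_subsetI)
      fix T assume T: "T \<in> ssyt (Suc n) \<nu> \<mu>"
      have "\<nu> (Suc i) \<le> shape T i" for i
      proof (rule ccontr)
        assume "\<not> \<nu> (Suc i) \<le> shape T i"
        then have lt: "shape T i < \<nu> (Suc i)" by simp
        have lt': "shape T i < \<nu> i" using lt mn(3)[of i] by linarith
        have ge: "\<mu> (Suc i) \<le> shape T i" using shape1(1)[of i T] mn(2)[of i] by linarith
        have "n < T (i, shape T i)" using shape1(2)[OF lt'] .
        moreover have "T (i, shape T i) < T (Suc i, shape T i)"
          using col[OF T, of i "shape T i" "Suc i"] lt lt' ge shape1(1)[of i T] by simp
        moreover have "T (Suc i, shape T i) \<in> {1..Suc n}"
          by (rule rng[OF T]) (use lt ge in \<open>simp add: skew_diagram_iff\<close>)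
        ultimately show False by simp
      qed
      then have "interlaced (shape T) \<nu>" "\<mu> \<le> shape T"
        using shape1(1) shape2 by (auto simp: interlaced_def le_fun_def)
      moreover have "(\<lambda>c. if c \<in> skew_diagram (shape T) \<mu> then T c else undefined) \<in> ssyt n (shape T) \<mu>"
        unfolding ssyt_def
      proof (intro CollectI conjI allI impI)
        show "(\<lambda>c. if c \<in> skew_diagram (shape T) \<mu> then T c else undefined) \<in> skew_diagram (shape T) \<mu> \<rightarrow>\<^sub>E {1..n}"
        proof (rule PiE_I)
          fix c assume c: "c \<in> skew_diagram (shape T) \<mu>"
          obtain i j where ij: "c = (i, j)" by (cases c)
          have b: "\<mu> i \<le> j" "j < shape T i" using c by (auto simp: ij skew_diagram_iff)
          have "T c \<in> {1..Suc n}"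
            by (rule rng[OF T]) (use b shape2[of T i] in \<open>simp add: ij skew_diagram_iff\<close>)
          moreover have "T c \<le> n" using shape3[OF b] by (simp add: ij)
          ultimately show "(if c \<in> skew_diagram (shape T) \<mu> then T c else undefined) \<in> {1..n}"
            using c by simp
        qed simp
      next
        fix i j j' assume a: "(i, j) \<in> skew_diagram (shape T) \<mu> \<and> (i, j') \<in> skew_diagram (shape T) \<mu> \<and> j \<le> j'"
        then have "T (i, j) \<le> T (i, j')"
          using row[OF T, of i j j'] shape2[of T i] by (simp add: skew_diagram_iff)
        with a show "(if (i, j) \<in> skew_diagram (shape T) \<mu> then T (i, j) else undefined)
            \<le> (if (i, j') \<in> skew_diagram (shape T) \<mu> then T (i, j') else undefined)" by simp
      next
        fix i i' j assume a: "(i, j) \<in> skew_diagram (shape T) \<mu> \<and> (i', j) \<in> skew_diagram (shape T) \<mu> \<and> i < i'"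
        then have "T (i, j) < T (i', j)"
          using col[OF T, of i j i'] shape2[of T i] shape2[of T i'] by (simp add: skew_diagram_iff)
        with a show "(if (i, j) \<in> skew_diagram (shape T) \<mu> then T (i, j) else undefined)
            < (if (i', j) \<in> skew_diagram (shape T) \<mu> then T (i', j) else undefined)" by simp
      qed
      ultimately show "(shape T, \<lambda>c. if c \<in> skew_diagram (shape T) \<mu> then T c else undefined)
         \<in> Sigma {\<kappa>. interlaced \<kappa> \<nu> \<and> \<mu> \<le> \<kappa>} (\<lambda>\<kappa>. ssyt n \<kappa> \<mu>)" by simp
    qed
  qed
qed

lemma skew_schur_branching:
  assumes \<nu>: "\<nu> \<in> partition_seqs" and \<mu>: "\<mu> \<in> partition_seqs"
  shows "skew_schur (Suc n) \<nu> \<mu> x = (\<Sum>\<kappa> | interlaced \<kappa> \<nu> \<and> \<mu> \<le> \<kappa>.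
           skew_schur n \<kappa> \<mu> x * x (Suc n) ^ (part_size \<nu> - part_size \<kappa>))"
proof (cases "\<mu> \<le> \<nu>")
  case False
  then have e: "{\<kappa>. interlaced \<kappa> \<nu> \<and> \<mu> \<le> \<kappa>} = {}" using interlaced_le order_trans by blast
  show ?thesis using False unfolding e by (simp add: skew_schur_def)
next
  case True
  let ?K = "{\<kappa>. interlaced \<kappa> \<nu> \<and> \<mu> \<le> \<kappa>}"
  have fin: "finite ?K"
    by (rule finite_subset[OF _ finite_below_partition[OF \<nu>]]) (auto dest: interlaced_le)
  have "skew_schur (Suc n) \<nu> \<mu> x = (\<Sum>T\<in>ssyt (Suc n) \<nu> \<mu>. \<Prod>c\<in>skew_diagram \<nu> \<mu>. x (T c))"
    using True by (simp add: skew_schur_def)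
  also have "\<dots> = (\<Sum>p\<in>Sigma ?K (\<lambda>\<kappa>. ssyt n \<kappa> \<mu>). \<Prod>c\<in>skew_diagram \<nu> \<mu>. x (fill_strip n \<nu> \<mu> p c))"
    by (rule sum.reindex_bij_betw[OF fill_strip_bij[OF \<nu> \<mu> True], symmetric])
  also have "\<dots> = (\<Sum>(\<kappa>, T)\<in>Sigma ?K (\<lambda>\<kappa>. ssyt n \<kappa> \<mu>).
      (\<Prod>c\<in>skew_diagram \<kappa> \<mu>. x (T c)) * x (Suc n) ^ (part_size \<nu> - part_size \<kappa>))"
  proof (rule sum.cong, rule refl)
    fix p assume p: "p \<in> Sigma ?K (\<lambda>\<kappa>. ssyt n \<kappa> \<mu>)"
    obtain \<kappa> T where pp: "p = (\<kappa>, T)" by (cases p)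
    have \<kappa>: "interlaced \<kappa> \<nu>" "\<mu> \<le> \<kappa>" using p by (auto simp: pp)
    have kn: "\<kappa> \<le> \<nu>" using \<kappa>(1) by (rule interlaced_le)
    have k: "\<kappa> i \<le> \<nu> i" "\<mu> i \<le> \<kappa> i" for i using kn \<kappa> by (auto simp: le_fun_def)
    have \<kappa>P: "\<kappa> \<in> partition_seqs" using interlaced_partition[OF \<nu> \<kappa>(1)] .
    have split: "skew_diagram \<nu> \<mu> = skew_diagram \<kappa> \<mu> \<union> skew_diagram \<nu> \<kappa>"
      using k by (auto simp: skew_diagram_def not_less intro: less_le_trans order_trans)
    have disj: "skew_diagram \<kappa> \<mu> \<inter> skew_diagram \<nu> \<kappa> = {}"
      by (auto simp: skew_diagram_def)
    have "(\<Prod>c\<in>skew_diagram \<nu> \<mu>. x (fill_strip n \<nu> \<mu> p c))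
        = (\<Prod>c\<in>skew_diagram \<kappa> \<mu>. x (fill_strip n \<nu> \<mu> p c)) * (\<Prod>c\<in>skew_diagram \<nu> \<kappa>. x (fill_strip n \<nu> \<mu> p c))"
      unfolding split using \<nu> \<kappa>P disj by (intro prod.union_disjoint finite_skew_diagram) auto
    also have "(\<Prod>c\<in>skew_diagram \<kappa> \<mu>. x (fill_strip n \<nu> \<mu> p c)) = (\<Prod>c\<in>skew_diagram \<kappa> \<mu>. x (T c))"
      by (rule prod.cong) (auto simp: pp fill_strip_def)
    also have "(\<Prod>c\<in>skew_diagram \<nu> \<kappa>. x (fill_strip n \<nu> \<mu> p c)) = (\<Prod>c\<in>skew_diagram \<nu> \<kappa>. x (Suc n))"
      by (rule prod.cong) (use disj split in \<open>auto simp: pp fill_strip_def\<close>)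
    also have "\<dots> = x (Suc n) ^ (part_size \<nu> - part_size \<kappa>)"
      by (simp add: card_skew_diagram[OF \<nu> kn])
    finally show "(\<Prod>c\<in>skew_diagram \<nu> \<mu>. x (fill_strip n \<nu> \<mu> p c)) = (case p of (\<kappa>, T) \<Rightarrow>
      (\<Prod>c\<in>skew_diagram \<kappa> \<mu>. x (T c)) * x (Suc n) ^ (part_size \<nu> - part_size \<kappa>))" by (simp add: pp)
  qed
  also have "\<dots> = (\<Sum>\<kappa>\<in>?K. \<Sum>T\<in>ssyt n \<kappa> \<mu>.
      (\<Prod>c\<in>skew_diagram \<kappa> \<mu>. x (T c)) * x (Suc n) ^ (part_size \<nu> - part_size \<kappa>))"
    using fin by (intro sum.Sigma[symmetric]) (auto intro!: finite_ssyt interlaced_partition[OF \<nu>])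
  also have "\<dots> = (\<Sum>\<kappa>\<in>?K. skew_schur n \<kappa> \<mu> x * x (Suc n) ^ (part_size \<nu> - part_size \<kappa>))"
    by (rule sum.cong) (auto simp: skew_schur_def sum_distrib_right)
  finally show ?thesis .
qed

lemma skew_schur_0:
  assumes "\<nu> \<in> partition_seqs"
  shows "skew_schur 0 \<nu> \<mu> x = (if \<mu> = \<nu> then 1 else 0)"
proof (cases "\<mu> \<le> \<nu> \<and> \<mu> \<noteq> \<nu>")
  case True
  then obtain i where "\<mu> i < \<nu> i" by (metis le_fun_def linorder_neqE_nat not_le ext)
  then have "(i, \<mu> i) \<in> skew_diagram \<nu> \<mu>" by (simp add: skew_diagram_iff)
  then have "ssyt 0 \<nu> \<mu> = {}" by (auto simp: ssyt_def PiE_def Pi_def)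
  with True show ?thesis by (simp add: skew_schur_def)
next
  case False
  moreover have "skew_diagram \<nu> \<nu> = {}" by (auto simp: skew_diagram_def)
  then have "skew_schur 0 \<nu> \<nu> x = 1"
    by (simp add: skew_schur_def ssyt_def)
  ultimately show ?thesis by (auto simp: skew_schur_def)
qed

text \<open>
  For non-negative variables all sums of tableau weights are non-negative reals, so the branching rule
  identifies them with sums over chains in the extended non-negative reals.
\<close>

lemma skew_schur_nonneg_real:
  assumes \<mu>: "\<mu> \<in> partition_seqs" and x: "\<And>j. j \<in> {1..n} \<Longrightarrow> 0 \<le> x j"
    and \<nu>: "\<nu> \<in> partition_seqs"
  shows "\<exists>s\<ge>0. skew_schur n \<nu> \<mu> (\<lambda>j. complex_of_real (x j)) = complex_of_real s \<and>
           strip_chains (\<lambda>j. ennreal (x j)) n \<mu> \<nu> = ennreal s"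
  using x \<nu>
proof (induction n arbitrary: \<nu>)
  case 0
  then show ?case
    using \<mu> by (intro exI[of _ "if \<mu> = \<nu> then 1 else 0"]) (auto simp: skew_schur_0)
next
  case (Suc n)
  let ?X = "\<lambda>j. complex_of_real (x j)" and ?x = "\<lambda>j. ennreal (x j)"
  let ?K = "{\<kappa>. interlaced \<kappa> \<nu> \<and> \<mu> \<le> \<kappa>}"
  have fin: "finite ?K"
    by (rule finite_subset[OF _ finite_below_partition[OF Suc.prems(2)]]) (auto dest: interlaced_le)
  have KP: "\<kappa> \<in> partition_seqs" if "interlaced \<kappa> \<nu>" for \<kappa>
    using interlaced_partition[OF Suc.prems(2)] that by auto
  have "\<forall>\<kappa>\<in>partition_seqs. \<exists>s\<ge>0. skew_schur n \<kappa> \<mu> ?X = complex_of_real s \<and>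
           strip_chains ?x n \<mu> \<kappa> = ennreal s"
    using Suc.IH Suc.prems(1) by simp
  then obtain s where s: "\<And>\<kappa>. \<kappa> \<in> partition_seqs \<Longrightarrow> s \<kappa> \<ge> 0"
      "\<And>\<kappa>. \<kappa> \<in> partition_seqs \<Longrightarrow> skew_schur n \<kappa> \<mu> ?X = complex_of_real (s \<kappa>)"
      "\<And>\<kappa>. \<kappa> \<in> partition_seqs \<Longrightarrow> strip_chains ?x n \<mu> \<kappa> = ennreal (s \<kappa>)"
    by metis
  let ?s = "\<Sum>\<kappa>\<in>?K. s \<kappa> * x (Suc n) ^ (part_size \<nu> - part_size \<kappa>)"
  have x0: "0 \<le> x (Suc n)" using Suc.prems by simp
  have nn: "0 \<le> s \<kappa> * x (Suc n) ^ (part_size \<nu> - part_size \<kappa>)" if "\<kappa> \<in> ?K" for \<kappa>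
    using that s(1) KP x0 by simp
  have "skew_schur (Suc n) \<nu> \<mu> ?X = complex_of_real ?s"
    unfolding skew_schur_branching[OF Suc.prems(2) \<mu>] of_real_sum
    by (rule sum.cong) (use s(2) KP in auto)
  moreover have "strip_chains ?x (Suc n) \<mu> \<nu> = ennreal ?s"
  proof -
    have z: "s \<kappa> = 0" if "\<kappa> \<in> partition_seqs" "\<not> \<mu> \<le> \<kappa>" for \<kappa>
      using s(2)[OF that(1)] that(2) by (simp add: skew_schur_def)
    have "strip_chains ?x (Suc n) \<mu> \<nu> = (\<Sum>\<kappa>\<in>?K. strip_chains ?x n \<mu> \<kappa> * strip_weight (?x (Suc n)) \<kappa> \<nu>)"
      unfolding strip_chains.simps
      by (rule nn_integral_count_space'[OF fin]) (auto simp: strip_weight_def s(3) z)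
    also have "\<dots> = (\<Sum>\<kappa>\<in>?K. ennreal (s \<kappa> * x (Suc n) ^ (part_size \<nu> - part_size \<kappa>)))"
      by (rule sum.cong)
        (use s(1,3) KP x0 Suc.prems(2) in \<open>auto simp: strip_weight_def ennreal_mult ennreal_power\<close>)
    also have "\<dots> = ennreal ?s" using nn by (rule sum_ennreal)
    finally show ?thesis .
  qed
  moreover have "0 \<le> ?s" using nn by (rule sum_nonneg)
  ultimately show ?case by blast
qed

lemma pf_tau_nonneg_real:
  assumes y: "\<And>j. j \<in> {1..k} \<Longrightarrow> 0 \<le> y j" and \<nu>: "\<nu> \<in> partition_seqs"
  shows "\<exists>t\<ge>0. pf_tau k (\<lambda>j. complex_of_real (y j)) \<nu> = complex_of_real t \<and>
           paired_chains (\<lambda>j. ennreal (y j)) k \<nu> = ennreal t"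
proof -
  let ?Y = "\<lambda>j. complex_of_real (y j)" and ?y = "\<lambda>j. ennreal (y j)"
  let ?M = "{\<mu>. \<mu> \<in> partition_seqs \<and> even_part (transpose_part \<mu>) \<and> \<mu> \<le> \<nu>}"
  have fin: "finite ?M"
    by (rule finite_subset[OF _ finite_below_partition[OF \<nu>]]) auto
  have "\<forall>\<mu>\<in>partition_seqs. \<exists>s\<ge>0. skew_schur k \<nu> \<mu> ?Y = complex_of_real s \<and>
           strip_chains ?y k \<mu> \<nu> = ennreal s"
    using skew_schur_nonneg_real y \<nu> by blast
  then obtain s where s: "\<And>\<mu>. \<mu> \<in> partition_seqs \<Longrightarrow> s \<mu> \<ge> 0"
      "\<And>\<mu>. \<mu> \<in> partition_seqs \<Longrightarrow> skew_schur k \<nu> \<mu> ?Y = complex_of_real (s \<mu>)"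
      "\<And>\<mu>. \<mu> \<in> partition_seqs \<Longrightarrow> strip_chains ?y k \<mu> \<nu> = ennreal (s \<mu>)"
    by metis
  have z: "s \<mu> = 0" if "\<mu> \<in> partition_seqs" "\<not> \<mu> \<le> \<nu>" for \<mu>
    using s(2)[OF that(1)] that(2) by (simp add: skew_schur_def)
  have "pf_tau k ?Y \<nu> = complex_of_real (\<Sum>\<mu>\<in>?M. s \<mu>)"
    unfolding pf_tau_def of_real_sum by (rule sum.cong) (use s(2) in auto)
  moreover have "paired_chains ?y k \<nu> = ennreal (\<Sum>\<mu>\<in>?M. s \<mu>)"
  proof -
    have "paired_chains ?y k \<nu> = (\<Sum>\<mu>\<in>?M. paired_rows \<mu> * strip_chains ?y k \<mu> \<nu>)"
      unfolding paired_chains_def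
      by (rule nn_integral_count_space'[OF fin]) (auto simp: paired_rows_def s(3) z)
    also have "\<dots> = (\<Sum>\<mu>\<in>?M. ennreal (s \<mu>))"
      by (rule sum.cong) (auto simp: paired_rows_def s(3))
    also have "\<dots> = ennreal (\<Sum>\<mu>\<in>?M. s \<mu>)" using s(1) by (intro sum_ennreal) auto
    finally show ?thesis .
  qed
  moreover have "0 \<le> (\<Sum>\<mu>\<in>?M. s \<mu>)" using s(1) by (intro sum_nonneg) auto
  ultimately show ?thesis by blast
qed

section \<open>The product formula for the partition function\<close>

lemma nn_integral_eq_infsum:
  fixes f :: "'a \<Rightarrow> real"
  assumes "f summable_on A" and "\<And>a. a \<in> A \<Longrightarrow> 0 \<le> f a"
  shows "(\<integral>\<^sup>+a. ennreal (f a) \<partial>count_space A) = ennreal (infsum f A)"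
proof -
  have "(\<lambda>a. norm (f a)) summable_on A"
    using assms by (subst summable_on_cong[of A _ f]) auto
  then have "Infinite_Set_Sum.abs_summable_on f A" using abs_summable_equivalent by blast
  then show ?thesis
    using nn_integral_conv_infsetsum[of f A] infsetsum_infsum[of f A] assms(2) by simp
qed

lemma pf_Z_nonneg_real:
  assumes x: "\<And>j. j \<in> {1..n} \<Longrightarrow> 0 \<le> x j" and y: "\<And>j. j \<in> {1..k} \<Longrightarrow> 0 \<le> y j"
    and conv: "pf_Z_abs_convergent n k (\<lambda>j. complex_of_real (y j)) (\<lambda>j. complex_of_real (x j))"
  shows "\<exists>Z\<ge>0. pf_Z n k (\<lambda>j. complex_of_real (y j)) (\<lambda>j. complex_of_real (x j)) = complex_of_real Z \<and>
     ennreal Z = (\<Prod>j=1..n. \<Prod>i=1..<j. \<Sum>m. (ennreal (x i) * ennreal (x j)) ^ m) *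
       (\<Prod>j=1..k. \<Prod>i=1..n. \<Sum>m. (ennreal (x i) * ennreal (y j)) ^ m)"
proof -
  let ?X = "\<lambda>j. complex_of_real (x j)" and ?x = "\<lambda>j. ennreal (x j)"
  let ?Y = "\<lambda>j. complex_of_real (y j)" and ?y = "\<lambda>j. ennreal (y j)"
  have "\<forall>\<nu>\<in>partition_seqs. \<exists>s\<ge>0. schur n \<nu> ?X = complex_of_real s \<and>
           strip_chains ?x n (\<lambda>_. 0) \<nu> = ennreal s"
    unfolding schur_def using skew_schur_nonneg_real[OF zero_partition, of n x] x by blast
  then obtain s where s: "\<And>\<nu>. \<nu> \<in> partition_seqs \<Longrightarrow> s \<nu> \<ge> 0"
      "\<And>\<nu>. \<nu> \<in> partition_seqs \<Longrightarrow> schur n \<nu> ?X = complex_of_real (s \<nu>)"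
      "\<And>\<nu>. \<nu> \<in> partition_seqs \<Longrightarrow> strip_chains ?x n (\<lambda>_. 0) \<nu> = ennreal (s \<nu>)"
    by metis
  have "\<forall>\<nu>\<in>partition_seqs. \<exists>t\<ge>0. pf_tau k ?Y \<nu> = complex_of_real t \<and>
           paired_chains ?y k \<nu> = ennreal t"
    using pf_tau_nonneg_real[of k y] y by blast
  then obtain t where t: "\<And>\<nu>. \<nu> \<in> partition_seqs \<Longrightarrow> t \<nu> \<ge> 0"
      "\<And>\<nu>. \<nu> \<in> partition_seqs \<Longrightarrow> pf_tau k ?Y \<nu> = complex_of_real (t \<nu>)"
      "\<And>\<nu>. \<nu> \<in> partition_seqs \<Longrightarrow> paired_chains ?y k \<nu> = ennreal (t \<nu>)"
    by metis
  have summ: "(\<lambda>\<nu>. t \<nu> * s \<nu>) summable_on partition_seqs"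
    using conv unfolding pf_Z_abs_convergent_def
    by (rule summable_on_cong[THEN iffD1, rotated]) (use s(1,2) t(1,2) in \<open>simp add: norm_mult\<close>)
  define Z where "Z = (\<Sum>\<^sub>\<infinity>\<nu>\<in>partition_seqs. t \<nu> * s \<nu>)"
  have "pf_Z n k ?Y ?X = (\<Sum>\<^sub>\<infinity>\<nu>\<in>partition_seqs. complex_of_real (t \<nu> * s \<nu>))"
    unfolding pf_Z_def by (rule infsum_cong) (use s(2) t(2) in simp)
  also have "\<dots> = complex_of_real Z"
    unfolding Z_def using summ by (intro infsumI has_sum_of_real) simp
  finally have 1: "pf_Z n k ?Y ?X = complex_of_real Z" .
  have nn: "0 \<le> t \<nu> * s \<nu>" if "\<nu> \<in> partition_seqs" for \<nu> using that s(1) t(1) by simp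
  have "ennreal Z = (\<integral>\<^sup>+\<nu>. ennreal (t \<nu> * s \<nu>) \<partial>count_space partition_seqs)"
    unfolding Z_def using nn_integral_eq_infsum[OF summ nn] by simp
  also have "\<dots> = (\<integral>\<^sup>+\<nu>. paired_chains ?y k \<nu> * strip_chains ?x n (\<lambda>_. 0) \<nu> \<partial>count_space partition_seqs)"
    by (rule nn_integral_cong) (simp add: s(1,3) t(1,3) ennreal_mult)
  also have "\<dots> = (\<integral>\<^sup>+\<nu>. paired_chains ?y k \<nu> * strip_chains ?x n (\<lambda>_. 0) \<nu> \<partial>count_space UNIV)"
    by (rule nn_integral_count_space_eq) (auto simp: strip_chains_nonpartition)
  finally have 2: "ennreal Z = \<dots>" .
  have "0 \<le> Z" unfolding Z_def using nn by (rule infsum_nonneg)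
  with 1 2 show ?thesis unfolding partition_function_chains by blast
qed

lemma geometric_ennreal:
  assumes "0 \<le> a" "(\<Sum>m. ennreal a ^ m) \<noteq> top"
  shows "a < 1 \<and> (\<Sum>m. ennreal a ^ m) = ennreal (1 / (1 - a))"
proof -
  have e: "(\<Sum>m. ennreal a ^ m) = (\<Sum>m. ennreal (a ^ m))"
    using assms(1) by (simp add: ennreal_power)
  have "summable (\<lambda>m. a ^ m)"
    using assms unfolding e by (intro summable_suminf_not_top) auto
  then have "a < 1" using assms(1) by (simp add: summable_geometric_iff)
  moreover have "(\<Sum>m. ennreal (a ^ m)) = ennreal (1 / (1 - a))"
    using assms(1) calculation by (intro suminf_ennreal_eq geometric_sums) auto
  ultimately show ?thesis using e by simp
qed

lemma ennreal_prod_ge1_finite: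
  fixes f :: "'a \<Rightarrow> ennreal"
  assumes "finite A" "\<And>a. a \<in> A \<Longrightarrow> 1 \<le> f a"
  shows "1 \<le> prod f A \<and> (prod f A \<noteq> top \<longrightarrow> (\<forall>a\<in>A. f a \<noteq> top))"
  using assms
proof (induction A rule: finite_induct)
  case (insert a A)
  have "1 \<le> f a" "1 \<le> prod f A" using insert by auto
  then have ne: "f a \<noteq> 0" "prod f A \<noteq> 0" by (metis not_one_le_zero)+
  have "1 * 1 \<le> f a * prod f A" using insert by (intro mult_mono) auto
  then show ?case using insert ne by (auto simp: ennreal_mult_eq_top_iff)
qed auto

text \<open>
  All factors of the product are at least \<open>1\<close>, so a finite product forces every geometric series to
  converge. Thus absolute convergence of the sum over partitions yields the bounds on the variables
  that the product formula needs.
\<close>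

lemma pf_Z_product_real:
  assumes x: "\<And>j. j \<in> {1..n} \<Longrightarrow> 0 \<le> x j" and y: "\<And>j. j \<in> {1..k} \<Longrightarrow> 0 \<le> y j"
    and conv: "pf_Z_abs_convergent n k (\<lambda>j. complex_of_real (y j)) (\<lambda>j. complex_of_real (x j))"
  shows "\<And>i j. j \<in> {1..n} \<Longrightarrow> i \<in> {1..<j} \<Longrightarrow> x i * x j < 1"
    and "\<And>i j. j \<in> {1..k} \<Longrightarrow> i \<in> {1..n} \<Longrightarrow> x i * y j < 1"
    and "pf_Z n k (\<lambda>j. complex_of_real (y j)) (\<lambda>j. complex_of_real (x j)) =
     complex_of_real ((\<Prod>j=1..n. \<Prod>i=1..<j. 1 / (1 - x i * x j)) *
       (\<Prod>j=1..k. \<Prod>i=1..n. 1 / (1 - x i * y j)))"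
proof -
  define G where "G = (\<lambda>a. \<Sum>m. ennreal a ^ m)"
  have G1: "1 \<le> G a" for a
  proof -
    have "(\<Sum>m<Suc 0. ennreal a ^ m) \<le> G a"
      unfolding G_def by (rule sum_le_suminf) auto
    then show ?thesis by simp
  qed
  obtain Z where Z: "0 \<le> Z"
    "pf_Z n k (\<lambda>j. complex_of_real (y j)) (\<lambda>j. complex_of_real (x j)) = complex_of_real Z"
    "ennreal Z = (\<Prod>j=1..n. \<Prod>i=1..<j. \<Sum>m. (ennreal (x i) * ennreal (x j)) ^ m) *
       (\<Prod>j=1..k. \<Prod>i=1..n. \<Sum>m. (ennreal (x i) * ennreal (y j)) ^ m)"
    using pf_Z_nonneg_real[OF x y conv] by blast
  define P where "P = (\<Prod>j=1..n. \<Prod>i=1..<j. G (x i * x j))"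
  define Q where "Q = (\<Prod>j=1..k. \<Prod>i=1..n. G (x i * y j))"
  have "(\<Prod>j=1..n. \<Prod>i=1..<j. \<Sum>m. (ennreal (x i) * ennreal (x j)) ^ m) = P"
    unfolding P_def G_def by (intro prod.cong refl) (use x in \<open>simp add: ennreal_mult\<close>)
  moreover have "(\<Prod>j=1..k. \<Prod>i=1..n. \<Sum>m. (ennreal (x i) * ennreal (y j)) ^ m) = Q"
    unfolding Q_def G_def by (intro prod.cong refl) (use x y in \<open>simp add: ennreal_mult\<close>)
  ultimately have ZPQ: "ennreal Z = P * Q" using Z(3) by simp
  have inner: "1 \<le> (\<Prod>i=1..<j. G (x i * x j))" "1 \<le> (\<Prod>i=1..n. G (x i * y j'))" for j j'
    using ennreal_prod_ge1_finite[of "{1..<j}" "\<lambda>i. G (x i * x j)"]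
      ennreal_prod_ge1_finite[of "{1..n}" "\<lambda>i. G (x i * y j')"] G1 by auto
  have P1: "1 \<le> P \<and> (P \<noteq> top \<longrightarrow> (\<forall>j\<in>{1..n}. (\<Prod>i=1..<j. G (x i * x j)) \<noteq> top))"
    unfolding P_def using inner by (intro ennreal_prod_ge1_finite) auto
  have Q1: "1 \<le> Q \<and> (Q \<noteq> top \<longrightarrow> (\<forall>j\<in>{1..k}. (\<Prod>i=1..n. G (x i * y j)) \<noteq> top))"
    unfolding Q_def using inner by (intro ennreal_prod_ge1_finite) auto
  have ne0: "P \<noteq> 0" "Q \<noteq> 0" using P1 Q1 by auto
  have "P * Q \<noteq> top" unfolding ZPQ[symmetric] by simp
  then have fin: "P \<noteq> top" "Q \<noteq> top" using ne0 by (auto simp: ennreal_mult_eq_top_iff)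
  have finP: "G (x i * x j) \<noteq> top" if "j \<in> {1..n}" "i \<in> {1..<j}" for i j
    using P1 fin that ennreal_prod_ge1_finite[of "{1..<j}" "\<lambda>i. G (x i * x j)"] G1 by auto
  have finQ: "G (x i * y j) \<noteq> top" if "j \<in> {1..k}" "i \<in> {1..n}" for i j
    using Q1 fin that ennreal_prod_ge1_finite[of "{1..n}" "\<lambda>i. G (x i * y j)"] G1 by auto
  have gP: "x i * x j < 1 \<and> G (x i * x j) = ennreal (1 / (1 - x i * x j))"
    if "j \<in> {1..n}" "i \<in> {1..<j}" for i j
    using finP[OF that] that x unfolding G_def by (intro geometric_ennreal) auto
  have gQ: "x i * y j < 1 \<and> G (x i * y j) = ennreal (1 / (1 - x i * y j))"
    if "j \<in> {1..k}" "i \<in> {1..n}" for i j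
    using finQ[OF that] that x y unfolding G_def by (intro geometric_ennreal) auto
  show "x i * x j < 1" if "j \<in> {1..n}" "i \<in> {1..<j}" for i j using gP[OF that] by blast
  show "x i * y j < 1" if "j \<in> {1..k}" "i \<in> {1..n}" for i j using gQ[OF that] by blast
  have "P = ennreal (\<Prod>j=1..n. \<Prod>i=1..<j. 1 / (1 - x i * x j))"
  proof -
    have "P = (\<Prod>j=1..n. \<Prod>i=1..<j. ennreal (1 / (1 - x i * x j)))"
      unfolding P_def by (intro prod.cong refl) (use gP in auto)
    also have "\<dots> = (\<Prod>j=1..n. ennreal (\<Prod>i=1..<j. 1 / (1 - x i * x j)))"
      by (intro prod.cong refl prod_ennreal) (use gP in \<open>auto intro: less_imp_le\<close>)
    also have "\<dots> = ennreal (\<Prod>j=1..n. \<Prod>i=1..<j. 1 / (1 - x i * x j))"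
      by (intro prod_ennreal prod_nonneg) (use gP in \<open>auto intro: less_imp_le\<close>)
    finally show ?thesis .
  qed
  moreover have "Q = ennreal (\<Prod>j=1..k. \<Prod>i=1..n. 1 / (1 - x i * y j))"
  proof -
    have "Q = (\<Prod>j=1..k. \<Prod>i=1..n. ennreal (1 / (1 - x i * y j)))"
      unfolding Q_def by (intro prod.cong refl) (use gQ in auto)
    also have "\<dots> = (\<Prod>j=1..k. ennreal (\<Prod>i=1..n. 1 / (1 - x i * y j)))"
      by (intro prod.cong refl prod_ennreal) (use gQ in \<open>auto intro: less_imp_le\<close>)
    also have "\<dots> = ennreal (\<Prod>j=1..k. \<Prod>i=1..n. 1 / (1 - x i * y j))"
      by (intro prod_ennreal prod_nonneg) (use gQ in \<open>auto intro: less_imp_le\<close>)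
    finally show ?thesis .
  qed
  moreover have nnP: "0 \<le> (\<Prod>j=1..n. \<Prod>i=1..<j. 1 / (1 - x i * x j))"
    by (intro prod_nonneg) (use gP in \<open>auto intro: less_imp_le\<close>)
  moreover have nnQ: "0 \<le> (\<Prod>j=1..k. \<Prod>i=1..n. 1 / (1 - x i * y j))"
    by (intro prod_nonneg) (use gQ in \<open>auto intro: less_imp_le\<close>)
  ultimately have "Z = (\<Prod>j=1..n. \<Prod>i=1..<j. 1 / (1 - x i * x j)) *
       (\<Prod>j=1..k. \<Prod>i=1..n. 1 / (1 - x i * y j))"
    using ZPQ Z(1) by (simp add: ennreal_mult[symmetric])
  then show "pf_Z n k (\<lambda>j. complex_of_real (y j)) (\<lambda>j. complex_of_real (x j)) =
     complex_of_real ((\<Prod>j=1..n. \<Prod>i=1..<j. 1 / (1 - x i * x j)) *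
       (\<Prod>j=1..k. \<Prod>i=1..n. 1 / (1 - x i * y j)))"
    using Z(2) by simp
qed

lemma norm_schur_le:
  assumes \<nu>: "\<nu> \<in> partition_seqs" and x: "\<And>j. j \<in> {1..n} \<Longrightarrow> cmod (u j) \<le> x j"
  shows "cmod (schur n \<nu> u) \<le> cmod (schur n \<nu> (\<lambda>j. complex_of_real (x j)))"
proof -
  let ?D = "skew_diagram \<nu> (\<lambda>_. 0)"
  have T: "T c \<in> {1..n}" if "T \<in> ssyt n \<nu> (\<lambda>_. 0)" "c \<in> ?D" for T c
    using that unfolding ssyt_def by (blast dest: PiE_mem)
  have le: "(\<lambda>_. 0) \<le> \<nu>" by (simp add: le_fun_def)
  have "cmod (schur n \<nu> u) \<le> (\<Sum>T\<in>ssyt n \<nu> (\<lambda>_. 0). cmod (\<Prod>c\<in>?D. u (T c)))"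
    using le by (simp add: schur_def skew_schur_def norm_sum)
  also have "\<dots> \<le> (\<Sum>T\<in>ssyt n \<nu> (\<lambda>_. 0). \<Prod>c\<in>?D. x (T c))"
    unfolding prod_norm[symmetric] by (intro sum_mono prod_mono) (use x T in auto)
  also have "\<dots> \<le> cmod (complex_of_real (\<Sum>T\<in>ssyt n \<nu> (\<lambda>_. 0). \<Prod>c\<in>?D. x (T c)))"
    by (metis norm_of_real abs_ge_self)
  also have "\<dots> = cmod (schur n \<nu> (\<lambda>j. complex_of_real (x j)))"
    using le by (simp add: schur_def skew_schur_def)
  finally show ?thesis .
qed

text \<open>
  Each summand is a polynomial in \<open>q\<close>, bounded on the closed unit disc by its value at \<open>q = 1\<close>
  because all coefficients are non-negative. So the sum is holomorphic in the open disc, and it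
  coincides with the product on the interval from \<open>0\<close> to \<open>1\<close>, where the shifted variables are
  again non-negative reals.
\<close>

theorem pf_Z_qshift_product:
  fixes I :: "nat set"
  assumes x: "\<And>j. j \<in> {1..n} \<Longrightarrow> 0 \<le> x j" and y: "\<And>j. j \<in> {1..k} \<Longrightarrow> 0 \<le> y j"
    and conv: "pf_Z_abs_convergent n k (\<lambda>j. complex_of_real (y j)) (\<lambda>j. complex_of_real (x j))"
    and q: "cmod q < 1"
  defines "u \<equiv> \<lambda>q i. if i \<in> I then q * complex_of_real (x i) else complex_of_real (x i)"
  shows "pf_Z n k (\<lambda>j. complex_of_real (y j)) (u q) =
     (\<Prod>j=1..n. \<Prod>i=1..<j. 1 / (1 - u q i * u q j)) *
     (\<Prod>j=1..k. \<Prod>i=1..n. 1 / (1 - u q i * complex_of_real (y j)))"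
proof -
  let ?Y = "\<lambda>j. complex_of_real (y j)" and ?X = "\<lambda>j. complex_of_real (x j)"
  have ule: "cmod (u p i) \<le> x i" if "cmod p \<le> 1" "i \<in> {1..n}" for p i
    using x[OF that(2)] that(1) by (auto simp: u_def norm_mult mult_left_le_one_le)
  have bound: "norm (pf_tau k ?Y \<nu> * schur n \<nu> (u p)) \<le> norm (pf_tau k ?Y \<nu> * schur n \<nu> ?X)"
    if "\<nu> \<in> partition_seqs" "p \<in> cball 0 1" for \<nu> p
    unfolding norm_mult using norm_schur_le[OF that(1), of n "u p" x] ule[of p] that
    by (intro mult_left_mono) auto
  have unif: "uniform_limit (cball 0 1) (\<lambda>A p. \<Sum>\<nu>\<in>A. pf_tau k ?Y \<nu> * schur n \<nu> (u p))
      (\<lambda>p. \<Sum>\<^sub>\<infinity>\<nu>\<in>partition_seqs. pf_tau k ?Y \<nu> * schur n \<nu> (u p)) (finite_subsets_at_top partition_seqs)"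
    using bound conv unfolding pf_Z_abs_convergent_def by (rule Weierstrass_m_test_general)
  have hol_u: "(\<lambda>p. u p i) holomorphic_on UNIV" for i
    unfolding u_def by (cases "i \<in> I") (auto intro!: holomorphic_intros)
  have hol_schur: "(\<lambda>p. schur n \<nu> (u p)) holomorphic_on UNIV" for \<nu>
    unfolding schur_def skew_schur_def
    by (cases "(\<lambda>_. 0) \<le> \<nu>") (auto intro!: holomorphic_intros hol_u)
  have hol_sum: "(\<lambda>p. \<Sum>\<nu>\<in>A. pf_tau k ?Y \<nu> * schur n \<nu> (u p)) holomorphic_on UNIV" for A
    by (intro holomorphic_intros hol_schur)
  have "(\<lambda>p. \<Sum>\<^sub>\<infinity>\<nu>\<in>partition_seqs. pf_tau k ?Y \<nu> * schur n \<nu> (u p)) holomorphic_on ball 0 1"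
  proof (rule holomorphic_uniform_limit[OF _ unif])
    show "\<forall>\<^sub>F A in finite_subsets_at_top partition_seqs.
       continuous_on (cball 0 1) (\<lambda>p. \<Sum>\<nu>\<in>A. pf_tau k ?Y \<nu> * schur n \<nu> (u p)) \<and>
       (\<lambda>p. \<Sum>\<nu>\<in>A. pf_tau k ?Y \<nu> * schur n \<nu> (u p)) holomorphic_on ball 0 1"
    proof (intro always_eventually allI conjI)
      fix A
      show "(\<lambda>p. \<Sum>\<nu>\<in>A. pf_tau k ?Y \<nu> * schur n \<nu> (u p)) holomorphic_on ball 0 1"
        by (rule holomorphic_on_subset[OF hol_sum]) simp
      show "continuous_on (cball 0 1) (\<lambda>p. \<Sum>\<nu>\<in>A. pf_tau k ?Y \<nu> * schur n \<nu> (u p))"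
        by (rule holomorphic_on_imp_continuous_on, rule holomorphic_on_subset[OF hol_sum]) simp
    qed
  qed auto
  then have holL: "(\<lambda>p. pf_Z n k ?Y (u p)) holomorphic_on ball 0 1"
    by (simp add: pf_Z_def)
  have lt1: "x i * x j < 1" if "j \<in> {1..n}" "i \<in> {1..<j}" for i j
    using pf_Z_product_real(1)[OF x y conv] that by blast
  have lt2: "x i * y j < 1" if "j \<in> {1..k}" "i \<in> {1..n}" for i j
    using pf_Z_product_real(2)[OF x y conv] that by blast
  have ne1: "1 - u p i * u p j \<noteq> 0" if "cmod p < 1" "j \<in> {1..n}" "i \<in> {1..<j}" for p i j
  proof -
    have "cmod (u p i * u p j) \<le> x i * x j"
      unfolding norm_mult using that ule[of p] x by (intro mult_mono) auto
    also have "\<dots> < 1" using lt1 that by blast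
    finally show ?thesis by auto
  qed
  have ne2: "1 - u p i * ?Y j \<noteq> 0" if "cmod p < 1" "j \<in> {1..k}" "i \<in> {1..n}" for p i j
  proof -
    have "cmod (u p i * ?Y j) \<le> x i * y j"
      unfolding norm_mult using that ule[of p] x y by (intro mult_mono) auto
    also have "\<dots> < 1" using lt2 that by blast
    finally show ?thesis by auto
  qed
  define R where "R = (\<lambda>p. (\<Prod>j=1..n. \<Prod>i=1..<j. 1 / (1 - u p i * u p j)) *
     (\<Prod>j=1..k. \<Prod>i=1..n. 1 / (1 - u p i * ?Y j)))"
  have hol_u': "(\<lambda>p. u p i) holomorphic_on ball 0 1" for i
    by (rule holomorphic_on_subset[OF hol_u]) simp
  have holR: "R holomorphic_on ball 0 1"
    unfolding R_def by (intro holomorphic_intros hol_u') (use ne1 ne2 in auto)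
  have real: "pf_Z n k ?Y (u p) - R p = 0" if p: "p \<in> complex_of_real ` {0<..<1}" for p
  proof -
    obtain a where a: "p = complex_of_real a" "0 < a" "a < 1" using p by auto
    define v where "v = (\<lambda>i. if i \<in> I then a * x i else x i)"
    have uv: "u p = (\<lambda>i. complex_of_real (v i))" by (auto simp: u_def v_def a fun_eq_iff)
    have v0: "0 \<le> v j" if "j \<in> {1..n}" for j using x[OF that] a by (auto simp: v_def)
    have "pf_Z_abs_convergent n k ?Y (\<lambda>i. complex_of_real (v i))"
      unfolding pf_Z_abs_convergent_def
    proof (rule summable_on_comparison_test)
      show "(\<lambda>\<nu>. norm (pf_tau k ?Y \<nu> * schur n \<nu> ?X)) summable_on partition_seqs"
        using conv by (simp add: pf_Z_abs_convergent_def)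
      show "norm (pf_tau k ?Y \<nu> * schur n \<nu> (\<lambda>i. complex_of_real (v i)))
         \<le> norm (pf_tau k ?Y \<nu> * schur n \<nu> ?X)" if "\<nu> \<in> partition_seqs" for \<nu>
        unfolding uv[symmetric] by (rule bound[OF that]) (use a in simp)
    qed auto
    from pf_Z_product_real(3)[OF v0 y this] show ?thesis
      by (simp add: R_def uv)
  qed
  have "pf_Z n k ?Y (u q) - R q = 0"
  proof (rule analytic_continuation[where f = "\<lambda>p. pf_Z n k ?Y (u p) - R p" and w = q and S = "ball 0 1" and U = "complex_of_real ` {0<..<1}" and \<xi> = 0])
    show "(\<lambda>p. pf_Z n k ?Y (u p) - R p) holomorphic_on ball 0 1"
      by (intro holomorphic_intros holL holR)
    show "(0 :: complex) islimpt complex_of_real ` {0<..<1}"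
      unfolding islimpt_approachable
    proof (intro allI impI)
      fix e :: real assume e: "0 < e"
      define a where "a = min (e / 2) (1 / 2)"
      have "0 < a" "a < 1" "a < e" using e by (auto simp: a_def min_def)
      then show "\<exists>z'\<in>complex_of_real ` {0<..<1}. z' \<noteq> 0 \<and> dist z' 0 < e"
        by (intro bexI[of _ "complex_of_real a"]) auto
    qed
  qed (use q real in auto)
  then show ?thesis by (simp add: R_def)
qed

section \<open>Products over pairs of indices\<close>

text \<open>
  The order of the indices only selects one representative of each unordered pair; it is immaterial
  for symmetric \<open>f\<close>.
\<close>

definition pairs_prod :: "(nat \<Rightarrow> nat \<Rightarrow> 'a::comm_monoid_mult) \<Rightarrow> nat set \<Rightarrow> 'a" where
  "pairs_prod f A = (\<Prod>i\<in>A. \<Prod>j\<in>{j\<in>A. i < j}. f i j)"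

lemma pairs_prod_empty [simp]: "pairs_prod f {} = 1"
  by (simp add: pairs_prod_def)

lemma pairs_prod_cong:
  "(\<And>i j. i \<in> A \<Longrightarrow> j \<in> A \<Longrightarrow> i < j \<Longrightarrow> f i j = g i j) \<Longrightarrow> pairs_prod f A = pairs_prod g A"
  unfolding pairs_prod_def by (intro prod.cong refl) auto

lemma pairs_prod_mult: "pairs_prod (\<lambda>i j. f i j * g i j) A = pairs_prod f A * pairs_prod g A"
  by (simp add: pairs_prod_def prod.distrib)

lemma pairs_prod_insert:
  assumes fin: "finite A" and a: "a \<notin> A" and sym: "\<And>i. i \<in> A \<Longrightarrow> f a i = f i a"
  shows "pairs_prod f (insert a A) = pairs_prod f A * (\<Prod>i\<in>A. f i a)"
proof -
  have up: "(\<Prod>j\<in>{j\<in>insert a A. a < j}. f a j) = (\<Prod>j\<in>A. if a < j then f j a else 1)"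
  proof -
    have "{j\<in>insert a A. a < j} = {j\<in>A. a < j}" by auto
    then have "(\<Prod>j\<in>{j\<in>insert a A. a < j}. f a j) = (\<Prod>j\<in>{j\<in>A. a < j}. f j a)"
      by (simp only:) (intro prod.cong refl, auto intro: sym)
    then show ?thesis using fin by (simp only: prod.inter_filter)
  qed
  have row: "(\<Prod>j\<in>{j\<in>insert a A. i < j}. f i j)
      = (if i < a then f i a else 1) * (\<Prod>j\<in>{j\<in>A. i < j}. f i j)" if "i \<in> A" for i
  proof (cases "i < a")
    case True
    then have "{j\<in>insert a A. i < j} = insert a {j\<in>A. i < j}" by auto
    then show ?thesis using True fin a by simp
  next
    case False
    then have "{j\<in>insert a A. i < j} = {j\<in>A. i < j}" by auto
    then show ?thesis using False by simp
  qed
  have rows: "(\<Prod>i\<in>A. \<Prod>j\<in>{j\<in>insert a A. i < j}. f i j)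
      = (\<Prod>i\<in>A. (if i < a then f i a else 1) * (\<Prod>j\<in>{j\<in>A. i < j}. f i j))"
    by (rule prod.cong[OF refl row])
  have "pairs_prod f (insert a A) = (\<Prod>j\<in>A. if a < j then f j a else 1) *
      ((\<Prod>i\<in>A. if i < a then f i a else 1) * pairs_prod f A)"
    unfolding pairs_prod_def prod.insert[OF fin a] up rows prod.distrib ..
  also have "\<dots> = pairs_prod f A * (\<Prod>j\<in>A. (if a < j then f j a else 1) * (if j < a then f j a else 1))"
    by (simp add: prod.distrib mult_ac)
  also have "(\<Prod>j\<in>A. (if a < j then f j a else 1) * (if j < a then f j a else 1)) = (\<Prod>i\<in>A. f i a)"
    using a by (intro prod.cong refl) (auto dest: linorder_neqE_nat)
  finally show ?thesis .
qed

lemma pairs_prod_offdiag: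
  assumes "finite A"
  shows "(\<Prod>i\<in>A. \<Prod>j\<in>A - {i}. f i j) = pairs_prod (\<lambda>i j. f i j * f j i) A"
  using assms
proof (induction A rule: finite_induct)
  case (insert a A)
  have "(\<Prod>j\<in>insert a A - {i}. f i j) = f i a * (\<Prod>j\<in>A - {i}. f i j)" if "i \<in> A" for i
  proof -
    have "insert a A - {i} = insert a (A - {i})" using that insert by auto
    then show ?thesis using insert by simp
  qed
  moreover have "insert a A - {a} = A" using insert by auto
  ultimately have "(\<Prod>i\<in>insert a A. \<Prod>j\<in>insert a A - {i}. f i j)
      = (\<Prod>j\<in>A. f a j) * ((\<Prod>i\<in>A. f i a) * pairs_prod (\<lambda>i j. f i j * f j i) A)"
    using insert by (simp add: prod.distrib)
  also have "\<dots> = pairs_prod (\<lambda>i j. f i j * f j i) (insert a A)"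
    using insert by (subst pairs_prod_insert) (auto simp: prod.distrib mult_ac)
  finally show ?case .
qed simp

lemma pairs_prod_Un:
  assumes "finite A" "finite B" "A \<inter> B = {}" and sym: "\<And>i j. f i j = f j i"
  shows "pairs_prod f (A \<union> B) = pairs_prod f A * pairs_prod f B * (\<Prod>i\<in>A. \<Prod>j\<in>B. f i j)"
  using assms(2,3)
proof (induction B rule: finite_induct)
  case (insert b B)
  have "pairs_prod f (A \<union> insert b B) = pairs_prod f (A \<union> B) * (\<Prod>i\<in>A \<union> B. f i b)"
    using insert assms(1) by (subst pairs_prod_insert[symmetric]) (auto intro: sym)
  also have "(\<Prod>i\<in>A \<union> B. f i b) = (\<Prod>i\<in>A. f i b) * (\<Prod>i\<in>B. f i b)"
    using insert assms(1) by (intro prod.union_disjoint) auto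
  also have "pairs_prod f (insert b B) = pairs_prod f B * (\<Prod>i\<in>B. f i b)"
    using insert by (intro pairs_prod_insert) (auto intro: sym)
  ultimately show ?case using insert
    by (simp add: pairs_prod_insert sym prod.distrib mult_ac)
qed simp

lemma lower_pairs_prod:
  fixes f :: "nat \<Rightarrow> nat \<Rightarrow> 'a::comm_monoid_mult"
  assumes "\<And>i j. f i j = f j i"
  shows "(\<Prod>j=1..n. \<Prod>i=1..<j. f i j) = pairs_prod f {1..n}"
proof (induction n)
  case (Suc n)
  have "{1..Suc n} = insert (Suc n) {1..n}" by auto
  then have "pairs_prod f {1..Suc n} = pairs_prod f {1..n} * (\<Prod>i=1..n. f i (Suc n))"
    using assms by (simp add: pairs_prod_insert)
  with Suc show ?case by (simp add: atLeastLessThanSuc_atLeastAtMost)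
qed simp

lemma sum_insert_subsets:
  fixes t :: "'b set \<Rightarrow> 'a::comm_semiring_1"
  assumes "finite S"
  shows "(\<Sum>j\<in>S. \<Sum>I | I \<subseteq> S - {j} \<and> card I = m. t (insert j I))
       = of_nat (Suc m) * (\<Sum>I | I \<subseteq> S \<and> card I = Suc m. t I)"
proof -
  have fin: "finite {I. I \<subseteq> S \<and> card I = m'}" "finite {I. I \<subseteq> S - A \<and> card I = m'}" for A m'
    using assms by (auto intro: finite_subset[of _ "Pow S"])
  have finI: "finite I" if "I \<subseteq> S" for I using that assms finite_subset by blast
  have card: "card (insert a I) = Suc (card I)" if "I \<subseteq> S - {a}" for a I
    using that finI[of I] by (subst card_insert_disjoint) auto
  have "(\<Sum>j\<in>S. \<Sum>I | I \<subseteq> S - {j} \<and> card I = m. t (insert j I))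
      = (\<Sum>(j, I)\<in>Sigma S (\<lambda>j. {I. I \<subseteq> S - {j} \<and> card I = m}). t (insert j I))"
    using assms fin by (intro sum.Sigma) auto
  also have "\<dots> = (\<Sum>(I, j)\<in>Sigma {I. I \<subseteq> S \<and> card I = Suc m} (\<lambda>I. I). t I)"
    by (rule sum.reindex_bij_witness[where i = "\<lambda>(I, j). (j, I - {j})" and j = "\<lambda>(j, I). (insert j I, j)"])
      (auto simp: insert_absorb card finI)
  also have "\<dots> = (\<Sum>I | I \<subseteq> S \<and> card I = Suc m. \<Sum>j\<in>I. t I)"
    using fin finI by (intro sum.Sigma[symmetric]) auto
  also have "\<dots> = (\<Sum>I | I \<subseteq> S \<and> card I = Suc m. of_nat (Suc m) * t I)"
    by (intro sum.cong) auto
  finally show ?thesis by (simp add: sum_distrib_left)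
qed

section \<open>The factors of the integrand\<close>

definition one_var ::
  "complex \<Rightarrow> nat \<Rightarrow> nat \<Rightarrow> (nat \<Rightarrow> complex) \<Rightarrow> (nat \<Rightarrow> complex) \<Rightarrow> complex \<Rightarrow> complex" where
  "one_var q n k x y z = (1 - q * z\<^sup>2) / (1 - z\<^sup>2) *
     (\<Prod>j=1..n. ((q * z - x j) * (1 - z * x j)) / ((z - x j) * (1 - q * z * x j))) *
     (\<Prod>j=1..k. (1 - z * y j) / (1 - q * z * y j)) * (1 / z)"

definition pair_factor :: "complex \<Rightarrow> complex \<Rightarrow> complex \<Rightarrow> complex" where
  "pair_factor q u z =
     ((u - z) * (1 - q * u * z) * ((z - u) * (1 - q * z * u))) /
     ((q * u - z) * (q * z - u) * ((1 - q\<^sup>2 * u * z) * (1 - u * z)))"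

lemma pair_factor_sym: "pair_factor q u z = pair_factor q z u"
  by (simp add: pair_factor_def mult_ac)

lemma pair_factor_self [simp]: "pair_factor q z z = 0"
  by (simp add: pair_factor_def)

text \<open>
  The product over ordered pairs \<open>i \<noteq> j\<close> is grouped into unordered pairs, which makes the interaction
  of two variables symmetric.
\<close>

lemma D_integrand_factor:
  "D_integrand q r n k x y z =
     (\<Prod>l=1..r. one_var q n k x y (z l)) * pairs_prod (\<lambda>i j. pair_factor q (z i) (z j)) {1..r}"
proof -
  have e1: "(\<Prod>i=1..r. \<Prod>j\<in>{1..r} - {i}. (z i - z j) * (1 - q * z i * z j) / (q * z i - z j))
      = pairs_prod (\<lambda>i j. (z i - z j) * (1 - q * z i * z j) / (q * z i - z j) *
          ((z j - z i) * (1 - q * z j * z i) / (q * z j - z i))) {1..r}"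
    by (rule pairs_prod_offdiag) simp
  have e2: "(\<Prod>i=1..r. \<Prod>j\<in>{i<..r}. 1 / ((1 - q\<^sup>2 * z i * z j) * (1 - z i * z j)))
      = pairs_prod (\<lambda>i j. 1 / ((1 - q\<^sup>2 * z i * z j) * (1 - z i * z j))) {1..r}"
    unfolding pairs_prod_def
    by (intro prod.cong refl) auto
  have e3: "pairs_prod (\<lambda>i j. pair_factor q (z i) (z j)) {1..r} =
      pairs_prod (\<lambda>i j. (z i - z j) * (1 - q * z i * z j) / (q * z i - z j) *
          ((z j - z i) * (1 - q * z j * z i) / (q * z j - z i))) {1..r} *
      pairs_prod (\<lambda>i j. 1 / ((1 - q\<^sup>2 * z i * z j) * (1 - z i * z j))) {1..r}"
    unfolding pairs_prod_mult[symmetric] by (simp add: pair_factor_def mult_ac)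
  show ?thesis
    unfolding D_integrand_def one_var_def e1 e2 e3 prod.distrib by (simp only: mult_ac)
qed

lemma D_integrand_cong:
  "(\<And>i. i \<in> {1..r} \<Longrightarrow> z i = z' i) \<Longrightarrow> D_integrand q r n k x y z = D_integrand q r n k x y z'"
  unfolding D_integrand_factor
  by (intro arg_cong2[where f = "(*)"] prod.cong pairs_prod_cong refl) auto

lemma D_integrand_Suc:
  "D_integrand q (Suc r) n k x y z = D_integrand q r n k x y z *
     (one_var q n k x y (z (Suc r)) * (\<Prod>l=1..r. pair_factor q (z l) (z (Suc r))))"
proof -
  have "{1..Suc r} = insert (Suc r) {1..r}" by auto
  then show ?thesis
    unfolding D_integrand_factor
    by (simp add: pairs_prod_insert[of _ "Suc r"] pair_factor_sym[of q "z (Suc r)"] mult_ac)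
qed

text \<open>
  Division by zero yields zero, so a non-zero value shows that no denominator vanishes, and then the
  function is analytic at that point.
\<close>

lemma one_var_nonzero:
  assumes "one_var q n k x y z \<noteq> 0"
  shows "z \<noteq> 0" "1 - z\<^sup>2 \<noteq> 0" "\<And>j. j \<in> {1..n} \<Longrightarrow> z \<noteq> x j"
    "\<And>j. j \<in> {1..n} \<Longrightarrow> 1 - q * z * x j \<noteq> 0" "\<And>j. j \<in> {1..k} \<Longrightarrow> 1 - q * z * y j \<noteq> 0"
  using assms by (auto simp: one_var_def)

lemma one_var_analytic:
  assumes "one_var q n k x y z \<noteq> 0"
  shows "one_var q n k x y analytic_on {z}"
  unfolding one_var_def[abs_def] using one_var_nonzero[OF assms]
  by (intro analytic_intros) auto

text \<open>
  The zeros of the denominator of \<open>pair_factor q w\<close>. The relation between a point and its partners is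
  symmetric on non-zero points, as \<open>pair_factor\<close> is.
\<close>

definition partners :: "complex \<Rightarrow> complex \<Rightarrow> complex set" where
  "partners q w = {q * w, w / q, 1 / (q\<^sup>2 * w), 1 / w}"

lemma pair_denominator_zero:
  assumes "q \<noteq> 0" "u \<noteq> 0"
  shows "(q * u - z) * (q * z - u) * ((1 - q\<^sup>2 * u * z) * (1 - u * z)) = 0 \<longleftrightarrow> z \<in> partners q u"
proof -
  have "q * u - z = 0 \<longleftrightarrow> z = q * u" "q * z - u = 0 \<longleftrightarrow> z = u / q"
    "1 - q\<^sup>2 * u * z = 0 \<longleftrightarrow> z = 1 / (q\<^sup>2 * u)" "1 - u * z = 0 \<longleftrightarrow> z = 1 / u"
    using assms by (auto simp: field_simps)
  then show ?thesis unfolding mult_eq_0_iff partners_def by blast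
qed

lemma pair_factor_analytic:
  assumes "q \<noteq> 0" "u \<noteq> 0" "\<And>z. z \<in> S \<Longrightarrow> z \<notin> partners q u"
  shows "pair_factor q u analytic_on S"
  unfolding pair_factor_def[abs_def] using assms(3) pair_denominator_zero[OF assms(1,2)]
  by (intro analytic_intros) blast

lemma pair_factor_analytic_nonzero:
  assumes "pair_factor q u z \<noteq> 0"
  shows "pair_factor q u analytic_on {z}"
  unfolding pair_factor_def[abs_def] using assms
  by (intro analytic_intros) (auto simp: pair_factor_def)

lemma finite_linear_roots: "a \<noteq> 0 \<or> b \<noteq> 0 \<Longrightarrow> finite {z :: complex. a * z = b}"
proof (cases "a = 0")
  case False
  then have "{z. a * z = b} \<subseteq> {b / a}" by (auto simp: field_simps)
  then show ?thesis by (rule finite_subset) simp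
qed auto

lemma finite_square_roots: "finite {z :: complex. a * z\<^sup>2 = 1}"
proof (cases "a = 0")
  case False
  then have "{z. a * z\<^sup>2 = 1} \<subseteq> {z. z ^ 2 = 1 / a}" by (auto simp: field_simps)
  then show ?thesis by (rule finite_subset) (simp add: finite_nth_roots)
qed auto

lemma finite_one_var_zeros:
  assumes "q \<noteq> 0"
  shows "finite {z. one_var q n k x y z = 0}"
proof -
  have "{z. one_var q n k x y z = 0} \<subseteq> {0} \<union> {z. q * z\<^sup>2 = 1} \<union> {z. 1 * z\<^sup>2 = 1} \<union>
     (\<Union>j\<in>{1..n}. {x j / q} \<union> {z. x j * z = 1} \<union> {x j} \<union> {z. (q * x j) * z = 1}) \<union>
     (\<Union>j\<in>{1..k}. {z. y j * z = 1} \<union> {z. (q * y j) * z = 1})"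
  proof
    fix z assume "z \<in> {z. one_var q n k x y z = 0}"
    then have "z = 0 \<or> q * z\<^sup>2 = 1 \<or> z\<^sup>2 = 1 \<or>
        (\<exists>j\<in>{1..n}. q * z = x j \<or> z * x j = 1 \<or> z = x j \<or> q * z * x j = 1) \<or>
        (\<exists>j\<in>{1..k}. z * y j = 1 \<or> q * z * y j = 1)"
      unfolding one_var_def mem_Collect_eq divide_eq_0_iff mult_eq_0_iff right_minus_eq
        prod_zero_iff[OF finite_atLeastAtMost] by (elim disjE) (auto simp: eq_commute[of 1])
    moreover have "z = a / q" if "q * z = a" for a using that assms by auto
    ultimately show "z \<in> {0} \<union> {z. q * z\<^sup>2 = 1} \<union> {z. 1 * z\<^sup>2 = 1} \<union>
     (\<Union>j\<in>{1..n}. {x j / q} \<union> {z. x j * z = 1} \<union> {x j} \<union> {z. (q * x j) * z = 1}) \<union>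
     (\<Union>j\<in>{1..k}. {z. y j * z = 1} \<union> {z. (q * y j) * z = 1})"
      by (elim disjE bexE) (auto simp: mult_ac)
  qed
  then show ?thesis
    by (rule finite_subset) (auto simp del: mult_1 intro!: finite_square_roots finite_linear_roots)
qed

lemma finite_pair_factor_zeros:
  assumes "q \<noteq> 0"
  shows "finite {v. pair_factor q v s = 0}"
proof -
  have "{v. pair_factor q v s = 0} \<subseteq> {s, s / q, q * s} \<union> {v. (q * s) * v = 1} \<union>
     {v. (q\<^sup>2 * s) * v = 1} \<union> {v. s * v = 1}"
  proof
    fix v assume "v \<in> {v. pair_factor q v s = 0}"
    then have "v = s \<or> q * v * s = 1 \<or> q * v = s \<or> q * s = v \<or> q\<^sup>2 * v * s = 1 \<or> v * s = 1"
      unfolding pair_factor_def mem_Collect_eq divide_eq_0_iff mult_eq_0_iff right_minus_eq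
      by (auto simp: mult_ac)
    then show "v \<in> {s, s / q, q * s} \<union> {v. (q * s) * v = 1} \<union>
     {v. (q\<^sup>2 * s) * v = 1} \<union> {v. s * v = 1}"
      using assms by (auto simp: mult_ac)
  qed
  then show ?thesis
    by (rule finite_subset) (auto intro!: finite_linear_roots)
qed

text \<open>
  At a partner \<open>p\<close> of \<open>w\<close> the numerator vanishes only if \<open>p = w\<close> or \<open>q w p = 1\<close>; the value of
  \<open>q w p\<close> is \<open>(q w)\<^sup>2\<close>, \<open>w\<^sup>2\<close>, \<open>1 / q\<close> or \<open>q\<close>.
\<close>

lemma pair_factor_pole:
  assumes q: "q \<noteq> 0" "q \<noteq> 1" and w: "w \<noteq> 0" "w\<^sup>2 \<noteq> 1" "(q * w)\<^sup>2 \<noteq> 1"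
    and p: "p \<in> partners q w"
  shows "is_pole (pair_factor q w) p"
proof -
  have ev: "eventually (\<lambda>z. z \<in> - (partners q w - {p}) - {p}) (at p)"
    by (intro eventually_at_in_open open_Compl finite_imp_closed) (auto simp: partners_def)
  have "q * w * p \<in> {(q * w)\<^sup>2, w\<^sup>2, 1 / q, q}"
    using p q w by (auto simp: partners_def power2_eq_square)
  then have "q * w * p \<noteq> 1"
    using q w by (metis insertE divide_eq_1_iff singletonD)
  moreover have "w \<noteq> p"
    using p q w by (auto simp: partners_def field_simps power2_eq_square)
  ultimately have "(w - p) * (1 - q * w * p) * ((p - w) * (1 - q * p * w)) \<noteq> 0"
    by (simp add: mult_ac)
  moreover have "filterlim (\<lambda>z. (q * w - z) * (q * z - w) * ((1 - q\<^sup>2 * w * z) * (1 - w * z)))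
      (at 0) (at p)"
    unfolding filterlim_at
  proof
    show "\<forall>\<^sub>F z in at p. (q * w - z) * (q * z - w) * ((1 - q\<^sup>2 * w * z) * (1 - w * z)) \<in> UNIV \<and>
        (q * w - z) * (q * z - w) * ((1 - q\<^sup>2 * w * z) * (1 - w * z)) \<noteq> 0"
      using ev by eventually_elim (use pair_denominator_zero[OF q(1) w(1)] in auto)
    have "((\<lambda>z. (q * w - z) * (q * z - w) * ((1 - q\<^sup>2 * w * z) * (1 - w * z))) \<longlongrightarrow>
       (q * w - p) * (q * p - w) * ((1 - q\<^sup>2 * w * p) * (1 - w * p))) (at p)"
      by (intro tendsto_intros)
    then show "((\<lambda>z. (q * w - z) * (q * z - w) * ((1 - q\<^sup>2 * w * z) * (1 - w * z))) \<longlongrightarrow> 0) (at p)"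
      unfolding pair_denominator_zero[OF q(1) w(1), of p, THEN iffD2, OF p] .
  qed
  ultimately show ?thesis
    unfolding pair_factor_def[abs_def] by (intro is_pole_divide continuous_intros) auto
qed

lemma partners_maps:
  assumes "q \<noteq> 0" "p \<in> partners q a"
  shows "\<exists>b b'. p = b a \<and> (\<forall>z. z \<noteq> 0 \<longrightarrow> isCont b z \<and> isCont b' z \<and> b' (b z) = z \<and>
           b z \<in> partners q z \<and> b' z \<in> partners q z)"
proof -
  consider "p = q * a" | "p = a / q" | "p = 1 / (q\<^sup>2 * a)" | "p = 1 / a"
    using assms(2) by (auto simp: partners_def)
  then show ?thesis
  proof cases
    case 1
    then show ?thesis using assms(1)
      by (intro exI[of _ "\<lambda>z. q * z"] exI[of _ "\<lambda>z. z / q"]) (auto simp: partners_def intro!: continuous_intros)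
  next
    case 2
    then show ?thesis using assms(1)
      by (intro exI[of _ "\<lambda>z. q * z"] exI[of _ "\<lambda>z. z / q"]) (auto simp: partners_def intro!: continuous_intros)
  next
    case 3
    then show ?thesis using assms(1)
      by (intro exI[of _ "\<lambda>z. 1 / (q\<^sup>2 * z)"]) (auto simp: partners_def intro!: continuous_intros)
  next
    case 4
    then show ?thesis using assms(1)
      by (intro exI[of _ "\<lambda>z. 1 / z"]) (auto simp: partners_def intro!: continuous_intros)
  qed
qed

lemma finite_partner_preimage:
  assumes "q \<noteq> 0" "finite Z"
  shows "finite {w. \<exists>p\<in>partners q w. p \<in> Z}"
proof -
  have "{w. \<exists>p\<in>partners q w. p \<in> Z} \<subseteq> {0} \<union> (\<Union>p\<in>Z. partners q p)"
    using assms(1) by (fastforce simp: partners_def)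
  then show ?thesis
    by (rule finite_subset) (use assms(2) in \<open>auto simp: partners_def\<close>)
qed

section \<open>Jordan curves and simple poles\<close>

abbreviation closed_inside :: "complex set \<Rightarrow> complex set" where
  "closed_inside c \<equiv> c \<union> inside c"

lemma jordan_closure:
  assumes "simple_path g" "pathfinish g = pathstart g"
  shows "closure (inside (path_image g)) = closed_inside (path_image g)"
  using Jordan_inside_outside[OF assms] by (metis closure_Un_frontier sup_commute)

text \<open>
  A curve has no isolated points. This allows statements that hold on a curve with finitely many
  exceptions to be transported to neighbouring points.
\<close>

lemma simple_path_image_perfect:
  fixes g :: "real \<Rightarrow> complex"
  assumes "simple_path g" "w \<in> path_image g" "open U" "w \<in> U" "finite B"
  shows "\<exists>w'\<in>path_image g \<inter> U. w' \<notin> B"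
proof -
  have lf: "\<forall>a\<in>{0..1}. \<forall>b\<in>{0..1}. g a = g b \<longrightarrow> a = b \<or> a = 0 \<and> b = 1 \<or> a = 1 \<and> b = 0"
    using assms(1) unfolding simple_path_def loop_free_def by blast
  have "g 0 \<noteq> g (1/2)"
    using lf[THEN bspec, of 0, THEN bspec, of "1/2"] by auto
  moreover have "g 0 \<in> path_image g" "g (1/2) \<in> path_image g" by (auto simp: path_image_def)
  ultimately have "\<And>a. path_image g \<noteq> {a}" by (metis singletonD)
  then have "w islimpt path_image g"
    using assms by (intro connected_imp_perfect connected_simple_path_image) auto
  then have "infinite (path_image g \<inter> U)"
    using assms(3,4) by (metis islimpt_eq_acc_point Int_commute)
  then show ?thesis using assms(5) by (meson finite_subset subsetI)
qed

lemma simple_path_image_infinite: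
  fixes g :: "real \<Rightarrow> complex"
  assumes "simple_path g" shows "infinite (path_image g)"
  using simple_path_image_perfect[OF assms pathstart_in_path_image open_UNIV] by auto

text \<open>
  Suppose that \<open>b\<close> maps the curve \<open>g\<close>, and its inverse \<open>b'\<close> the curve \<open>h\<close>, off the closed
  region bounded by the other curve, with finitely many exceptions. Then \<open>b\<close> maps the whole open
  region inside \<open>g\<close> off the region bounded by \<open>h\<close>. For an exceptional point of \<open>h\<close> cannot
  be the image of an interior point of \<open>g\<close>, as its unexceptional neighbours on \<open>h\<close> would be such
  images too; so the image of the inside of \<open>g\<close> is connected and avoids \<open>h\<close>. If it met the
  inside of \<open>h\<close>, it would lie in it, and by continuity the image of \<open>g\<close> itself would be
  enclosed by \<open>h\<close>.
\<close>

lemma jordan_avoid: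
  fixes b b' :: "complex \<Rightarrow> complex"
  assumes g: "simple_path g" "pathfinish g = pathstart g"
    and h: "simple_path h" "pathfinish h = pathstart h"
    and fin: "finite B"
    and cb: "continuous_on (closed_inside (path_image g)) b"
    and cb': "\<And>w. w \<in> path_image h \<Longrightarrow> isCont b' w"
    and inv: "\<And>z. z \<in> closed_inside (path_image g) \<Longrightarrow> b' (b z) = z"
    and off: "\<And>z. z \<in> path_image g - B \<Longrightarrow> b z \<notin> closed_inside (path_image h)"
    and off': "\<And>w. w \<in> path_image h - B \<Longrightarrow> b' w \<notin> closed_inside (path_image g)"
    and p: "p \<in> inside (path_image g)"
  shows "b p \<notin> closed_inside (path_image h)"
proof
  assume bp: "b p \<in> closed_inside (path_image h)"
  let ?D = "inside (path_image g)"
  note Jg = Jordan_inside_outside[OF g] and Jh = Jordan_inside_outside[OF h]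
  have disj: "b z \<notin> path_image h" if z: "z \<in> ?D" for z
  proof
    assume bz: "b z \<in> path_image h"
    have "b' (b z) \<in> ?D" using inv z by simp
    then have "\<forall>\<^sub>F w in at (b z). b' w \<in> ?D"
      using cb'[OF bz] Jg unfolding isCont_def by (intro topological_tendstoD) auto
    then obtain U where U: "open U" "b z \<in> U" "\<And>w. w \<in> U \<Longrightarrow> w \<noteq> b z \<Longrightarrow> b' w \<in> ?D"
      unfolding eventually_at_topological by blast
    obtain w where "w \<in> path_image h \<inter> U" "w \<notin> insert (b z) B"
      using simple_path_image_perfect[OF h(1) bz U(1,2), of "insert (b z) B"] fin by blast
    with U(3)[of w] off'[of w] show False by blast
  qed
  have "connected (b ` ?D)"
    by (intro connected_continuous_image continuous_on_subset[OF cb]) (use Jg in auto)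
  moreover have cover: "b ` ?D \<subseteq> inside (path_image h) \<union> outside (path_image h)"
    using disj Jh by blast
  moreover have "inside (path_image h) \<inter> b ` ?D \<noteq> {}"
    using bp disj[OF p] p by blast
  ultimately have "outside (path_image h) \<inter> b ` ?D = {}"
    using Jh connectedD[of "b ` ?D" "inside (path_image h)" "outside (path_image h)"] by blast
  then have "b ` ?D \<subseteq> inside (path_image h)" using cover by blast
  then have "b ` ?D \<subseteq> closure (inside (path_image h))"
    using closure_subset by (rule subset_trans)
  then have sub: "b ` closed_inside (path_image g) \<subseteq> closed_inside (path_image h)"
    using image_closure_subset[of ?D b "closure (inside (path_image h))"] cb
    unfolding jordan_closure[OF g] jordan_closure[OF h]
    by (metis closed_closure jordan_closure[OF h])
  have "\<not> path_image g \<subseteq> B"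
    using simple_path_image_infinite[OF g(1)] fin finite_subset by blast
  then obtain z where z: "z \<in> path_image g" "z \<notin> B" by blast
  then have "b z \<in> closed_inside (path_image h)" using sub by blast
  with off[of z] z show False by blast
qed

text \<open>
  A simple curve passes at most twice through any given point. Hence the values of the integrand
  at removable singularities on the curve do not influence the integral.
\<close>

lemma has_contour_integral_finite_change:
  fixes f f' :: "complex \<Rightarrow> complex"
  assumes g: "simple_path g" and f: "(f has_contour_integral I) g" and B: "finite B"
    and eq: "\<And>z. z \<in> path_image g - B \<Longrightarrow> f' z = f z"
  shows "(f' has_contour_integral I) g"
proof -
  have lf: "\<forall>s\<in>{0..1}. \<forall>t\<in>{0..1}. g s = g t \<longrightarrow> s = t \<or> s = 0 \<and> t = 1 \<or> s = 1 \<and> t = 0"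
    using g unfolding simple_path_def loop_free_def by blast
  \<comment> \<open>The end points are the only parameters that can share a point of the curve.\<close>
  have sub: "{t \<in> {0..1}. g t = b} \<subseteq> {0, 1, SOME t. 0 < t \<and> t < 1 \<and> g t = b}" for b
  proof
    fix t assume t: "t \<in> {t \<in> {0..1}. g t = b}"
    show "t \<in> {0, 1, SOME t. 0 < t \<and> t < 1 \<and> g t = b}"
    proof (cases "t = 0 \<or> t = 1")
      case False
      let ?s = "SOME t. 0 < t \<and> t < 1 \<and> g t = b"
      have "0 < t \<and> t < 1 \<and> g t = b" using False t by auto
      then have s: "0 < ?s \<and> ?s < 1 \<and> g ?s = b" by (rule someI)
      have "t = ?s" using lf[THEN bspec, of t, THEN bspec, of ?s] False t s by auto
      then show ?thesis by blast
    qed auto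
  qed
  have fin: "finite (\<Union>b\<in>B. {t \<in> {0..1}. g t = b})"
    using B finite_subset[OF sub] by blast
  show ?thesis
    using f unfolding has_contour_integral
    by (rule has_integral_spike_finite[OF fin, rotated]) (use eq in \<open>auto simp: path_image_def\<close>)
qed

lemma has_contour_integral_simple_pole:
  assumes vp: "valid_path g" and g: "simple_path g" "pathfinish g = pathstart g"
    and a: "a \<in> inside (path_image g)" "winding_number g a = 1"
    and f: "f analytic_on closed_inside (path_image g)"
  shows "((\<lambda>z. f z / (z - a)) has_contour_integral (2 * pi * \<i> * f a)) g"
proof -
  obtain S where S: "open S" "closed_inside (path_image g) \<subseteq> S" "f holomorphic_on S"
    using f unfolding analytic_on_holomorphic by blast
  have "((\<lambda>w. f w / (w - a)) has_contour_integral (2 * pi * \<i> * winding_number g a * f a)) g"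
  proof (rule Cauchy_integral_formula_global[OF S(1,3) _ vp _ g(2)])
    show "a \<in> S" using a S by blast
    show "path_image g \<subseteq> S - {a}" using a S inside_no_overlap[of "path_image g"] by blast
    fix w assume "w \<notin> S"
    then have "w \<in> outside (path_image g)"
      using S Jordan_inside_outside[OF g] by blast
    then show "winding_number g w = 0"
      using winding_number_zero_in_outside[OF valid_path_imp_path[OF vp] g(2)] by blast
  qed
  then show ?thesis by (simp add: a)
qed

section \<open>Where the poles lie relative to the contours\<close>

text \<open>
  The bounds on \<open>x\<close> and \<open>y\<close> keep the denominators of the product formula and of the residues away
  from zero, for all \<open>q\<close> in the unit disc. A single integral also makes sense for \<open>q = 0\<close>.
\<close>

locale admissible_setup =
  fixes q :: complex and r n k :: nat and x y :: "nat \<Rightarrow> real" and \<gamma> :: "nat \<Rightarrow> real \<Rightarrow> complex"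
  assumes q: "cmod q < 1" and r: "1 \<le> r" and q0: "2 \<le> r \<Longrightarrow> q \<noteq> 0"
    and n: "1 \<le> n"
    and x_pos: "\<And>j. j \<in> {1..n} \<Longrightarrow> 0 < x j" and x_less: "\<And>j. j \<in> {1..n} \<Longrightarrow> x j < 1"
    and x_inj: "inj_on x {1..n}"
    and y_nonneg: "\<And>j. j \<in> {1..k} \<Longrightarrow> 0 \<le> y j"
    and xy_less: "\<And>i j. i \<in> {1..n} \<Longrightarrow> j \<in> {1..k} \<Longrightarrow> x i * y j < 1"
    and adm: "admissible_contours q r n k (\<lambda>j. complex_of_real (x j)) (\<lambda>j. complex_of_real (y j)) \<gamma>"
begin

abbreviation "X \<equiv> \<lambda>j. complex_of_real (x j)"
abbreviation "Y \<equiv> \<lambda>j. complex_of_real (y j)"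
abbreviation "F \<equiv> one_var q n k X Y"
abbreviation "P \<equiv> pair_factor q"
abbreviation "K \<equiv> \<lambda>i. closed_inside (path_image (\<gamma> i))"
abbreviation "C \<equiv> \<Union>j\<in>{1..n}. path_image (\<gamma> j)"

lemma contour:
  assumes "i \<in> {1..n}"
  shows "valid_path (\<gamma> i)" "simple_path (\<gamma> i)" "pathfinish (\<gamma> i) = pathstart (\<gamma> i)"
    "X i \<in> inside (path_image (\<gamma> i))" "winding_number (\<gamma> i) (X i) = 1"
  using adm assms unfolding admissible_contours_def by blast+

lemma no_pole_contour:
  assumes "i \<in> {1..n}" "l \<in> {1..r}" "\<And>m. m \<in> {1..r} - {l} \<Longrightarrow> z m \<in> C" "p \<in> K i"
    "is_pole (\<lambda>w. D_integrand q r n k X Y (z(l := w))) p"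
  shows "p = X i"
  using adm assms unfolding admissible_contours_def by blast

lemma infinite_C: "infinite C"
proof -
  have "path_image (\<gamma> 1) \<subseteq> C" using n by auto
  then show ?thesis
    using simple_path_image_infinite[OF contour(2)[of 1]] n by (auto dest: finite_subset)
qed

lemma denominators_nonzero: "i \<in> {1..n} \<Longrightarrow> j \<in> {1..n} \<Longrightarrow> 1 - q * X i * X j \<noteq> 0"
  "i \<in> {1..n} \<Longrightarrow> j \<in> {1..k} \<Longrightarrow> 1 - q * X i * Y j \<noteq> 0"
  "i \<in> {1..n} \<Longrightarrow> 1 - (X i)\<^sup>2 \<noteq> 0"
proof -
  show "1 - q * X i * X j \<noteq> 0" if "i \<in> {1..n}" "j \<in> {1..n}"
  proof -
    have "x i * x j < 1" using x_pos[OF that(1)] x_less[OF that(1)] x_pos[OF that(2)] x_less[OF that(2)]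
      by (metis less_eq_real_def mult_left_le_one_le order_le_less_trans)
    then have "cmod q * (x i * x j) < 1"
      using q x_pos that by (metis less_eq_real_def mult_left_le_one_le mult_nonneg_nonneg norm_ge_zero order_le_less_trans)
    then have "cmod (q * X i * X j) < 1"
      using x_pos[OF that(1)] x_pos[OF that(2)] by (simp add: norm_mult mult.assoc)
    then show ?thesis by auto
  qed
  show "1 - q * X i * Y j \<noteq> 0" if "i \<in> {1..n}" "j \<in> {1..k}"
  proof -
    have "cmod q * (x i * y j) < 1"
      using q x_pos[OF that(1)] y_nonneg[OF that(2)] xy_less[OF that]
      by (metis less_eq_real_def mult_left_le_one_le mult_nonneg_nonneg norm_ge_zero order_le_less_trans)
    then have "cmod (q * X i * Y j) < 1"
      using x_pos[OF that(1)] y_nonneg[OF that(2)] by (simp add: norm_mult mult.assoc)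
    then show ?thesis by auto
  qed
  show "1 - (X i)\<^sup>2 \<noteq> 0" if "i \<in> {1..n}"
  proof -
    have "(x i)\<^sup>2 < 1" using x_pos[OF that] x_less[OF that] by (simp add: power_less_one_iff)
    then have "1 - (x i)\<^sup>2 \<noteq> 0" by simp
    then have "complex_of_real (1 - (x i)\<^sup>2) \<noteq> 0" unfolding of_real_eq_0_iff .
    then show ?thesis by simp
  qed
qed

text \<open>
  The hypothesis on the contours concerns the integrand in all \<open>r\<close> variables, whereas poles of the
  factors that involve only some of them are to be excluded. The missing variables are placed on the
  contour one after the other at points where none of the factors that they bring in vanishes or blows
  up, so that a pole of the smaller product remains a pole of the integrand.
\<close>

lemma pole_extend:
  assumes j: "j \<in> {1..n}" and p: "p \<in> K j"
    and "m < r" "\<And>l. l \<in> {1..m} \<Longrightarrow> z l \<in> C" "D_integrand q m n k X Y z \<noteq> 0"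
    and "is_pole (\<lambda>w. F w * (\<Prod>l=1..m. P (z l) w)) p"
  shows "p = X j"
  using assms(3-)
proof (induction "r - m" arbitrary: m z rule: less_induct)
  case less
  show ?case
  proof (cases "r = Suc m")
    case True
    have "(\<lambda>w. D_integrand q r n k X Y (z(r := w)))
        = (\<lambda>w. D_integrand q m n k X Y z * (F w * (\<Prod>l=1..m. P (z l) w)))"
    proof
      fix w
      have "D_integrand q m n k X Y (z(r := w)) = D_integrand q m n k X Y z"
        by (rule D_integrand_cong) (use True in auto)
      then show "D_integrand q r n k X Y (z(r := w))
        = D_integrand q m n k X Y z * (F w * (\<Prod>l=1..m. P (z l) w))"
        unfolding True D_integrand_Suc by simp
    qed
    then have "is_pole (\<lambda>w. D_integrand q r n k X Y (z(r := w))) p"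
      using less.prems(3,4) by simp
    moreover have "z l \<in> C" if "l \<in> {1..r} - {r}" for l
      using that True by (intro less.prems(2)) auto
    ultimately show ?thesis
      using no_pole_contour[OF j, of r z p] r p by auto
  next
    case False
    then have m: "Suc m < r" using less.prems(1) by simp
    then have qn: "q \<noteq> 0" using q0 by simp
    let ?bad = "{v. F v = 0} \<union> {v. P v p = 0} \<union> (\<Union>l\<in>{1..m}. {v. P v (z l) = 0})"
    have "finite ?bad" by (auto intro!: finite_one_var_zeros finite_pair_factor_zeros qn)
    then obtain v where v: "v \<in> C" "v \<notin> ?bad" using infinite_C by (meson finite_subset subsetI)
    define z' where "z' = z(Suc m := v)"
    have "(\<Prod>l=1..m. P (z l) v) \<noteq> 0"
      using v by (auto simp: pair_factor_sym[of q v])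
    then have "D_integrand q (Suc m) n k X Y z' \<noteq> 0"
      using less.prems(3) v D_integrand_cong[of m z' z q n k X Y]
      by (auto simp: D_integrand_Suc z'_def)
    moreover have "is_pole (\<lambda>w. F w * (\<Prod>l=1..Suc m. P (z' l) w)) p"
    proof -
      have "is_pole (\<lambda>w. F w * (\<Prod>l=1..m. P (z l) w) * P v w) p"
        by (rule is_pole_mult_analytic_nonzero2[OF less.prems(4) pair_factor_analytic_nonzero])
          (use v in auto)
      then show ?thesis by (simp add: z'_def mult.assoc)
    qed
    moreover have "z' l \<in> C" if "l \<in> {1..Suc m}" for l
      using that less.prems(2)[of l] v by (auto simp: z'_def)
    ultimately show ?thesis
      using less.hyps[of "Suc m" z'] m by auto
  qed
qed

lemma one_var_pole: "j \<in> {1..n} \<Longrightarrow> p \<in> K j \<Longrightarrow> is_pole F p \<Longrightarrow> p = X j"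
  using pole_extend[of j p 0] r by (simp add: D_integrand_factor)

lemma one_var_X [simp]: "j \<in> {1..n} \<Longrightarrow> F (X j) = 0"
  using one_var_nonzero(3)[of q n k X Y "X j" j] by blast

text \<open>
  The factor \<open>1 / z\<close> of the measure makes \<open>0\<close> a pole. So no curve encloses \<open>0\<close>, and the maps
  that send a point to its partners are defined on everything that the curves enclose.
\<close>

lemma zero_outside:
  assumes "j \<in> {1..n}" shows "0 \<notin> K j"
proof
  assume "0 \<in> K j"
  define G where "G = (\<lambda>z. (1 - q * z\<^sup>2) / (1 - z\<^sup>2) *
     (\<Prod>j=1..n. ((q * z - X j) * (1 - z * X j)) / ((z - X j) * (1 - q * z * X j))) *
     (\<Prod>j=1..k. (1 - z * Y j) / (1 - q * z * Y j)))"
  have "G analytic_on {0}"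
    unfolding G_def by (intro analytic_intros) (use x_pos in \<open>auto simp: less_imp_neq[symmetric]\<close>)
  moreover have "G 0 \<noteq> 0"
    using x_pos by (auto simp: G_def less_imp_neq[symmetric])
  moreover have "is_pole (\<lambda>z :: complex. 1 / (z - 0)) 0" by (rule is_pole_inverse)
  ultimately have "is_pole (\<lambda>z. G z * (1 / z)) 0"
    by (intro is_pole_mult_analytic_nonzero1) auto
  moreover have "F = (\<lambda>z. G z * (1 / z))" by (simp add: one_var_def G_def fun_eq_iff)
  ultimately have "0 = X j" using one_var_pole[OF assms \<open>0 \<in> K j\<close>] by simp
  then show False using x_pos[OF assms] by simp
qed

text \<open>
  The excluded points are those at which \<open>F\<close> or the numerator of \<open>P\<close> might cancel the pole that
  \<open>P w\<close> has at a partner of \<open>w\<close>. In particular partners equal to some \<open>x j\<close> are excluded, as \<open>F\<close>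
  takes the value \<open>0\<close> there by convention. Where \<open>F w\<close> vanishes the whole integrand may vanish, so
  these points are excluded as well.
\<close>

lemma partners_avoid_generic:
  assumes "2 \<le> r"
  shows "\<exists>B. finite B \<and> (\<forall>w\<in>C - B. w \<noteq> 0 \<and> (\<forall>j\<in>{1..n}. \<forall>p\<in>partners q w. p \<notin> K j))"
proof -
  note qn = q0[OF assms]
  define B where "B = {0} \<union> {w. F w = 0} \<union> {w. 1 * w\<^sup>2 = 1} \<union> {w. q\<^sup>2 * w\<^sup>2 = 1} \<union>
     {w. \<exists>p\<in>partners q w. p \<in> {z. F z = 0}}"
  have "finite B"
    unfolding B_def using qn
    by (intro finite_UnI finite_partner_preimage finite_one_var_zeros finite_square_roots) auto
  moreover have "p \<notin> K j" if w: "w \<in> C" "w \<notin> B" and j: "j \<in> {1..n}" and p: "p \<in> partners q w" for w j p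
  proof
    assume pK: "p \<in> K j"
    have Fp: "F p \<noteq> 0" and Fw: "F w \<noteq> 0" and w': "w \<noteq> 0" "w\<^sup>2 \<noteq> 1" "(q * w)\<^sup>2 \<noteq> 1"
      using w p by (auto simp: B_def power_mult_distrib)
    have "q \<noteq> 1" using q by auto
    then have "is_pole (P w) p" using pair_factor_pole[OF qn _ w' p] by blast
    then have "is_pole (\<lambda>z. F z * P w z) p"
      by (intro is_pole_mult_analytic_nonzero1 one_var_analytic Fp)
    then have "p = X j"
      using pole_extend[OF j pK, of 1 "\<lambda>_. w"] assms w Fw
      by (simp add: D_integrand_factor pairs_prod_def)
    then show False using Fp j by simp
  qed
  moreover have "w \<noteq> 0" if "w \<notin> B" for w using that by (auto simp: B_def)
  ultimately show ?thesis by (intro exI[of _ B]) blast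
qed

text \<open>
  The step from points on the contour to the points \<open>x i\<close> inside it. It guarantees that after a residue
  has been taken at \<open>x i\<close>, the factor \<open>P (x i)\<close> in the remaining variables has no poles
  enclosed by the curves. It also shows \<open>q x i \<noteq> x j\<close>.
\<close>

lemma partners_avoid_x:
  assumes r2: "2 \<le> r" and i: "i \<in> {1..n}" and j: "j \<in> {1..n}" and p: "p \<in> partners q (X i)"
  shows "p \<notin> K j"
proof -
  obtain B where B: "finite B" "\<And>w l p. w \<in> C - B \<Longrightarrow> l \<in> {1..n} \<Longrightarrow> p \<in> partners q w \<Longrightarrow> p \<notin> K l"
    using partners_avoid_generic[OF r2] by blast
  obtain b b' where b: "p = b (X i)" and bb: "\<And>z. z \<noteq> 0 \<Longrightarrow> isCont b z \<and> isCont b' z \<and> b' (b z) = z \<and>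
           b z \<in> partners q z \<and> b' z \<in> partners q z"
    using partners_maps[OF q0[OF r2] p] by blast
  have nz: "z \<noteq> 0" if "z \<in> K l" "l \<in> {1..n}" for z l using zero_outside that by blast
  show ?thesis
    unfolding b
  proof (rule jordan_avoid[where b = b and b' = b' and B = B and g = "\<gamma> i" and h = "\<gamma> j" and p = "X i"])
    show "continuous_on (K i) b"
      using bb nz[OF _ i] by (intro continuous_at_imp_continuous_on) blast
    show "isCont b' w" if "w \<in> path_image (\<gamma> j)" for w
      using bb nz[of w j] that j by blast
    show "b' (b z) = z" if "z \<in> K i" for z using bb nz[OF that i] by blast
    show "b z \<notin> K j" if "z \<in> path_image (\<gamma> i) - B" for z
      using B(2)[of z j "b z"] bb[of z] nz[of z i] that i j by blast
    show "b' w \<notin> K i" if "w \<in> path_image (\<gamma> j) - B" for w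
      using B(2)[of w i "b' w"] bb[of w] nz[of w j] that i j by blast
  qed (use contour i j B(1) in auto)
qed

section \<open>Evaluation of the iterated integral\<close>

text \<open>
  The function \<open>F\<close> with the factor \<open>1 / (z - x j)\<close> removed, so that its value at \<open>x j\<close> is the residue of
  \<open>F\<close> there.
\<close>

definition residue_factor :: "nat \<Rightarrow> complex \<Rightarrow> complex" where
  "residue_factor j z = (1 - q * z\<^sup>2) / (1 - z\<^sup>2) *
     ((q * z - X j) * (1 - z * X j) / (1 - q * z * X j)) *
     (\<Prod>l\<in>{1..n} - {j}. ((q * z - X l) * (1 - z * X l)) / ((z - X l) * (1 - q * z * X l))) *
     (\<Prod>l=1..k. (1 - z * Y l) / (1 - q * z * Y l)) * (1 / z)"

abbreviation "\<rho> \<equiv> \<lambda>j. residue_factor j (X j)"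

lemma one_var_residue_factor:
  assumes "j \<in> {1..n}" shows "F z = residue_factor j z / (z - X j)"
proof -
  have "(\<Prod>l=1..n. ((q * z - X l) * (1 - z * X l)) / ((z - X l) * (1 - q * z * X l))) =
     ((q * z - X j) * (1 - z * X j)) / ((z - X j) * (1 - q * z * X j)) *
     (\<Prod>l\<in>{1..n} - {j}. ((q * z - X l) * (1 - z * X l)) / ((z - X l) * (1 - q * z * X l)))"
    using assms by (intro prod.remove) auto
  then show ?thesis by (simp add: one_var_def residue_factor_def mult_ac)
qed

lemma residue_factor_analytic:
  assumes "1 - z\<^sup>2 \<noteq> 0" "z \<noteq> 0" "\<And>l. l \<in> {1..n} - {j} \<Longrightarrow> z \<noteq> X l" "j \<in> {1..n}"
    "\<And>l. l \<in> {1..n} \<Longrightarrow> 1 - q * z * X l \<noteq> 0" "\<And>l. l \<in> {1..k} \<Longrightarrow> 1 - q * z * Y l \<noteq> 0"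
  shows "residue_factor j analytic_on {z}"
  unfolding residue_factor_def[abs_def] using assms by (intro analytic_intros) auto

lemma residue_factor_analytic_X:
  assumes "j \<in> {1..n}" shows "residue_factor j analytic_on {X j}"
proof (rule residue_factor_analytic)
  show "X j \<noteq> X l" if "l \<in> {1..n} - {j}" for l
    using inj_on_eq_iff[OF x_inj assms, of l] that by auto
  show "X j \<noteq> 0" using x_pos[OF assms] by simp
qed (use assms in \<open>simp_all only: denominators_nonzero simp_thms\<close>)

text \<open>
  Apart from \<open>x j\<close> the function \<open>F\<close> has no poles on or inside the \<open>j\<close>-th curve, but it may have
  removable singularities there, where a zero of the numerator cancels one of the denominator. They are
  removed before the integral formula of Cauchy is applied.
\<close>

lemma one_var_integral:
  assumes j: "j \<in> {1..n}" and h: "h analytic_on K j" and B: "finite B"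
    and f: "\<And>z. z \<in> path_image (\<gamma> j) - B \<Longrightarrow> f z = F z * h z"
  shows "(f has_contour_integral (2 * pi * \<i> * (\<rho> j * h (X j)))) (\<gamma> j)"
proof -
  define \<Phi> where "\<Phi> = remove_sings (residue_factor j)"
  have mero: "residue_factor j meromorphic_on UNIV"
    unfolding residue_factor_def[abs_def] by (intro meromorphic_intros)
  have nopole: "\<not> is_pole (residue_factor j) p" if p: "p \<in> K j" for p
  proof
    assume pole: "is_pole (residue_factor j) p"
    have ne: "p \<noteq> X j"
      using pole residue_factor_analytic_X[OF j] analytic_at_imp_no_pole by blast
    have "is_pole (\<lambda>z. residue_factor j z * (1 / (z - X j))) p"
      using pole ne by (intro is_pole_mult_analytic_nonzero2) (auto intro!: analytic_intros)
    then have "is_pole F p"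
      by (rule is_pole_transform) (simp_all add: one_var_residue_factor[OF j])
    then show False using one_var_pole[OF j p] ne by blast
  qed
  have "\<Phi> analytic_on {p}" if "p \<in> K j" for p
    unfolding \<Phi>_def
  proof (rule nicely_meromorphic_on_imp_analytic_at)
    show "remove_sings (residue_factor j) nicely_meromorphic_on UNIV"
      by (rule remove_sings_nicely_meromorphic[OF mero])
    have "isolated_singularity_at (residue_factor j) p"
      using mero by (meson UNIV_I meromorphic_on_isolated_singularity meromorphic_on_subset subset_UNIV)
    then show "\<not> is_pole (remove_sings (residue_factor j)) p" using nopole[OF that] by simp
  qed simp
  then have an: "\<Phi> analytic_on K j" using analytic_on_analytic_at by blast
  define E where "E = {0} \<union> {z. 1 * z\<^sup>2 = 1} \<union> (\<Union>l\<in>{1..n}. {X l} \<union> {z. (q * X l) * z = 1}) \<union>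
     (\<Union>l\<in>{1..k}. {z. (q * Y l) * z = 1})"
  have "finite E"
    unfolding E_def by (intro finite_UnI finite_UN_I finite_square_roots finite_linear_roots) auto
  have \<Phi>: "\<Phi> z = residue_factor j z" if "z \<notin> E" for z
    unfolding \<Phi>_def
    by (rule remove_sings_at_analytic, rule residue_factor_analytic)
       (use that j in \<open>auto simp: E_def mult_ac\<close>)
  have \<Phi>X: "\<Phi> (X j) = \<rho> j"
    unfolding \<Phi>_def using residue_factor_analytic_X[OF j] by simp
  have "((\<lambda>z. \<Phi> z * h z / (z - X j)) has_contour_integral (2 * pi * \<i> * (\<Phi> (X j) * h (X j)))) (\<gamma> j)"
    by (rule has_contour_integral_simple_pole) (use contour[OF j] an h in \<open>auto intro!: analytic_intros\<close>)
  then show ?thesis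
    unfolding \<Phi>X
  proof (rule has_contour_integral_finite_change[rotated])
    show "finite (B \<union> E)" using B \<open>finite E\<close> by simp
    show "f z = \<Phi> z * h z / (z - X j)" if "z \<in> path_image (\<gamma> j) - (B \<union> E)" for z
      using that f[of z] \<Phi>[of z] by (simp add: one_var_residue_factor[OF j])
  qed (use contour[OF j] in auto)
qed

text \<open>
  The iterated residue at the points \<open>x i\<close>, \<open>i \<in> I\<close>, in any order. The additional function \<open>h\<close>
  collects the interaction with variables that have not been integrated yet.
\<close>

definition residue_term :: "(complex \<Rightarrow> complex) \<Rightarrow> nat set \<Rightarrow> complex" where
  "residue_term h I = (\<Prod>i\<in>I. \<rho> i * h (X i)) * pairs_prod (\<lambda>i j. P (X i) (X j)) I"

lemma residue_term_insert:
  assumes "finite I" "j \<notin> I"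
  shows "residue_term h (insert j I) = \<rho> j * h (X j) * residue_term (\<lambda>z. h z * P (X j) z) I"
  using assms
  by (simp add: residue_term_def pairs_prod_insert pair_factor_sym[of q "X j"] prod.distrib mult_ac)

lemma residue_term_vanish:
  assumes "finite I" "j \<in> I"
  shows "residue_term (\<lambda>z. h z * P (X j) z) I = 0"
proof -
  have "(\<Prod>i\<in>I. \<rho> i * (h (X i) * P (X j) (X i))) = 0"
    using assms by (intro prod_zero bexI[of _ j]) auto
  then show ?thesis by (simp add: residue_term_def)
qed

text \<open>
  The outermost variable \<open>w\<close> enters the inner integral only through the factors \<open>P w\<close>, which are absorbed
  into \<open>h\<close>; this is why the induction runs over arbitrary \<open>h\<close>. The inner integral is thereby evaluated
  for all but finitely many \<open>w\<close> on the contour, and the result, as a function of \<open>w\<close>, is again \<open>F\<close>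
  times a function that is analytic where it matters. Taking the residue at \<open>x j\<close> enlarges the
  index set by \<open>j\<close>, and vanishes if \<open>j\<close> occurs already.
\<close>

theorem iterated_integral_residues:
  assumes "m \<le> r" and "\<And>j. j \<in> {1..n} \<Longrightarrow> h analytic_on K j"
    and "\<And>z'. (\<And>i. i \<notin> {1..m} \<Longrightarrow> z' i = z i) \<Longrightarrow>
        G z' = c * (\<Prod>l=1..m. F (z' l) * h (z' l)) * pairs_prod (\<lambda>i j. P (z' i) (z' j)) {1..m}"
  shows "iterated_contour_integral n \<gamma> m G z =
     c * ((2 * pi * \<i>) ^ m * fact m * (\<Sum>I | I \<subseteq> {1..n} \<and> card I = m. residue_term h I))"
  using assms
proof (induction m arbitrary: h z c)
  case 0
  have "{I. I \<subseteq> {1..n} \<and> card I = 0} = {{}}" by (auto dest: finite_subset)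
  then show ?case using 0(3)[of z] by (simp add: residue_term_def)
next
  case (Suc m)
  let ?S = "{I. I \<subseteq> {1..n} \<and> card I = m}"
  let ?c = "(2 * pi * \<i>) ^ m * fact m :: complex"
  have finI: "finite I" if "I \<in> ?S" for I using that finite_subset by blast
  have G: "G z' = (c * (F w * h w)) * (\<Prod>l=1..m. F (z' l) * (h (z' l) * P w (z' l))) *
        pairs_prod (\<lambda>i j. P (z' i) (z' j)) {1..m}"
    if z': "\<And>i. i \<notin> {1..m} \<Longrightarrow> z' i = (z(Suc m := w)) i" for z' w
  proof -
    have w: "z' (Suc m) = w" using z'[of "Suc m"] by simp
    have "{1..Suc m} = insert (Suc m) {1..m}" by auto
    then have "pairs_prod (\<lambda>i j. P (z' i) (z' j)) {1..Suc m}
        = pairs_prod (\<lambda>i j. P (z' i) (z' j)) {1..m} * (\<Prod>l=1..m. P w (z' l))"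
      by (simp add: pairs_prod_insert pair_factor_sym w)
    moreover have "G z' = c * (\<Prod>l=1..Suc m. F (z' l) * h (z' l)) * pairs_prod (\<lambda>i j. P (z' i) (z' j)) {1..Suc m}"
      by (rule Suc.prems(3)) (use z' in auto)
    ultimately show ?thesis by (simp add: w prod.distrib mult_ac)
  qed
  define H where "H = (\<lambda>w. h w * (c * (?c * (\<Sum>I\<in>?S. residue_term (\<lambda>z. h z * P w z) I))))"
  obtain B where B: "finite B" "\<And>w. w \<in> C - B \<Longrightarrow> iterated_contour_integral n \<gamma> m G (z(Suc m := w)) = F w * H w"
  proof (cases "m = 0")
    case True
    have S: "?S = {{}}" using True by (auto dest: finite_subset)
    have "iterated_contour_integral n \<gamma> m G (z(Suc m := w)) = F w * H w" for w
      using G[of "z(Suc m := w)" w] unfolding H_def S by (simp add: True residue_term_def)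
    then show thesis using that[of "{}"] by blast
  next
    case False
    then have r2: "2 \<le> r" using Suc.prems(1) by simp
    obtain B where B: "finite B" "\<And>w. w \<in> C - B \<Longrightarrow> w \<noteq> 0"
        "\<And>w l p. w \<in> C - B \<Longrightarrow> l \<in> {1..n} \<Longrightarrow> p \<in> partners q w \<Longrightarrow> p \<notin> K l"
      using partners_avoid_generic[OF r2] by blast
    have "iterated_contour_integral n \<gamma> m G (z(Suc m := w)) = F w * H w" if w: "w \<in> C - B" for w
    proof -
      have "iterated_contour_integral n \<gamma> m G (z(Suc m := w)) =
          (c * (F w * h w)) * (?c * (\<Sum>I\<in>?S. residue_term (\<lambda>z. h z * P w z) I))"
      proof (rule Suc.IH)
        fix j assume j: "j \<in> {1..n}"
        have "P w analytic_on K j"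
          using B(2,3)[OF w] j by (intro pair_factor_analytic q0[OF r2]) blast+
        then show "(\<lambda>z. h z * P w z) analytic_on K j"
          using Suc.prems(2)[OF j] by (intro analytic_intros)
      qed (use Suc.prems(1) G in auto)
      then show ?thesis by (simp add: H_def mult_ac)
    qed
    then show thesis using that B(1) by blast
  qed
  have H: "H analytic_on K j" if j: "j \<in> {1..n}" for j
  proof -
    have "(\<lambda>w. P w (X i)) analytic_on K j" if i: "i \<in> I" and I: "I \<in> ?S" for i I
    proof -
      have "card I \<noteq> 0" using i finI[OF I] by auto
      then have r2: "2 \<le> r" using I Suc.prems(1) by auto
      have i': "i \<in> {1..n}" using i I by auto
      have "P (X i) analytic_on K j"
        using partners_avoid_x[OF r2 i' j] x_pos[OF i'] by (intro pair_factor_analytic q0[OF r2]) auto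
      then show ?thesis by (simp add: pair_factor_sym[of q _ "X i"])
    qed
    then show ?thesis
      unfolding H_def residue_term_def using Suc.prems(2)[OF j] by (intro analytic_intros) auto
  qed
  have "contour_integral (\<gamma> j) (\<lambda>w. iterated_contour_integral n \<gamma> m G (z(Suc m := w)))
      = 2 * pi * \<i> * (\<rho> j * H (X j))" if "j \<in> {1..n}" for j
    by (rule contour_integral_unique, rule one_var_integral[OF that H[OF that] B(1)]) (use B(2) that in blast)
  then have "iterated_contour_integral n \<gamma> (Suc m) G z = (\<Sum>j\<in>{1..n}. 2 * pi * \<i> * (\<rho> j * H (X j)))"
    by (simp add: multi_contour_integral_def)
  also have "\<dots> = (\<Sum>j\<in>{1..n}. 2 * pi * \<i> * c * ?c *
      (\<Sum>I | I \<subseteq> {1..n} - {j} \<and> card I = m. residue_term h (insert j I)))"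
  proof (rule sum.cong[OF refl])
    fix j assume j: "j \<in> {1..n}"
    have "\<rho> j * h (X j) * (\<Sum>I\<in>?S. residue_term (\<lambda>z. h z * P (X j) z) I)
        = \<rho> j * h (X j) * (\<Sum>I | I \<subseteq> {1..n} - {j} \<and> card I = m. residue_term (\<lambda>z. h z * P (X j) z) I)"
      by (intro arg_cong2[where f = "(*)"] refl sum.mono_neutral_right)
         (auto intro!: residue_term_vanish intro: finite_subset[of _ "Pow {1..n}"] finite_subset)
    also have "\<dots> = (\<Sum>I | I \<subseteq> {1..n} - {j} \<and> card I = m. residue_term h (insert j I))"
      unfolding sum_distrib_left
      by (intro sum.cong refl residue_term_insert[symmetric]) (auto intro: finite_subset)
    finally show "2 * pi * \<i> * (\<rho> j * H (X j)) = 2 * pi * \<i> * c * ?c *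
      (\<Sum>I | I \<subseteq> {1..n} - {j} \<and> card I = m. residue_term h (insert j I))"
      by (simp add: H_def mult_ac)
  qed
  also have "\<dots> = 2 * pi * \<i> * c * ?c * (of_nat (Suc m) *
      (\<Sum>I | I \<subseteq> {1..n} \<and> card I = Suc m. residue_term h I))"
    by (simp only: sum_distrib_left[symmetric] sum_insert_subsets[OF finite_atLeastAtMost])
  finally show ?case by (simp add: mult_ac)
qed

corollary D_integral_residues:
  "iterated_contour_integral n \<gamma> r (D_integrand q r n k X Y) z =
     (2 * pi * \<i>) ^ r * fact r * (\<Sum>I | I \<subseteq> {1..n} \<and> card I = r. residue_term (\<lambda>_. 1) I)"
  using iterated_integral_residues[of r "\<lambda>_. 1" z "D_integrand q r n k X Y" 1]
  by (simp add: D_integrand_factor)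

section \<open>Comparison with the Macdonald operator\<close>

abbreviation "swap_ratio \<equiv> \<lambda>i j. (1 - X i * X j) / (1 - q\<^sup>2 * X i * X j)"
abbreviation "cross_ratio \<equiv> \<lambda>i j. (1 - X i * X j) / (1 - q * X i * X j)"
abbreviation "y_ratio \<equiv> \<lambda>i l. (1 - X i * Y l) / (1 - q * X i * Y l)"

lemma unshifted_nonzero:
  "i \<in> {1..n} \<Longrightarrow> j \<in> {1..n} \<Longrightarrow> 1 - X i * X j \<noteq> 0"
  "i \<in> {1..n} \<Longrightarrow> l \<in> {1..k} \<Longrightarrow> 1 - X i * Y l \<noteq> 0"
proof -
  show "1 - X i * X j \<noteq> 0" if "i \<in> {1..n}" "j \<in> {1..n}"
  proof -
    have "x i * x j < 1" using x_pos[OF that(1)] x_less[OF that(1)] x_pos[OF that(2)] x_less[OF that(2)]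
      by (metis less_eq_real_def mult_left_le_one_le order_le_less_trans)
    then have "complex_of_real (1 - x i * x j) \<noteq> 0" unfolding of_real_eq_0_iff by simp
    then show ?thesis by simp
  qed
  show "1 - X i * Y l \<noteq> 0" if "i \<in> {1..n}" "l \<in> {1..k}"
  proof -
    have "complex_of_real (1 - x i * y l) \<noteq> 0" unfolding of_real_eq_0_iff using xy_less[OF that] by simp
    then show ?thesis by simp
  qed
qed

lemma residue_value:
  assumes i: "i \<in> {1..n}"
  shows "\<rho> i = (q - 1) * (\<Prod>l\<in>{1..n} - {i}. ((q * X i - X l) / (X i - X l)) * cross_ratio i l) *
           (\<Prod>l=1..k. y_ratio i l)"
proof -
  have nz: "X i \<noteq> 0" "1 - (X i)\<^sup>2 \<noteq> 0" "1 - q * (X i)\<^sup>2 \<noteq> 0"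
    using x_pos[OF i] denominators_nonzero(3)[OF i] denominators_nonzero(1)[OF i i] by (auto simp: power2_eq_square mult.assoc)
  define D E where "D = 1 - q * (X i)\<^sup>2" and "E = 1 - (X i)\<^sup>2"
  have e: "q * X i - X i = (q - 1) * X i" "1 - X i * X i = E" "1 - q * X i * X i = D"
    by (simp_all add: D_def E_def algebra_simps power2_eq_square)
  have "D / E * ((q - 1) * X i * E / D) * (1 / X i) = q - 1"
    using nz unfolding D_def[symmetric] E_def[symmetric] by simp
  then have lead: "(1 - q * (X i)\<^sup>2) / (1 - (X i)\<^sup>2) *
     ((q * X i - X i) * (1 - X i * X i) / (1 - q * X i * X i)) * (1 / X i) = q - 1"
    unfolding e by (simp only: D_def E_def)
  show ?thesis
    unfolding residue_factor_def lead[symmetric] times_divide_times_eq[symmetric, of "q * X i - X _"]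
    by (simp only: mult_ac)
qed

lemma q_shift_distinct:
  assumes "2 \<le> r" "i \<in> {1..n}" "j \<in> {1..n}"
  shows "q * X i - X j \<noteq> 0"
  using partners_avoid_x[OF assms, of "q * X i"] contour(4)[OF assms(3)]
  by (auto simp: partners_def)

text \<open>
  The residue factors of two selected indices and the interaction between them combine into the
  change of \<open>1 / (1 - x i x j)\<close> under the shift of both variables. The factors \<open>q x i - x j\<close>
  that cancel are non-zero by \<open>q_shift_distinct\<close>.
\<close>

lemma swap_ratio_eq:
  assumes "2 \<le> r" and i: "i \<in> {1..n}" and j: "j \<in> {1..n}" and ne: "i \<noteq> j"
  shows "((q * X i - X j) / (X i - X j)) * cross_ratio i j *
      (((q * X j - X i) / (X j - X i)) * cross_ratio j i) * P (X i) (X j) = swap_ratio i j"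
proof -
  define a b where "a = X i" and "b = X j"
  have ne': "a - b \<noteq> 0" "b - a \<noteq> 0"
    using inj_on_eq_iff[OF x_inj i j] ne by (auto simp: a_def b_def)
  have nz: "q * a - b \<noteq> 0" "q * b - a \<noteq> 0" "1 - a * b \<noteq> 0" "1 - q * a * b \<noteq> 0"
    using q_shift_distinct[OF assms(1)] unshifted_nonzero(1)[OF i j] denominators_nonzero(1)[OF i j] i j
    by (auto simp: a_def b_def)
  define A B D E where "A = q * a - b" and "B = q * b - a" and "D = 1 - a * b" and "E = 1 - q * a * b"
  have e: "1 - b * a = D" "1 - q * b * a = E" by (auto simp: D_def E_def mult_ac)
  have "A / (a - b) * (D / E) * (B / (b - a) * (D / E)) *
      ((a - b) * E * ((b - a) * E) / (A * B * ((1 - q\<^sup>2 * a * b) * D))) = D / (1 - q\<^sup>2 * a * b)"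
    using ne' nz unfolding A_def[symmetric] B_def[symmetric] D_def[symmetric] E_def[symmetric]
    by (simp add: divide_simps)
  then show ?thesis
    unfolding pair_factor_def a_def[symmetric] b_def[symmetric] e
    by (simp add: A_def B_def D_def E_def)
qed

lemma residue_term_value:
  assumes I: "I \<subseteq> {1..n}" "card I = r"
  shows "residue_term (\<lambda>_. 1) I = (q - 1) ^ r *
     (\<Prod>i\<in>I. \<Prod>j\<in>{1..n} - I. (q * X i - X j) / (X i - X j)) *
     (pairs_prod swap_ratio I * (\<Prod>i\<in>I. \<Prod>j\<in>{1..n} - I. cross_ratio i j) *
      (\<Prod>i\<in>I. \<Prod>l=1..k. y_ratio i l))"
proof -
  have fin: "finite I" using I(1) finite_subset by blast
  define g where "g = (\<lambda>i j. ((q * X i - X j) / (X i - X j)) * cross_ratio i j)"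
  have "(\<Prod>i\<in>I. \<rho> i) = (\<Prod>i\<in>I. (q - 1) * ((\<Prod>l\<in>I - {i}. g i l) * (\<Prod>l\<in>{1..n} - I. g i l)) *
           (\<Prod>l=1..k. y_ratio i l))"
  proof (rule prod.cong[OF refl])
    fix i assume i: "i \<in> I"
    have "(\<Prod>l\<in>{1..n} - {i}. g i l) = (\<Prod>l\<in>(I - {i}) \<union> ({1..n} - I). g i l)"
      using i I(1) by (intro prod.cong) auto
    also have "\<dots> = (\<Prod>l\<in>I - {i}. g i l) * (\<Prod>l\<in>{1..n} - I. g i l)"
      using fin by (intro prod.union_disjoint) auto
    finally show "\<rho> i = (q - 1) * ((\<Prod>l\<in>I - {i}. g i l) * (\<Prod>l\<in>{1..n} - I. g i l)) *
           (\<Prod>l=1..k. y_ratio i l)"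
      using residue_value[of i] i I(1) by (auto simp: g_def)
  qed
  also have "\<dots> = (q - 1) ^ r * (pairs_prod (\<lambda>i j. g i j * g j i) I *
      (\<Prod>i\<in>I. \<Prod>l\<in>{1..n} - I. g i l)) * (\<Prod>i\<in>I. \<Prod>l=1..k. y_ratio i l)"
    unfolding pairs_prod_offdiag[OF fin, symmetric] prod.distrib using I(2) by simp
  finally have \<rho>: "(\<Prod>i\<in>I. \<rho> i) = \<dots>" .
  have cross: "(\<Prod>i\<in>I. \<Prod>l\<in>{1..n} - I. g i l) =
      (\<Prod>i\<in>I. \<Prod>j\<in>{1..n} - I. (q * X i - X j) / (X i - X j)) *
      (\<Prod>i\<in>I. \<Prod>j\<in>{1..n} - I. cross_ratio i j)"
    by (simp only: g_def prod.distrib)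
  have pairs: "pairs_prod (\<lambda>i j. g i j * g j i) I * pairs_prod (\<lambda>i j. P (X i) (X j)) I
      = pairs_prod swap_ratio I"
    unfolding pairs_prod_mult[symmetric]
  proof (rule pairs_prod_cong)
    fix i j assume ij: "i \<in> I" "j \<in> I" "i < j"
    have "card {i, j} \<le> card I" using ij fin by (intro card_mono) auto
    then have "2 \<le> r" using ij I(2) by simp
    then show "g i j * g j i * P (X i) (X j) = swap_ratio i j"
      using ij I(1) unfolding g_def by (intro swap_ratio_eq) auto
  qed
  show ?thesis
    unfolding residue_term_def mult_1_right \<rho> cross pairs[symmetric] by (simp only: mult_ac)
qed

text \<open>
  Pairs inside \<open>I\<close> are scaled by \<open>q\<^sup>2\<close>, pairs between \<open>I\<close> and its complement by \<open>q\<close>, and the other pairs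
  not at all; likewise for the factors that contain some \<open>y l\<close>.
\<close>

lemma product_shift_ratio:
  assumes I: "I \<subseteq> {1..n}"
  defines "u \<equiv> \<lambda>i. if i \<in> I then q * X i else X i"
  shows "(\<Prod>j=1..n. \<Prod>i=1..<j. 1 / (1 - u i * u j)) * (\<Prod>j=1..k. \<Prod>i=1..n. 1 / (1 - u i * Y j)) =
     (\<Prod>j=1..n. \<Prod>i=1..<j. 1 / (1 - X i * X j)) * (\<Prod>j=1..k. \<Prod>i=1..n. 1 / (1 - X i * Y j)) *
     (pairs_prod swap_ratio I * (\<Prod>i\<in>I. \<Prod>j\<in>{1..n} - I. cross_ratio i j) *
      (\<Prod>i\<in>I. \<Prod>l=1..k. y_ratio i l))"
proof -
  have fin: "finite I" using I finite_subset by blast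
  let ?J = "{1..n} - I"
  have S: "{1..n} = I \<union> ?J" using I by auto
  have split: "pairs_prod (\<lambda>i j. 1 / (1 - v i * v j)) {1..n} =
     pairs_prod (\<lambda>i j. 1 / (1 - v i * v j)) I * pairs_prod (\<lambda>i j. 1 / (1 - v i * v j)) ?J *
     (\<Prod>i\<in>I. \<Prod>j\<in>?J. 1 / (1 - v i * v j))" for v :: "nat \<Rightarrow> complex"
    by (subst S, rule pairs_prod_Un) (use fin in \<open>auto simp: mult.commute\<close>)
  have "pairs_prod (\<lambda>i j. 1 / (1 - u i * u j)) I
      = pairs_prod (\<lambda>i j. 1 / (1 - X i * X j)) I * pairs_prod swap_ratio I"
    unfolding pairs_prod_mult[symmetric]
  proof (rule pairs_prod_cong)
    fix i j assume ij: "i \<in> I" "j \<in> I"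
    then have "1 - X i * X j \<noteq> 0" using unshifted_nonzero(1) I by blast
    then show "1 / (1 - u i * u j) = 1 / (1 - X i * X j) * swap_ratio i j"
      using ij by (simp add: u_def power2_eq_square mult_ac)
  qed
  moreover have "pairs_prod (\<lambda>i j. 1 / (1 - u i * u j)) ?J = pairs_prod (\<lambda>i j. 1 / (1 - X i * X j)) ?J"
    by (rule pairs_prod_cong) (simp add: u_def)
  moreover have "(\<Prod>i\<in>I. \<Prod>j\<in>?J. 1 / (1 - u i * u j))
      = (\<Prod>i\<in>I. \<Prod>j\<in>?J. 1 / (1 - X i * X j)) * (\<Prod>i\<in>I. \<Prod>j\<in>?J. cross_ratio i j)"
    unfolding prod.distrib[symmetric]
  proof (intro prod.cong refl)
    fix i j assume ij: "i \<in> I" "j \<in> ?J"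
    then have "1 - X i * X j \<noteq> 0" using unshifted_nonzero(1) I by blast
    then show "1 / (1 - u i * u j) = 1 / (1 - X i * X j) * cross_ratio i j"
      using ij by (simp add: u_def)
  qed
  ultimately have 1: "pairs_prod (\<lambda>i j. 1 / (1 - u i * u j)) {1..n} = pairs_prod (\<lambda>i j. 1 / (1 - X i * X j)) {1..n} *
      (pairs_prod swap_ratio I * (\<Prod>i\<in>I. \<Prod>j\<in>?J. cross_ratio i j))"
    unfolding split[of u] split[of X] by (simp only: mult_ac)
  have spliti: "(\<Prod>j=1..k. \<Prod>i=1..n. 1 / (1 - v i * Y j)) =
      (\<Prod>i\<in>I. \<Prod>j=1..k. 1 / (1 - v i * Y j)) * (\<Prod>i\<in>?J. \<Prod>j=1..k. 1 / (1 - v i * Y j))" for v :: "nat \<Rightarrow> complex"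
    by (subst prod.swap, subst S, rule prod.union_disjoint) (use fin in auto)
  have "(\<Prod>i\<in>I. \<Prod>j=1..k. 1 / (1 - u i * Y j))
      = (\<Prod>i\<in>I. \<Prod>j=1..k. 1 / (1 - X i * Y j)) * (\<Prod>i\<in>I. \<Prod>l=1..k. y_ratio i l)"
    unfolding prod.distrib[symmetric]
  proof (intro prod.cong refl)
    fix i j assume ij: "i \<in> I" "j \<in> {1..k}"
    then have "1 - X i * Y j \<noteq> 0" using unshifted_nonzero(2) I by blast
    then show "1 / (1 - u i * Y j) = 1 / (1 - X i * Y j) * y_ratio i j"
      using ij by (simp add: u_def)
  qed
  moreover have "(\<Prod>i\<in>?J. \<Prod>j=1..k. 1 / (1 - u i * Y j)) = (\<Prod>i\<in>?J. \<Prod>j=1..k. 1 / (1 - X i * Y j))"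
    by (intro prod.cong refl) (simp add: u_def)
  ultimately have 2: "(\<Prod>j=1..k. \<Prod>i=1..n. 1 / (1 - u i * Y j)) =
      (\<Prod>j=1..k. \<Prod>i=1..n. 1 / (1 - X i * Y j)) * (\<Prod>i\<in>I. \<Prod>l=1..k. y_ratio i l)"
    unfolding spliti[of u] spliti[of X] by (simp only: mult_ac)
  have sym: "1 / (1 - v i * v j) = 1 / (1 - v j * v i)" for v :: "nat \<Rightarrow> complex" and i j
    by (simp add: mult.commute)
  show ?thesis
    unfolding lower_pairs_prod[of "\<lambda>i j. 1 / (1 - u i * u j)", OF sym]
      lower_pairs_prod[of "\<lambda>i j. 1 / (1 - X i * X j)", OF sym] 1 2
    by (simp only: mult_ac)
qed

lemma macdonald_integral:
  assumes conv: "pf_Z_abs_convergent n k Y X"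
  shows "macdonald_D r q n (pf_Z n k Y) X =
           pf_Z n k Y X * q ^ (r * (r - 1) div 2) /
             (fact r * (2 * complex_of_real pi * \<i>) ^ r * (q - 1) ^ r) *
           iterated_contour_integral n \<gamma> r (D_integrand q r n k X Y) (\<lambda>_. 0)"
proof -
  have x0: "0 \<le> x j" if "j \<in> {1..n}" for j using x_pos[OF that] by simp
  have q1: "q - 1 \<noteq> 0" using q by auto
  note prodZ = pf_Z_qshift_product[OF x0 y_nonneg conv q]
  have Z: "pf_Z n k Y X = (\<Prod>j=1..n. \<Prod>i=1..<j. 1 / (1 - X i * X j)) *
      (\<Prod>j=1..k. \<Prod>i=1..n. 1 / (1 - X i * Y j))"
    using prodZ[where I = "{}"] by simp
  have summand: "(\<Prod>i\<in>I. \<Prod>j\<in>{1..n} - I. (q * X i - X j) / (X i - X j)) * qshifts q I (pf_Z n k Y) X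
      = pf_Z n k Y X / (q - 1) ^ r * residue_term (\<lambda>_. 1) I"
    if I: "I \<subseteq> {1..n}" "card I = r" for I
  proof -
    have "qshifts q I (pf_Z n k Y) X = pf_Z n k Y X *
       (pairs_prod swap_ratio I * (\<Prod>i\<in>I. \<Prod>j\<in>{1..n} - I. cross_ratio i j) *
        (\<Prod>i\<in>I. \<Prod>l=1..k. y_ratio i l))"
      unfolding qshifts_def Z by (rule trans[OF prodZ[where I = I] product_shift_ratio[OF I(1)]])
    then show ?thesis using q1 by (simp add: residue_term_value[OF I])
  qed
  have "macdonald_D r q n (pf_Z n k Y) X = q ^ (r * (r - 1) div 2) *
      (\<Sum>I | I \<subseteq> {1..n} \<and> card I = r. pf_Z n k Y X / (q - 1) ^ r * residue_term (\<lambda>_. 1) I)"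
    unfolding macdonald_D_def
    by (rule arg_cong[where f = "(*) _"], rule sum.cong[OF refl]) (use summand in blast)
  then show ?thesis
    unfolding D_integral_residues sum_distrib_left[symmetric] by (simp add: mult_ac)
qed

end

theorem corollary4p2:
  fixes q :: complex and r n k :: nat and t s :: real
    and x y :: "nat \<Rightarrow> real" and \<gamma> :: "nat \<Rightarrow> real \<Rightarrow> complex"
  defines "X \<equiv> (\<lambda>j. complex_of_real (x j))" and "Y \<equiv> (\<lambda>j. complex_of_real (y j))"
  assumes "cmod q < 1" and "1 \<le> r" and "r \<le> n" and "0 < t" and "0 < s"
    and "inj_on x {1..n}" and "\<forall>j\<in>{1..n}. 0 \<le> x j"
    and "inj_on y {1..k}" and "\<forall>j\<in>{1..k}. 0 \<le> y j"
    and "t < Min (x ` {1..n})" and "Max (x ` {1..n}) < s"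
    and "ereal s \<le> min (INF j\<in>{1..n}. inverse (ereal \<bar>x j\<bar>))
                       (INF j\<in>{1..k}. inverse (ereal (cmod (q * Y j))))"
    and "pf_Z_abs_convergent n k Y X"
    and "admissible_contours q r n k X Y \<gamma>"
  shows "macdonald_D r q n (pf_Z n k Y) X =
           pf_Z n k Y X * q ^ (r * (r - 1) div 2) /
             (fact r * (2 * complex_of_real pi * \<i>) ^ r * (q - 1) ^ r) *
           iterated_contour_integral n \<gamma> r (D_integrand q r n k X Y) (\<lambda>_. 0)"
proof (cases "q = 0 \<and> 2 \<le> r")
  case True
  then have "2 * 1 \<le> r * (r - 1)" by (intro mult_le_mono) auto
  then have z: "q ^ (r * (r - 1) div 2) = 0" using True by simp
  show ?thesis unfolding macdonald_D_def z by simp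
next
  case False
  have x_pos: "0 < x j" if j: "j \<in> {1..n}" for j
  proof -
    have "Min (x ` {1..n}) \<le> x j" using j by simp
    then show ?thesis using assms(6,12) by linarith
  qed
  have x_less: "x j < 1" if j: "j \<in> {1..n}" for j
  proof -
    have "ereal s \<le> inverse (ereal \<bar>x j\<bar>)"
      using assms(14) INF_lower[OF j, of "\<lambda>j. inverse (ereal \<bar>x j\<bar>)"] by (meson min.boundedE order_trans)
    then have s: "s \<le> inverse (x j)" using x_pos[OF j] by simp
    have "x j \<le> Max (x ` {1..n})" using j by simp
    then have "x j < inverse (x j)" using assms(13) s by linarith
    then have "x j * x j < 1" using x_pos[OF j] by (simp add: field_simps)
    then show ?thesis using mult_mono[of 1 "x j" 1 "x j"] by linarith
  qed
  have conv: "pf_Z_abs_convergent n k (\<lambda>j. complex_of_real (y j)) (\<lambda>j. complex_of_real (x j))"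
    using assms(15) unfolding X_def Y_def .
  have xy: "x i * y j < 1" if "i \<in> {1..n}" "j \<in> {1..k}" for i j
    by (rule pf_Z_product_real(2)[OF _ _ conv that(2,1)]) (use assms(9,11) in auto)
  interpret admissible_setup q r n k x y \<gamma>
  proof
    show "1 \<le> n" using assms(4,5) by linarith
    show "q \<noteq> 0" if "2 \<le> r" using False that by blast
    show "0 \<le> y j" if "j \<in> {1..k}" for j using assms(11) that by blast
    show "admissible_contours q r n k (\<lambda>j. complex_of_real (x j)) (\<lambda>j. complex_of_real (y j)) \<gamma>"
      using assms(16) unfolding X_def Y_def .
  qed (fact assms(3,4,8) x_pos x_less xy)+
  show ?thesis
    using macdonald_integral[OF conv] unfolding X_def Y_def .
qed

end
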